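(* Assume that $\sup_{u\in[0,T]}\sum_{k\in\mathbb Z} f(u-k\Delta)<\infty$. Then the sequence $\{\bar A^{(n)}\}_{n\ge 1}$ satisfies a large deviations principle on $D([0,T])$, equipped with the Skorokhod $J_1$ topology, with speed $n$ and good rate function $$I_T(\phi)=\sup_{m\ge1}\ \sup_{0<t_1<\cdots<t_m\le T} I_{t_1,\dots,t_m}\bigl(\phi(t_1),\dots,\phi(t_m)\bigr),\qquad \phi\in D([0,T]),$$ where, for each $0<t_1<\cdots<t_m\le T$ and $x\in\mathbb R^m$, $$I_{t_1,\dots,t_m}(x)=\sup_{\alpha\in\mathbb R^m}\Bigl\{\sum_{\ell=1}^m\alpha_\ell x_\ell-\Lambda_{t_1,\dots,t_m}(\alpha)\Bigr\},\qquad \Lambda_{t_1,\dots,t_m}(\alpha)=\log\mathbb E\exp\Bigl(\sum_{\ell=1}^m\alpha_\ell A(t_\ell)\Bigr).$$ Moreover, the rate function admits the variational representation $$I_T(\phi)=\sup_{\theta\in C([0,T]),\ \gamma\in\mathbb R}\Bigl\{\int_0^T\theta(t)\phi(t)\,dt+\gamma\phi(T)-\Lambda_T(\theta,\gamma)\Bigr\},\qquad \phi\in D([0,T]),$$ where $$\Lambda_T(\theta,\gamma):=\log\mathbb E\exp\Bigl(\int_0^T\theta(t)A(t)\,dt+\gamma A(T)\Bigr).$$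
   Context: Fix $\Delta>0$ and $T>0$. Let $(T_k)_{k\in\mathbb Z}$ be i.i.d. real random variables with distribution function $F$ and probability density $f$. Put $A_k:=k\Delta+T_k$ for $k\in\mathbb Z$, and define the arrival counting process $A(t):=\sum_{k\in\mathbb Z}\mathbf 1_{\{0<A_k\le t\}}$, $t\in[0,T]$, which is nondecreasing with càdlàg paths (almost surely finite). Let $A^{(1)},A^{(2)},\dots$ be i.i.d. copies of the process $A$ and set $\bar A^{(n)}(t):=\frac1n\sum_{i=1}^nA^{(i)}(t)$, $t\in[0,T]$. $D([0,T])$ is the space of càdlàg functions $[0,T]\to\mathbb R$ and $C([0,T])$ is the space of continuous functions $[0,T]\to\mathbb R$. Large deviations principle: random elements $X^{(n)}$ of a topological space $E$ satisfy an LDP with speed $n$ and rate function $I:E\to[0,\infty]$ if $\limsup_{n}\frac1n\log\mathbb P(X^{(n)}\in C)\le-\inf_{x\in C}I(x)$ for every closed $C\subset E$ and $\liminf_n\frac1n\log\mathbb P(X^{(n)}\in G)\ge-\inf_{x\in G}I(x)$ for every open $G\subset E$. The rate function is good if the level sets $\{x:I(x)\le M\}$ are compact for all $M<\infty$. *)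

theory Defs
  imports "HOL-Probability.Probability"
begin

text \<open>Functions on \<open>[0,T]\<close> are represented by \<^term>\<open>extensional {0..T}\<close>, so that equality in
  \<open>cadlag T\<close> is equality on \<open>[0,T]\<close>.\<close>

definition cadlag :: "real \<Rightarrow> (real \<Rightarrow> real) set" where
  "cadlag T = {\<phi> \<in> extensional {0..T}.
     (\<forall>t\<in>{0..<T}. (\<phi> \<longlongrightarrow> \<phi> t) (at_right t)) \<and>
     (\<forall>t\<in>{0<..T}. \<exists>l. (\<phi> \<longlongrightarrow> l) (at_left t))}"

definition time_change :: "real \<Rightarrow> (real \<Rightarrow> real) \<Rightarrow> bool" where
  "time_change T \<mu> \<longleftrightarrow>
     strict_mono_on {0..T} \<mu> \<and> continuous_on {0..T} \<mu> \<and> \<mu> ` {0..T} = {0..T}"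

definition J1_close :: "real \<Rightarrow> (real \<Rightarrow> real) \<Rightarrow> (real \<Rightarrow> real) \<Rightarrow> real \<Rightarrow> bool" where
  "J1_close T \<phi> \<psi> e \<longleftrightarrow>
     (\<exists>\<mu>. time_change T \<mu> \<and> (\<forall>t\<in>{0..T}. \<bar>\<mu> t - t\<bar> \<le> e \<and> \<bar>\<phi> t - \<psi> (\<mu> t)\<bar> \<le> e))"

text \<open>Skorokhod's metric (not the complete Billingsley variant, which induces the same topology).
  The value off \<open>cadlag T\<close> is irrelevant for the topology below.\<close>

definition J1_dist :: "real \<Rightarrow> (real \<Rightarrow> real) \<Rightarrow> (real \<Rightarrow> real) \<Rightarrow> real" where
  "J1_dist T \<phi> \<psi> = (if \<phi> \<in> cadlag T \<and> \<psi> \<in> cadlag T then Inf {e. J1_close T \<phi> \<psi> e} else 0)"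

definition J1_topology :: "real \<Rightarrow> (real \<Rightarrow> real) topology" where
  "J1_topology T = Metric_space.mtopology (cadlag T) (J1_dist T)"

lemma time_change_id: "time_change T (\<lambda>t. t)"
  by (auto simp: time_change_def strict_mono_on_def)

lemma time_change_mem: "time_change T l \<Longrightarrow> t \<in> {0..T} \<Longrightarrow> l t \<in> {0..T}"
  unfolding time_change_def by blast

lemma time_change_comp:
  assumes "time_change T l" "time_change T m"
  shows "time_change T (\<lambda>t. m (l t))"
proof -
  have "(\<lambda>t. m (l t)) ` {0..T} = m ` (l ` {0..T})" by (simp add: image_image)
  also have "\<dots> = {0..T}" using assms by (simp add: time_change_def)
  finally have "(\<lambda>t. m (l t)) ` {0..T} = {0..T}" .
  moreover have "continuous_on {0..T} (\<lambda>t. m (l t))"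
    using assms by (auto simp: time_change_def intro: continuous_on_compose2[of "{0..T}" m])
  moreover have "strict_mono_on {0..T} (\<lambda>t. m (l t))"
    using assms time_change_mem[OF assms(1)]
    unfolding time_change_def strict_mono_on_def by blast
  ultimately show ?thesis by (simp add: time_change_def)
qed

lemma time_change_inverse:
  assumes "time_change T l"
  shows "\<exists>m. time_change T m \<and> (\<forall>t\<in>{0..T}. l (m t) = t)"
proof -
  have sm: "strict_mono_on {0..T} l" and co: "continuous_on {0..T} l" and im: "l ` {0..T} = {0..T}"
    using assms by (auto simp: time_change_def)
  have inj: "inj_on l {0..T}" using sm by (rule strict_mono_on_imp_inj_on)
  define m where "m = the_inv_into {0..T} l"
  have lm: "l (m t) = t" and mm: "m t \<in> {0..T}" if "t \<in> {0..T}" for t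
    using f_the_inv_into_f[OF inj, of t] the_inv_into_into[OF inj, of t "{0..T}"] that im
    unfolding m_def by blast+
  have ml: "m (l t) = t" if "t \<in> {0..T}" for t
    using the_inv_into_f_f[OF inj that] unfolding m_def .
  have "continuous_on (l ` {0..T}) m"
    unfolding m_def by (rule continuous_on_inv_into[OF co compact_Icc inj])
  moreover have "strict_mono_on {0..T} m"
  proof (rule strict_mono_onI)
    fix r s assume *: "r \<in> {0..T}" "s \<in> {0..T}" "r < s"
    show "m r < m s"
    proof (rule ccontr)
      assume "\<not> m r < m s"
      hence "l (m s) \<le> l (m r)"
        using sm mm[OF *(1)] mm[OF *(2)] unfolding strict_mono_on_def
        by (metis linorder_not_less order_le_less)
      thus False using lm * by auto
    qed
  qed
  moreover have "m ` {0..T} = {0..T}"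
  proof
    show "m ` {0..T} \<subseteq> {0..T}" using mm by blast
    show "{0..T} \<subseteq> m ` {0..T}"
    proof
      fix t assume t: "t \<in> {0..T}"
      have "m (l t) \<in> m ` {0..T}" by (rule imageI[OF time_change_mem[OF assms t]])
      thus "t \<in> m ` {0..T}" using ml[OF t] by simp
    qed
  qed
  ultimately show ?thesis using im lm by (auto simp: time_change_def)
qed

lemma time_change_end:
  assumes "0 < T" "time_change T l"
  shows "l T = T"
proof -
  obtain s where s: "s \<in> {0..T}" "l s = T"
    using assms unfolding time_change_def by (metis (no_types) atLeastAtMost_iff imageE
        less_eq_real_def)
  show ?thesis
  proof (cases "s = T")
    case False
    hence "l s < l T" using assms s unfolding time_change_def strict_mono_on_def by auto
    moreover have "l T \<le> T" using time_change_mem[OF assms(2), of T] assms(1) by auto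
    ultimately show ?thesis using s by simp
  qed (use s in simp)
qed

lemma cadlag_bounded:
  assumes "0 < T" "\<phi> \<in> cadlag T"
  shows "\<exists>B. \<forall>t\<in>{0..T}. \<bar>\<phi> t\<bar> \<le> B"
proof -
  define P where "P = (\<lambda>a b. \<exists>B. \<forall>t\<in>{a..b} \<inter> {0..T}. \<bar>\<phi> t\<bar> \<le> B)"
  have "P 0 T"
  proof (rule Bolzano)
    show "0 \<le> T" using assms by simp
  next
    fix a b c :: real assume ab: "P a b" and bc: "P b c"
    obtain B1 where B1: "\<And>t. t \<in> {a..b} \<inter> {0..T} \<Longrightarrow> \<bar>\<phi> t\<bar> \<le> B1" using ab unfolding P_def by blast
    obtain B2 where B2: "\<And>t. t \<in> {b..c} \<inter> {0..T} \<Longrightarrow> \<bar>\<phi> t\<bar> \<le> B2" using bc unfolding P_def by blast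
    have "\<bar>\<phi> t\<bar> \<le> max B1 B2" if "t \<in> {a..c} \<inter> {0..T}" for t
      using B1[of t] B2[of t] that by (cases "t \<le> b") auto
    thus "P a c" unfolding P_def by blast
  next
    fix x assume x: "0 \<le> x" "x \<le> T"
    have "\<exists>d>0. \<exists>B. \<forall>t. x < t \<and> t < x + d \<and> t \<le> T \<longrightarrow> \<bar>\<phi> t\<bar> \<le> B"
    proof (cases "x < T")
      case True
      hence "(\<phi> \<longlongrightarrow> \<phi> x) (at_right x)" using assms x by (auto simp: cadlag_def)
      hence "\<forall>\<^sub>F t in at_right x. dist (\<phi> t) (\<phi> x) < 1" by (rule tendstoD) simp
      then obtain b where b: "b > x" "\<And>t. x < t \<Longrightarrow> t < b \<Longrightarrow> dist (\<phi> t) (\<phi> x) < 1"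
        unfolding eventually_at_right_field by blast
      show ?thesis
        by (rule exI[of _ "b - x"], use b in \<open>simp add: dist_real_def\<close>,
            rule exI[of _ "\<bar>\<phi> x\<bar> + 1"]) (smt (verit) b(2) dist_real_def)
    qed (use x in \<open>auto intro!: exI[of _ 1]\<close>)
    then obtain d1 B1 where d1: "d1 > 0" "\<And>t. x < t \<Longrightarrow> t < x + d1 \<Longrightarrow> t \<le> T \<Longrightarrow> \<bar>\<phi> t\<bar> \<le> B1" by blast
    have "\<exists>d>0. \<exists>B. \<forall>t. x - d < t \<and> t < x \<and> 0 \<le> t \<longrightarrow> \<bar>\<phi> t\<bar> \<le> B"
    proof (cases "0 < x")
      case True
      hence "x \<in> {0<..T}" using x by simp
      then obtain l where "(\<phi> \<longlongrightarrow> l) (at_left x)" using assms(2) unfolding cadlag_def by blast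
      hence "\<forall>\<^sub>F t in at_left x. dist (\<phi> t) l < 1" by (rule tendstoD) simp
      then obtain b where b: "b < x" "\<And>t. b < t \<Longrightarrow> t < x \<Longrightarrow> dist (\<phi> t) l < 1"
        unfolding eventually_at_left_field by blast
      show ?thesis
        by (rule exI[of _ "x - b"], use b in \<open>simp add: dist_real_def\<close>,
            rule exI[of _ "\<bar>l\<bar> + 1"]) (smt (verit) b(2) dist_real_def)
    qed (use x in \<open>auto intro!: exI[of _ 1]\<close>)
    then obtain d2 B2 where d2: "d2 > 0" "\<And>t. x - d2 < t \<Longrightarrow> t < x \<Longrightarrow> 0 \<le> t \<Longrightarrow> \<bar>\<phi> t\<bar> \<le> B2" by blast
    show "\<exists>d>0. \<forall>a b. a \<le> x \<and> x \<le> b \<and> b - a < d \<longrightarrow> P a b"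
    proof (intro exI[of _ "min d1 d2"] conjI allI impI)
      show "0 < min d1 d2" using d1 d2 by simp
      fix a b assume ab: "a \<le> x \<and> x \<le> b \<and> b - a < min d1 d2"
      have "\<bar>\<phi> t\<bar> \<le> max \<bar>\<phi> x\<bar> (max B1 B2)" if "t \<in> {a..b} \<inter> {0..T}" for t
        using d1(2)[of t] d2(2)[of t] that ab by (cases t x rule: linorder_cases) auto
      thus "P a b" unfolding P_def by blast
    qed
  qed
  thus ?thesis by (simp add: P_def)
qed

lemma J1_close_sym:
  assumes "J1_close T \<phi> \<psi> e" shows "J1_close T \<psi> \<phi> e"
proof -
  obtain l where l: "time_change T l"
    "\<And>t. t \<in> {0..T} \<Longrightarrow> \<bar>l t - t\<bar> \<le> e \<and> \<bar>\<phi> t - \<psi> (l t)\<bar> \<le> e"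
    using assms by (auto simp: J1_close_def)
  obtain m where m: "time_change T m" "\<And>t. t \<in> {0..T} \<Longrightarrow> l (m t) = t"
    using time_change_inverse[OF l(1)] by blast
  have "\<bar>m t - t\<bar> \<le> e \<and> \<bar>\<psi> t - \<phi> (m t)\<bar> \<le> e" if "t \<in> {0..T}" for t
    using l(2)[OF time_change_mem[OF m(1) that]] m(2)[OF that] by (simp add: abs_minus_commute)
  thus ?thesis using m(1) by (auto simp: J1_close_def)
qed

lemma J1_close_trans:
  assumes "J1_close T \<phi> \<psi> d" "J1_close T \<psi> \<eta> e" shows "J1_close T \<phi> \<eta> (d + e)"
proof -
  obtain l where l: "time_change T l"
    "\<And>t. t \<in> {0..T} \<Longrightarrow> \<bar>l t - t\<bar> \<le> d \<and> \<bar>\<phi> t - \<psi> (l t)\<bar> \<le> d"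
    using assms by (auto simp: J1_close_def)
  obtain m where m: "time_change T m"
    "\<And>t. t \<in> {0..T} \<Longrightarrow> \<bar>m t - t\<bar> \<le> e \<and> \<bar>\<psi> t - \<eta> (m t)\<bar> \<le> e"
    using assms by (auto simp: J1_close_def)
  have "\<bar>m (l t) - t\<bar> \<le> d + e \<and> \<bar>\<phi> t - \<eta> (m (l t))\<bar> \<le> d + e" if "t \<in> {0..T}" for t
    using l(2)[OF that] m(2)[OF time_change_mem[OF l(1) that]] by linarith
  thus ?thesis using time_change_comp[OF l(1) m(1)] unfolding J1_close_def
    by (intro exI[of _ "\<lambda>t. m (l t)"]) auto
qed

lemma J1_close_nonneg:
  assumes "0 < T" "J1_close T \<phi> \<psi> e" shows "0 \<le> e"
proof -
  obtain l where "\<forall>t\<in>{0..T}. \<bar>l t - t\<bar> \<le> e"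
    using assms(2) unfolding J1_close_def by blast
  hence "\<bar>l 0 - 0\<bar> \<le> e" using assms(1) by (auto dest: bspec[of _ _ 0])
  thus ?thesis by linarith
qed

lemma J1_close_exists:
  assumes "0 < T" "\<phi> \<in> cadlag T" "\<psi> \<in> cadlag T" shows "\<exists>e. J1_close T \<phi> \<psi> e"
proof -
  obtain B1 where B1: "\<And>t. t \<in> {0..T} \<Longrightarrow> \<bar>\<phi> t\<bar> \<le> B1" using cadlag_bounded[OF assms(1,2)] by blast
  obtain B2 where B2: "\<And>t. t \<in> {0..T} \<Longrightarrow> \<bar>\<psi> t\<bar> \<le> B2" using cadlag_bounded[OF assms(1,3)] by blast
  have "\<bar>t - t\<bar> \<le> B1 + B2 \<and> \<bar>\<phi> t - \<psi> t\<bar> \<le> B1 + B2" if "t \<in> {0..T}" for t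
    using B1[OF that] B2[OF that] by linarith
  thus ?thesis using time_change_id unfolding J1_close_def by blast
qed

lemma J1_dist_lessD:
  assumes "0 < T" "\<phi> \<in> cadlag T" "\<psi> \<in> cadlag T" "J1_dist T \<phi> \<psi> < e"
  shows "\<exists>d<e. J1_close T \<phi> \<psi> d"
  using cInf_lessD[of "{e. J1_close T \<phi> \<psi> e}" e] assms J1_close_exists[OF assms(1-3)]
  by (auto simp: J1_dist_def)

lemma J1_dist_le:
  assumes "0 < T" "\<phi> \<in> cadlag T" "\<psi> \<in> cadlag T" "J1_close T \<phi> \<psi> e"
  shows "J1_dist T \<phi> \<psi> \<le> e"
  using assms J1_close_nonneg[OF assms(1)]
  by (auto simp: J1_dist_def intro!: cInf_lower bdd_belowI[of _ 0])

lemma J1_dist_eq_0_imp: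
  assumes T: "0 < T" and \<phi>: "\<phi> \<in> cadlag T" and \<psi>: "\<psi> \<in> cadlag T" and 0: "J1_dist T \<phi> \<psi> = 0"
  shows "\<phi> = \<psi>"
proof (rule extensionalityI[of _ "{0..T}"])
  show "\<phi> \<in> extensional {0..T}" "\<psi> \<in> extensional {0..T}" using \<phi> \<psi> by (auto simp: cadlag_def)
  have cl: "\<exists>l. time_change T l \<and> (\<forall>t\<in>{0..T}. \<bar>l t - t\<bar> < e \<and> \<bar>\<phi> t - \<psi> (l t)\<bar> < e)" if "e > 0" for e
    using J1_dist_lessD[OF T \<phi> \<psi>, of e] 0 that unfolding J1_close_def
    by (metis order_le_less_trans)
  fix t assume t: "t \<in> {0..T}"
  show "\<phi> t = \<psi> t"
  proof (cases "t = T")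
    case True
    have "\<bar>\<phi> T - \<psi> T\<bar> \<le> 0 + e" if "e > 0" for e
      using cl[OF that] time_change_end[OF T] t True by fastforce
    hence "\<bar>\<phi> T - \<psi> T\<bar> \<le> 0" by (rule field_le_epsilon)
    thus ?thesis using True by simp
  next
    case False
    hence tT: "t < T" "0 \<le> t" using t by auto
    have lim: "(\<phi> \<longlongrightarrow> \<phi> t) (at_right t)" "(\<psi> \<longlongrightarrow> \<psi> t) (at_right t)"
      using \<phi> \<psi> tT by (auto simp: cadlag_def)
    have "(\<phi> \<longlongrightarrow> \<psi> t) (at_right t)"
    proof (rule tendstoI)
      fix e :: real assume e: "e > 0"
      have "\<forall>\<^sub>F s in at_right t. dist (\<psi> s) (\<psi> t) < e / 2" using lim(2) e by (intro tendstoD) auto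
      then obtain b where b: "b > t" "\<And>s. t < s \<Longrightarrow> s < b \<Longrightarrow> dist (\<psi> s) (\<psi> t) < e / 2"
        unfolding eventually_at_right_field by blast
      have "dist (\<phi> s) (\<psi> t) < e" if s: "t < s" "s < min b T" for s
      proof -
        have "0 < min (e / 2) (min (s - t) (b - s))" using e s by simp
        from cl[OF this] obtain l where l: "\<bar>l s - s\<bar> < min (e / 2) (min (s - t) (b - s))"
          "\<bar>\<phi> s - \<psi> (l s)\<bar> < min (e / 2) (min (s - t) (b - s))"
          using s tT by (meson atLeastAtMost_iff less_eq_real_def min_less_iff_conj order_trans)
        have "dist (\<psi> (l s)) (\<psi> t) < e / 2" using l(1) by (intro b(2)) (auto simp: abs_if split: if_splits)
        moreover have "\<bar>\<phi> s - \<psi> (l s)\<bar> < e / 2" using l(2) by simp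
        ultimately show ?thesis unfolding dist_real_def by linarith
      qed
      thus "\<forall>\<^sub>F s in at_right t. dist (\<phi> s) (\<psi> t) < e"
        unfolding eventually_at_right_field using b(1) tT by (intro exI[of _ "min b T"]) auto
    qed
    thus ?thesis using lim(1) tendsto_unique[OF trivial_limit_at_right_real] by blast
  qed
qed

lemma Metric_space_J1:
  assumes T: "0 < T"
  shows "Metric_space (cadlag T) (J1_dist T)"
proof
  have nn: "0 \<le> J1_dist T x y" for x y
  proof (cases "x \<in> cadlag T \<and> y \<in> cadlag T")
    case True
    hence "{e. J1_close T x y e} \<noteq> {}" using J1_close_exists[OF T] by blast
    hence "0 \<le> Inf {e. J1_close T x y e}"
      using J1_close_nonneg[OF T] by (intro cInf_greatest) auto
    thus ?thesis using True by (simp add: J1_dist_def)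
  qed (auto simp: J1_dist_def)
  fix x y z
  show "0 \<le> J1_dist T x y" by (rule nn)
  have "{e. J1_close T x y e} = {e. J1_close T y x e}" using J1_close_sym by blast
  thus "J1_dist T x y = J1_dist T y x" by (simp add: J1_dist_def)
  {
    assume xy: "x \<in> cadlag T" "y \<in> cadlag T"
    have "J1_dist T x x \<le> 0"
      by (rule J1_dist_le[OF T xy(1) xy(1)]) (auto simp: J1_close_def intro!: exI[of _ "\<lambda>t. t"] time_change_id)
    with nn[of x x] have "J1_dist T x x = 0" by simp
    thus "(J1_dist T x y = 0) = (x = y)" using J1_dist_eq_0_imp[OF T xy] by auto
  }
  assume m: "x \<in> cadlag T" "y \<in> cadlag T" "z \<in> cadlag T"
  show "J1_dist T x z \<le> J1_dist T x y + J1_dist T y z"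
  proof (rule field_le_epsilon)
    fix e :: real assume e: "e > 0"
    obtain a where a: "a < J1_dist T x y + e / 2" "J1_close T x y a"
      using J1_dist_lessD[OF T m(1,2), of "J1_dist T x y + e / 2"] e by auto
    obtain b where b: "b < J1_dist T y z + e / 2" "J1_close T y z b"
      using J1_dist_lessD[OF T m(2,3), of "J1_dist T y z + e / 2"] e by auto
    have "J1_dist T x z \<le> a + b" by (rule J1_dist_le[OF T m(1,3) J1_close_trans[OF a(2) b(2)]])
    thus "J1_dist T x z \<le> J1_dist T x y + J1_dist T y z + e" using a b by simp
  qed
qed

lemma topspace_J1_topology: "0 < T \<Longrightarrow> topspace (J1_topology T) = cadlag T"
  unfolding J1_topology_def by (rule Metric_space.topspace_mtopology[OF Metric_space_J1])

definition elog :: "ennreal \<Rightarrow> ereal" where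
  "elog x = (if x = 0 then - \<infinity> else if x = \<infinity> then \<infinity> else ereal (ln (enn2real x)))"

definition borel_of_topology :: "'e topology \<Rightarrow> 'e measure" where
  "borel_of_topology E = sigma (topspace E) {U. openin E U}"

text \<open>The sequence is indexed by \<open>n \<ge> 1\<close>; the speed is \<open>n\<close>. That each \<open>X n\<close> is a random element
  of \<open>E\<close>, i.e. Borel measurable, is part of the definition.\<close>

definition satisfies_LDP :: "'w measure \<Rightarrow> 'e topology \<Rightarrow> (nat \<Rightarrow> 'w \<Rightarrow> 'e) \<Rightarrow> ('e \<Rightarrow> ereal) \<Rightarrow> bool" where
  "satisfies_LDP P E X I \<longleftrightarrow>
     (\<forall>n\<ge>1. X n \<in> measurable P (borel_of_topology E)) \<and>
     (\<forall>x\<in>topspace E. 0 \<le> I x) \<and>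
     (\<forall>C. closedin E C \<longrightarrow>
        limsup (\<lambda>n. ereal (1 / real n) * elog (emeasure P {w \<in> space P. X n w \<in> C}))
          \<le> - (INF x\<in>C. I x)) \<and>
     (\<forall>G. openin E G \<longrightarrow>
        liminf (\<lambda>n. ereal (1 / real n) * elog (emeasure P {w \<in> space P. X n w \<in> G}))
          \<ge> - (INF x\<in>G. I x))"

definition good_rate_function :: "'e topology \<Rightarrow> ('e \<Rightarrow> ereal) \<Rightarrow> bool" where
  "good_rate_function E I \<longleftrightarrow> (\<forall>a::real. compactin E {x \<in> topspace E. I x \<le> ereal a})"

text \<open>On the (null) event of infinitely many arrivals in \<open>(0,T]\<close> the path is set to zero, which makes
  every path an element of \<open>cadlag T\<close>.\<close>

definition arrival_process ::
    "real \<Rightarrow> real \<Rightarrow> (int \<Rightarrow> 'a \<Rightarrow> real) \<Rightarrow> 'a \<Rightarrow> real \<Rightarrow> real" where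
  "arrival_process T \<Delta> \<tau> w = (\<lambda>t\<in>{0..T}.
     if finite {k. 0 < of_int k * \<Delta> + \<tau> k w \<and> of_int k * \<Delta> + \<tau> k w \<le> T}
     then real (card {k. 0 < of_int k * \<Delta> + \<tau> k w \<and> of_int k * \<Delta> + \<tau> k w \<le> t})
     else 0)"

text \<open>Laws and independence of processes are taken in the product space \<open>\<real>\<^bsup>[0,T]\<^esup>\<close>,
  i.e. they are determined by the finite-dimensional distributions.\<close>

definition iid_copies ::
    "real \<Rightarrow> 'b measure \<Rightarrow> (nat \<Rightarrow> 'b \<Rightarrow> real \<Rightarrow> real) \<Rightarrow> 'a measure \<Rightarrow> ('a \<Rightarrow> real \<Rightarrow> real) \<Rightarrow> bool" where
  "iid_copies T N X M A \<longleftrightarrow>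
     (\<forall>i\<ge>1. \<forall>w\<in>space N. X i w \<in> cadlag T) \<and>
     prob_space.indep_vars N (\<lambda>_. PiM {0..T} (\<lambda>_. borel)) X {1..} \<and>
     (\<forall>i\<ge>1. distr N (PiM {0..T} (\<lambda>_. borel)) (X i) = distr M (PiM {0..T} (\<lambda>_. borel)) A)"

definition sample_mean :: "real \<Rightarrow> (nat \<Rightarrow> 'b \<Rightarrow> real \<Rightarrow> real) \<Rightarrow> nat \<Rightarrow> 'b \<Rightarrow> real \<Rightarrow> real" where
  "sample_mean T X n w = (\<lambda>t\<in>{0..T}. (1 / real n) * (\<Sum>i=1..n. X i w t))"

definition log_exp_moment :: "'a measure \<Rightarrow> ('a \<Rightarrow> real) \<Rightarrow> ereal" where
  "log_exp_moment M Y = elog (\<integral>\<^sup>+w. ennreal (exp (Y w)) \<partial>M)"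

text \<open>Vectors in \<open>\<real>\<^sup>m\<close> are functions on \<^typ>\<open>nat\<close> of which only the values at \<open>1, \<dots>, m\<close> matter.\<close>

definition Lambda_fdd ::
    "'a measure \<Rightarrow> ('a \<Rightarrow> real \<Rightarrow> real) \<Rightarrow> nat \<Rightarrow> (nat \<Rightarrow> real) \<Rightarrow> (nat \<Rightarrow> real) \<Rightarrow> ereal" where
  "Lambda_fdd M A m t \<alpha> = log_exp_moment M (\<lambda>w. \<Sum>l=1..m. \<alpha> l * A w (t l))"

definition rate_fdd ::
    "'a measure \<Rightarrow> ('a \<Rightarrow> real \<Rightarrow> real) \<Rightarrow> nat \<Rightarrow> (nat \<Rightarrow> real) \<Rightarrow> (nat \<Rightarrow> real) \<Rightarrow> ereal" where
  "rate_fdd M A m t x = (SUP \<alpha>. ereal (\<Sum>l=1..m. \<alpha> l * x l) - Lambda_fdd M A m t \<alpha>)"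

definition time_grids :: "real \<Rightarrow> nat \<Rightarrow> (nat \<Rightarrow> real) set" where
  "time_grids T m = {t. strict_mono_on {1..m} t \<and> t ` {1..m} \<subseteq> {0<..T}}"

definition rate ::
    "real \<Rightarrow> 'a measure \<Rightarrow> ('a \<Rightarrow> real \<Rightarrow> real) \<Rightarrow> (real \<Rightarrow> real) \<Rightarrow> ereal" where
  "rate T M A \<phi> = (SUP m\<in>{1..}. SUP t\<in>time_grids T m. rate_fdd M A m t (\<lambda>l. \<phi> (t l)))"

definition Lambda_path ::
    "real \<Rightarrow> 'a measure \<Rightarrow> ('a \<Rightarrow> real \<Rightarrow> real) \<Rightarrow> (real \<Rightarrow> real) \<Rightarrow> real \<Rightarrow> ereal" where
  "Lambda_path T M A \<theta> \<gamma> =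
     log_exp_moment M (\<lambda>w. (LBINT t:{0..T}. \<theta> t * A w t) + \<gamma> * A w T)"

end

theory Submission
  imports Defs "HOL-Complex_Analysis.Great_Picard"
begin

text \<open>Everything rests on the bound \<open>E exp (\<alpha> (A(t) - A(s))) \<le> exp (K (t - s) (e\<^sup>\<alpha> - 1))\<close>, which holds
  because the increment is a sum of independent indicators whose success probabilities add up to at
  most \<open>K (t - s)\<close>. It makes all cumulant functions finite, and it forces a path of finite rate to be
  nondecreasing, continuous, and to have a modulus of continuity depending only on the value of the rate.

  A sequence of nondecreasing paths satisfying an increasing number of the half-space conditions
  \<open>\<Sum> c\<^sub>l \<phi>(t\<^sub>l) \<le> a + \<Lambda>\<^sub>t(c)\<close>, taken from a countable dense family, thus has a subsequence converging
  uniformly to a path of rate at most \<open>a\<close>. This gives compact level sets; it also shows that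
  a closed set on which the rate exceeds \<open>a\<close> is covered, as far as nondecreasing paths are concerned,
  by finitely many complementary half-spaces, so that Chernoff's inequality yields the upper bound.

  For the lower bound, continuity and monotonicity reduce a ball around a path of finite rate to a
  finite-dimensional neighbourhood, which is treated by an exponential change of measure at the maximiser of
  the Legendre transform with a small quadratic penalty. In the variational representation one passes
  from integrals to point evaluations by bumps to the right of each time, and back by Riemann sums.\<close>

section \<open>Measurability for the Skorokhod topology\<close>

text \<open>Two notions of closeness are at work. Sample paths jump at random times, so their step
  approximations converge only after a time change, and Borel measurability of the sample mean is
  therefore argued in \<open>J1_topology\<close>. On the large-deviation side every limit path is
  continuous, all convergence is uniform, and a uniform bound controls \<open>J1_dist\<close>.

  The usual obstacle to an upper bound on path space is exponential tightness. Compactness is used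
  here only along nondecreasing paths that pass more and more tests, so the only probabilities to be
  estimated are those of violating one of finitely many linear inequalities.

  The obstacle to the lower bound is that the supremum in a Legendre transform may fail to be
  attained at a boundary point of its domain. The penalty produces a maximiser at the price of a
  slightly displaced target.

  Both ends of the interval are special. Time 0 belongs to no time grid, so the value there is
  recovered by right continuity. Time T has nothing to its right, so no bump reaches it, and the
  separate coefficient \<gamma> is what represents it.\<close>

definition floor_to :: "real \<Rightarrow> real \<Rightarrow> real" where
  "floor_to h t = h * of_int \<lfloor>t / h\<rfloor>"

text \<open>Rounding up serves right-continuous paths, whose values at \<open>ceil_to h t\<close>
  converge to the value at t as h tends to 0. Rounding down gives the last grid point passed, which
  is where a piecewise constant interpolation reads its value.\<close>

definition ceil_to :: "real \<Rightarrow> real \<Rightarrow> real" where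
  "ceil_to h t = h * of_int \<lceil>t / h\<rceil>"

lemma ceil_to_ge: "0 < h \<Longrightarrow> t \<le> ceil_to h t"
  unfolding ceil_to_def by (metis le_of_int_ceiling mult.commute pos_divide_le_eq)

lemma ceil_to_less: "0 < h \<Longrightarrow> ceil_to h t < t + h"
proof -
  assume h: "0 < h"
  have "of_int \<lceil>t / h\<rceil> < t / h + 1" by linarith
  hence "h * of_int \<lceil>t / h\<rceil> < h * (t / h + 1)" using h by simp
  also have "\<dots> = t + h" using h by (simp add: field_simps)
  finally show ?thesis by (simp add: ceil_to_def)
qed

lemma floor_to_le: "0 < h \<Longrightarrow> floor_to h t \<le> t"
  unfolding floor_to_def by (metis of_int_floor_le mult.commute pos_le_divide_eq)

lemma floor_to_nonneg: "0 < h \<Longrightarrow> 0 \<le> t \<Longrightarrow> 0 \<le> floor_to h t"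
  unfolding floor_to_def by simp

text \<open>With \<open>floor_to_ge\<close> this is an adjunction: t < ceil s exactly when floor t <
  s. Hence t lies in [ceil a, ceil b) exactly when floor t lies in [a, b), which keeps the
  interpolated value inside a piece of small oscillation.\<close>

lemma floor_to_less: "0 < h \<Longrightarrow> t < ceil_to h s \<Longrightarrow> floor_to h t < s"
proof -
  assume h: "0 < h" and t: "t < ceil_to h s"
  have "t / h < of_int \<lceil>s / h\<rceil>" using h t by (simp add: ceil_to_def field_simps)
  hence "\<lfloor>t / h\<rfloor> < \<lceil>s / h\<rceil>" by (simp add: floor_less_iff)
  hence "of_int \<lfloor>t / h\<rfloor> < s / h" by linarith
  thus ?thesis using h by (simp add: floor_to_def field_simps)
qed

lemma floor_to_ge: "0 < h \<Longrightarrow> ceil_to h s \<le> t \<Longrightarrow> s \<le> floor_to h t"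
proof -
  assume h: "0 < h" and t: "ceil_to h s \<le> t"
  have "of_int \<lceil>s / h\<rceil> \<le> t / h" using h t by (simp add: ceil_to_def field_simps)
  hence "\<lceil>s / h\<rceil> \<le> \<lfloor>t / h\<rfloor>" by linarith
  hence "s / h \<le> of_int \<lfloor>t / h\<rfloor>" by linarith
  thus ?thesis using h by (simp add: floor_to_def field_simps)
qed

lemma ceil_to_mono: "0 < h \<Longrightarrow> s \<le> t \<Longrightarrow> ceil_to h s \<le> ceil_to h t"
  unfolding ceil_to_def by (simp add: ceiling_mono divide_right_mono)

lemma ceil_to_0 [simp]: "ceil_to h 0 = 0"
  by (simp add: ceil_to_def)

lemma ceil_to_end: "m \<ge> 1 \<Longrightarrow> 0 < T \<Longrightarrow> ceil_to (T / real m) T = T"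
  by (simp add: ceil_to_def)

lemma floor_to_end: "m \<ge> 1 \<Longrightarrow> 0 < T \<Longrightarrow> floor_to (T / real m) T = T"
  by (simp add: floor_to_def)

text \<open>A time change from \<open>[\<lceil>a\<rceil>,\<lceil>b\<rceil>]\<close> (rounded up to the grid) onto \<open>[a,b]\<close> under which \<open>\<phi>\<close> is close
  to its piecewise constant interpolation.\<close>

definition grid_change :: "(real \<Rightarrow> real) \<Rightarrow> real \<Rightarrow> real \<Rightarrow> real \<Rightarrow> real \<Rightarrow> (real \<Rightarrow> real) \<Rightarrow> bool" where
  "grid_change \<phi> e h a b \<mu> \<longleftrightarrow>
     strict_mono_on {ceil_to h a..ceil_to h b} \<mu> \<and> continuous_on {ceil_to h a..ceil_to h b} \<mu> \<and>
     \<mu> (ceil_to h a) = a \<and> \<mu> (ceil_to h b) = b \<and>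
     (\<forall>t\<in>{ceil_to h a..ceil_to h b}. \<bar>\<mu> t - t\<bar> \<le> h) \<and>
     (\<forall>t\<in>{ceil_to h a..<ceil_to h b}. \<bar>\<phi> (floor_to h t) - \<phi> (\<mu> t)\<bar> \<le> e)"

text \<open>The affine map carrying the rounded endpoints back to a and b works: both endpoints are
  displaced by an amount in [0, h), and \<open>h < b - a\<close> keeps the rounded interval
  nondegenerate.\<close>

lemma grid_change_linear:
  assumes h: "0 < h" "h < b - a"
    and osc: "\<And>s t. s \<in> {a..<b} \<Longrightarrow> t \<in> {a..<b} \<Longrightarrow> \<bar>\<phi> s - \<phi> t\<bar> \<le> e"
  shows "\<exists>\<mu>. grid_change \<phi> e h a b \<mu>"
proof -
  define p where "p = ceil_to h a"
  define q where "q = ceil_to h b"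
  have p: "a \<le> p" "p < a + h" and q: "b \<le> q" "q < b + h"
    unfolding p_def q_def using h by (auto intro: ceil_to_ge ceil_to_less)
  have pq: "p < q" using p q h by linarith
  define r where "r = (b - a) / (q - p)"
  have r: "0 < r" "r * (q - p) = b - a" using pq h by (auto simp: r_def)
  define \<mu> where "\<mu> = (\<lambda>t. a + (t - p) * r)"
  have lt: "\<mu> s < \<mu> t" if "s < t" for s t using that r by (simp add: \<mu>_def)
  have ends: "\<mu> p = a" "\<mu> q = b" using r by (simp_all add: \<mu>_def mult.commute)
  have close: "\<bar>\<mu> t - t\<bar> \<le> h" if t: "t \<in> {p..q}" for t
  proof -
    define l where "l = (t - p) / (q - p)"
    have l: "0 \<le> l" "l \<le> 1" using t pq by (auto simp: l_def)
    have tl: "t = p + l * (q - p)" using pq by (simp add: l_def)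
    have "\<mu> t = a + l * (b - a)" using r(2) pq by (simp add: \<mu>_def l_def r_def)
    \<comment> \<open>The displacement at t is a convex combination of the two endpoint
      displacements.\<close>
    hence eq: "t - \<mu> t = (1 - l) * (p - a) + l * (q - b)" by (subst tl) (simp add: algebra_simps)
    have "(1 - l) * (p - a) \<le> (1 - l) * h" "l * (q - b) \<le> l * h"
      using l p q by (auto intro!: mult_left_mono)
    moreover have "0 \<le> (1 - l) * (p - a)" "0 \<le> l * (q - b)" using l p q by auto
    ultimately show ?thesis using eq by (auto simp: algebra_simps)
  qed
  have "\<bar>\<phi> (floor_to h t) - \<phi> (\<mu> t)\<bar> \<le> e" if t: "t \<in> {p..<q}" for t
  proof (rule osc)
    show "floor_to h t \<in> {a..<b}"
      using t floor_to_less[OF h(1), of t b] floor_to_ge[OF h(1), of a t] by (auto simp: p_def q_def)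
    have "a \<le> \<mu> t" using t r by (simp add: \<mu>_def)
    moreover have "\<mu> t < b" using lt[of t q] t ends by auto
    ultimately show "\<mu> t \<in> {a..<b}" by simp
  qed
  hence "grid_change \<phi> e h a b \<mu>"
    unfolding grid_change_def p_def[symmetric] q_def[symmetric]
    using lt ends close by (auto intro!: strict_mono_onI continuous_intros simp: \<mu>_def)
  thus ?thesis by blast
qed

text \<open>Degenerate pieces occur because a cut at a point x may leave nothing on one side of
  it.\<close>

lemma grid_change_trivial:
  assumes "0 < h" shows "grid_change \<phi> e h a a (\<lambda>_. a)"
  unfolding grid_change_def
  using ceil_to_ge[OF assms, of a] ceil_to_less[OF assms, of a] by (auto simp: strict_mono_on_def)

text \<open>The closeness clause concerns half-open intervals, so a jump of \<phi> at the seam does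
  no harm: there both maps have the value b, and the right piece supplies the estimate.\<close>

lemma grid_change_glue:
  assumes h: "0 < h" and "a \<le> b" "b \<le> c"
    and 1: "grid_change \<phi> e h a b \<mu>" and 2: "grid_change \<phi> e h b c \<nu>"
  shows "grid_change \<phi> e h a c (\<lambda>t. if t \<le> ceil_to h b then \<mu> t else \<nu> t)"
proof -
  let ?l = "\<lambda>t. if t \<le> ceil_to h b then \<mu> t else \<nu> t"
  define p q r where pqr: "p = ceil_to h a" "q = ceil_to h b" "r = ceil_to h c"
  have le: "p \<le> q" "q \<le> r" using assms ceil_to_mono by (auto simp: pqr)
  have m: "\<And>s t. s \<in> {p..q} \<Longrightarrow> t \<in> {p..q} \<Longrightarrow> s < t \<Longrightarrow> \<mu> s < \<mu> t"
    and n: "\<And>s t. s \<in> {q..r} \<Longrightarrow> t \<in> {q..r} \<Longrightarrow> s < t \<Longrightarrow> \<nu> s < \<nu> t"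
    and ends: "\<mu> p = a" "\<mu> q = b" "\<nu> q = b" "\<nu> r = c"
    and cont: "continuous_on {p..q} \<mu>" "continuous_on {q..r} \<nu>"
    and close: "\<And>t. t \<in> {p..q} \<Longrightarrow> \<bar>\<mu> t - t\<bar> \<le> h" "\<And>t. t \<in> {q..r} \<Longrightarrow> \<bar>\<nu> t - t\<bar> \<le> h"
      "\<And>t. t \<in> {p..<q} \<Longrightarrow> \<bar>\<phi> (floor_to h t) - \<phi> (\<mu> t)\<bar> \<le> e"
      "\<And>t. t \<in> {q..<r} \<Longrightarrow> \<bar>\<phi> (floor_to h t) - \<phi> (\<nu> t)\<bar> \<le> e"
    using 1 2 unfolding grid_change_def pqr by (auto simp: strict_mono_on_def)
  have "continuous_on ({p..q} \<union> {q..r}) (\<lambda>t. if t \<le> q then \<mu> t else \<nu> t)"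
  proof (rule continuous_on_cases)
    show "\<forall>x. x \<in> {p..q} \<and> \<not> x \<le> q \<or> x \<in> {q..r} \<and> x \<le> q \<longrightarrow> \<mu> x = \<nu> x"
      using ends by (metis atLeastAtMost_iff order_antisym)
  qed (simp_all add: cont)
  moreover have "{p..q} \<union> {q..r} = {p..r}" using le by auto
  ultimately have co: "continuous_on {p..r} ?l" by (simp add: pqr)
  have "strict_mono_on {p..r} ?l"
  proof (rule strict_mono_onI)
    fix s t assume st: "s \<in> {p..r}" "t \<in> {p..r}" "s < t"
    consider "t \<le> q" | "q < s" | "s = q" "q < t" | "s < q" "q < t" using st by linarith
    hence "(if s \<le> q then \<mu> s else \<nu> s) < (if t \<le> q then \<mu> t else \<nu> t)"
    proof cases
      case 1 thus ?thesis using st m[of s t] by simp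
    next
      case 2 thus ?thesis using st n[of s t] by simp
    next
      case 3 thus ?thesis using st n[of q t] ends le by simp
    next
      case 4 thus ?thesis using st n[of q t] m[of s q] ends le by simp
    qed
    thus "?l s < ?l t" by (simp add: pqr)
  qed
  moreover have "?l p = a" using ends le by (simp add: pqr)
  moreover have "?l r = c"
  proof (cases "r = q")
    case True
    thus ?thesis using ends by (simp add: pqr)
  next
    case False thus ?thesis using ends le by (simp add: pqr)
  qed
  moreover have "\<bar>?l t - t\<bar> \<le> h" if "t \<in> {p..r}" for t
    using close(1,2)[of t] that by (auto simp: pqr)
  moreover have "\<bar>\<phi> (floor_to h t) - \<phi> (?l t)\<bar> \<le> e" if t: "t \<in> {p..<r}" for t
  proof (cases "t = q")
    case True thus ?thesis using close(4)[of q] ends t by (simp add: pqr)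
  next
    case False thus ?thesis using close(3,4)[of t] t by (auto simp: pqr)
  qed
  ultimately show ?thesis using co unfolding grid_change_def pqr[symmetric] by blast
qed

text \<open>Bisection: near any x the path oscillates by at most e on either side, by right
  continuity and by the left limit, and a cut at x places a large jump on the boundary between two
  pieces. A threshold d exists because h only has to be smaller than finitely many lengths.\<close>

lemma cadlag_grid_change:
  assumes T: "0 < T" and \<phi>: "\<phi> \<in> cadlag T" and e: "0 < e"
  shows "\<exists>d>0. \<forall>h. 0 < h \<and> h < d \<longrightarrow> (\<exists>\<mu>. grid_change \<phi> e h 0 T \<mu>)"
proof -
  define E where "E = (\<lambda>a b. \<exists>d>0. \<forall>h. 0 < h \<and> h < d \<longrightarrow> (\<exists>\<mu>. grid_change \<phi> e h a b \<mu>))"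
  \<comment> \<open>The guard is there because the intervals that \<open>Bolzano\<close> considers
    around x may stick out of \<open>{0..T}\<close>.\<close>
  define P where "P = (\<lambda>a b. 0 \<le> a \<and> b \<le> T \<longrightarrow> E a b)"
  have glue: "E a c" if "E a b" "E b c" "a \<le> b" "b \<le> c" for a b c
  proof -
    obtain d1 where d1: "d1 > 0" "\<And>h. 0 < h \<Longrightarrow> h < d1 \<Longrightarrow> \<exists>\<mu>. grid_change \<phi> e h a b \<mu>"
      using \<open>E a b\<close> unfolding E_def by blast
    obtain d2 where d2: "d2 > 0" "\<And>h. 0 < h \<Longrightarrow> h < d2 \<Longrightarrow> \<exists>\<mu>. grid_change \<phi> e h b c \<mu>"
      using \<open>E b c\<close> unfolding E_def by blast
    show ?thesis unfolding E_def
    proof (intro exI[of _ "min d1 d2"] conjI allI impI)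
      fix h :: real assume h: "0 < h \<and> h < min d1 d2"
      obtain \<mu> \<nu> where "grid_change \<phi> e h a b \<mu>" "grid_change \<phi> e h b c \<nu>"
        using d1(2)[of h] d2(2)[of h] h by auto
      from grid_change_glue[OF _ that(3,4) this] h show "\<exists>\<mu>. grid_change \<phi> e h a c \<mu>" by blast
    qed (use d1 d2 in auto)
  qed
  have base: "E a b" if "a \<le> b" "\<And>s t. s \<in> {a..<b} \<Longrightarrow> t \<in> {a..<b} \<Longrightarrow> \<bar>\<phi> s - \<phi> t\<bar> \<le> e" for a b
  proof (cases "a = b")
    case True
    thus ?thesis unfolding E_def using grid_change_trivial by (intro exI[of _ 1]) fastforce
  next
    case False
    hence ab: "a < b" using that by simp
    show ?thesis unfolding E_def
    proof (intro exI[of _ "b - a"] conjI allI impI)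
      show "0 < b - a" using ab by simp
      fix h assume "0 < h \<and> h < b - a"
      thus "\<exists>\<mu>. grid_change \<phi> e h a b \<mu>" using that(2) by (intro grid_change_linear) auto
    qed
  qed
  have "P 0 T"
  proof (rule Bolzano)
    fix a b c :: real assume "P a b" "P b c" "a \<le> b" "b \<le> c"
    thus "P a c" using glue[of a b c] by (auto simp: P_def)
  next
    fix x assume x: "0 \<le> x" "x \<le> T"
    have "\<exists>d>0. \<forall>b. x \<le> b \<and> b < x + d \<and> b \<le> T \<longrightarrow> E x b"
    proof (cases "x < T")
      case True
      hence "(\<phi> \<longlongrightarrow> \<phi> x) (at_right x)" using \<phi> x by (auto simp: cadlag_def)
      hence "\<forall>\<^sub>F t in at_right x. dist (\<phi> t) (\<phi> x) < e / 2" by (rule tendstoD) (use e in simp)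
      then obtain y where y: "y > x" "\<And>t. x < t \<Longrightarrow> t < y \<Longrightarrow> dist (\<phi> t) (\<phi> x) < e / 2"
        unfolding eventually_at_right_field by blast
      have y': "\<bar>\<phi> t - \<phi> x\<bar> < e / 2" if "x \<le> t" "t < y" for t
        using y(2)[of t] that e by (cases "x = t") (auto simp: dist_real_def)
      show ?thesis
      proof (intro exI[of _ "y - x"] conjI allI impI)
        show "0 < y - x" using y by simp
        fix b assume b: "x \<le> b \<and> b < x + (y - x) \<and> b \<le> T"
        show "E x b"
        proof (rule base)
          show "x \<le> b" using b by simp
          fix s t assume "s \<in> {x..<b}" "t \<in> {x..<b}"
          thus "\<bar>\<phi> s - \<phi> t\<bar> \<le> e" using y'[of s] y'[of t] b by (auto simp: abs_if split: if_splits)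
        qed
      qed
    next
      case False
      hence "x = T" using x by simp
      thus ?thesis using base[of T T] by (intro exI[of _ 1]) auto
    qed
    then obtain d1 where d1: "d1 > 0" "\<And>b. x \<le> b \<Longrightarrow> b < x + d1 \<Longrightarrow> b \<le> T \<Longrightarrow> E x b" by blast
    have "\<exists>d>0. \<forall>a. a \<le> x \<and> x - d < a \<and> 0 \<le> a \<longrightarrow> E a x"
    proof (cases "0 < x")
      case True
      hence "x \<in> {0<..T}" using x by simp
      then obtain l where "(\<phi> \<longlongrightarrow> l) (at_left x)" using \<phi> unfolding cadlag_def by blast
      hence "\<forall>\<^sub>F t in at_left x. dist (\<phi> t) l < e / 2" by (rule tendstoD) (use e in simp)
      then obtain y where y: "y < x" "\<And>t. y < t \<Longrightarrow> t < x \<Longrightarrow> dist (\<phi> t) l < e / 2"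
        unfolding eventually_at_left_field by blast
      show ?thesis
      proof (intro exI[of _ "x - y"] conjI allI impI)
        show "0 < x - y" using y by simp
        fix a assume a: "a \<le> x \<and> x - (x - y) < a \<and> 0 \<le> a"
        show "E a x"
        proof (rule base)
          show "a \<le> x" using a by simp
          fix s t assume "s \<in> {a..<x}" "t \<in> {a..<x}"
          thus "\<bar>\<phi> s - \<phi> t\<bar> \<le> e" using y(2)[of s] y(2)[of t] a
            by (auto simp: dist_real_def abs_if split: if_splits)
        qed
      qed
    next
      case False
      hence "x = 0" using x by simp
      thus ?thesis using base[of 0 0] by (intro exI[of _ 1]) auto
    qed
    then obtain d2 where d2: "d2 > 0" "\<And>a. a \<le> x \<Longrightarrow> x - d2 < a \<Longrightarrow> 0 \<le> a \<Longrightarrow> E a x" by blast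
    show "\<exists>d>0. \<forall>a b. a \<le> x \<and> x \<le> b \<and> b - a < d \<longrightarrow> P a b"
    proof (intro exI[of _ "min d1 d2"] conjI allI impI)
      fix a b assume "a \<le> x \<and> x \<le> b \<and> b - a < min d1 d2"
      thus "P a b" unfolding P_def using glue[of a x b] d1(2)[of b] d2(2)[of a] by auto
    qed (use d1 d2 in auto)
  qed (use T in auto)
  thus ?thesis by (simp add: P_def E_def)
qed

text \<open>For a positive T and m \<ge> 1 the index counts the grid points in (0,t]. The last cell
  is the single point T, the only place where the entry \<open>x m\<close> is read.\<close>

definition step_path :: "real \<Rightarrow> nat \<Rightarrow> (nat \<Rightarrow> real) \<Rightarrow> real \<Rightarrow> real" where
  "step_path T m x = (\<lambda>t\<in>{0..T}. x (nat \<lfloor>t / (T / real m)\<rfloor>))"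

lemma step_index_le:
  assumes "0 < T" "m \<ge> 1" "t \<in> {0..T}" shows "nat \<lfloor>t / (T / real m)\<rfloor> \<le> m"
proof -
  have "t / (T / real m) \<le> real m" using assms by (simp add: field_simps)
  thus ?thesis by linarith
qed

lemma floor_eventually_right:
  fixes x :: real shows "\<forall>\<^sub>F t in at_right x. \<lfloor>t\<rfloor> = \<lfloor>x\<rfloor>"
  unfolding eventually_at_right_field
  by (rule exI[of _ "of_int \<lfloor>x\<rfloor> + 1"]) (auto simp: floor_eq_iff, linarith+)

text \<open>\<open>\<lceil>x\<rceil> - 1\<close> is the largest integer strictly below x, which also
  covers an integer x, where the floor jumps.\<close>

lemma floor_eventually_left:
  fixes x :: real shows "\<forall>\<^sub>F t in at_left x. \<lfloor>t\<rfloor> = \<lceil>x\<rceil> - 1"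
  unfolding eventually_at_left_field
  by (rule exI[of _ "of_int \<lceil>x\<rceil> - 1"]) (auto simp: floor_eq_iff, linarith+)

lemma step_path_cadlag:
  assumes T: "0 < T" and m: "m \<ge> 1"
  shows "step_path T m x \<in> cadlag T"
proof -
  define h where "h = T / real m"
  have h: "h > 0" using T m by (simp add: h_def)
  have "(step_path T m x \<longlongrightarrow> step_path T m x t) (at_right t)" if t: "0 \<le> t" "t < T" for t
  proof (rule tendsto_eventually)
    obtain b where b: "b > t / h" "\<And>s. t / h < s \<Longrightarrow> s < b \<Longrightarrow> \<lfloor>s\<rfloor> = \<lfloor>t / h\<rfloor>"
      using floor_eventually_right[of "t / h"] unfolding eventually_at_right_field by blast
    show "\<forall>\<^sub>F s in at_right t. step_path T m x s = step_path T m x t"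
      unfolding eventually_at_right_field
    proof (intro exI[of _ "min T (b * h)"] conjI allI impI)
      show "t < min T (b * h)" using t b h by (simp add: field_simps)
      fix s assume "t < s" "s < min T (b * h)"
      hence "\<lfloor>s / h\<rfloor> = \<lfloor>t / h\<rfloor>" "s \<in> {0..T}" using b(2)[of "s / h"] h t by (auto simp: field_simps)
      thus "step_path T m x s = step_path T m x t" using t by (simp add: step_path_def h_def)
    qed
  qed
  moreover have "\<exists>l. (step_path T m x \<longlongrightarrow> l) (at_left t)" if t: "0 < t" "t \<le> T" for t
  proof (rule exI, rule tendsto_eventually)
    obtain b where b: "b < t / h" "\<And>s. b < s \<Longrightarrow> s < t / h \<Longrightarrow> \<lfloor>s\<rfloor> = \<lceil>t / h\<rceil> - 1"
      using floor_eventually_left[of "t / h"] unfolding eventually_at_left_field by blast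
    show "\<forall>\<^sub>F s in at_left t. step_path T m x s = x (nat (\<lceil>t / h\<rceil> - 1))"
      unfolding eventually_at_left_field
    proof (intro exI[of _ "max 0 (b * h)"] conjI allI impI)
      show "max 0 (b * h) < t" using t b h by (simp add: field_simps)
      fix s assume "s < t" "max 0 (b * h) < s"
      hence "\<lfloor>s / h\<rfloor> = \<lceil>t / h\<rceil> - 1" "s \<in> {0..T}" using b(2)[of "s / h"] h t by (auto simp: field_simps)
      thus "step_path T m x s = x (nat (\<lceil>t / h\<rceil> - 1))" by (simp add: step_path_def h_def)
    qed
  qed
  ultimately show ?thesis by (auto simp: cadlag_def) (simp add: step_path_def)
qed

text \<open>In the uniform metric this would fail for a path that jumps off the grids. The time
  change delays each large jump to the next grid point, which is where the interpolation makes
  it.\<close>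

lemma step_path_approx:
  assumes T: "0 < T" and \<phi>: "\<phi> \<in> cadlag T"
  shows "(\<lambda>m. J1_dist T (step_path T m (\<lambda>l. \<phi> (T / real m * real l))) \<phi>) \<longlonglongrightarrow> 0"
proof (rule LIMSEQ_I)
  interpret J: Metric_space "cadlag T" "J1_dist T" by (rule Metric_space_J1[OF T])
  fix e :: real assume e: "0 < e"
  obtain d where d: "d > 0" "\<And>h. 0 < h \<Longrightarrow> h < d \<Longrightarrow> \<exists>\<mu>. grid_change \<phi> (e / 2) h 0 T \<mu>"
    using cadlag_grid_change[OF T \<phi>, of "e / 2"] e by auto
  have "(\<lambda>m. T / real m) \<longlonglongrightarrow> 0" by (rule lim_const_over_n)
  hence "\<forall>\<^sub>F m in sequentially. T / real m < min d (e / 2)"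
    by (rule order_tendstoD) (use d e in auto)
  with eventually_ge_at_top[of 1]
  have "\<forall>\<^sub>F m in sequentially.
      norm (J1_dist T (step_path T m (\<lambda>l. \<phi> (T / real m * real l))) \<phi> - 0) < e"
  proof eventually_elim
    case (elim m)
    define h where "h = T / real m"
    define V where "V = step_path T m (\<lambda>l. \<phi> (h * real l))"
    have h: "0 < h" "h < d" "h < e / 2" using T elim by (auto simp: h_def)
    have ceT: "ceil_to h T = T" unfolding h_def by (rule ceil_to_end) (use T elim in auto)
    obtain \<mu> where "grid_change \<phi> (e / 2) h 0 T \<mu>" using d(2)[of h] h by blast
    note \<mu> = this[unfolded grid_change_def ceil_to_0 ceT]
    have V: "V t = \<phi> (floor_to h t)" if "t \<in> {0..T}" for t
      using that h by (simp add: V_def step_path_def floor_to_def h_def)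
    have "\<mu> ` {0..T} = {0..T}"
    proof (intro equalityI subsetI)
      fix y assume "y \<in> \<mu> ` {0..T}"
      then obtain t where "t \<in> {0..T}" "y = \<mu> t" by blast
      thus "y \<in> {0..T}" using \<mu> T strict_mono_on_leD[of "{0..T}" \<mu> 0 t] strict_mono_on_leD[of "{0..T}" \<mu> t T]
        by auto
    next
      fix y assume "y \<in> {0..T}"
      thus "y \<in> \<mu> ` {0..T}" using IVT'[of \<mu> 0 y T] \<mu> T by auto
    qed
    hence tc: "time_change T \<mu>" using \<mu> by (simp add: time_change_def)
    have "J1_close T V \<phi> (e / 2)" unfolding J1_close_def
    proof (intro exI[of _ \<mu>] conjI ballI tc)
      fix t assume t: "t \<in> {0..T}"
      show "\<bar>\<mu> t - t\<bar> \<le> e / 2" using \<mu> t h by fastforce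
      show "\<bar>V t - \<phi> (\<mu> t)\<bar> \<le> e / 2"
      \<comment> \<open>The closeness clause of \<open>grid_change\<close> stops short of the right
        end; there \<open>floor_to\<close> and \<mu> both fix T.\<close>
      proof (cases "t = T")
        case True
        have "floor_to h T = T" unfolding h_def by (rule floor_to_end) (use T elim in auto)
        thus ?thesis using V[OF t] True \<mu> e by simp
      next
        case False thus ?thesis using V[OF t] t \<mu> by auto
      qed
    qed
    moreover have "V \<in> cadlag T" unfolding V_def using T elim by (intro step_path_cadlag) auto
    ultimately have "J1_dist T V \<phi> \<le> e / 2" using T \<phi> by (intro J1_dist_le)
    thus ?case using e J.nonneg[of V \<phi>] by (simp add: V_def h_def)
  qed
  thus "\<exists>no. \<forall>n\<ge>no. norm (J1_dist T (step_path T n (\<lambda>l. \<phi> (T / real n * real l))) \<phi> - 0) < e"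
    by (simp add: eventually_sequentially)
qed

lemma J1_dist_le_sup:
  assumes "0 < T" "\<phi> \<in> cadlag T" "\<psi> \<in> cadlag T" "\<And>t. t \<in> {0..T} \<Longrightarrow> \<bar>\<phi> t - \<psi> t\<bar> \<le> e"
  shows "J1_dist T \<phi> \<psi> \<le> e"
proof (rule J1_dist_le[OF assms(1-3)])
  have "\<bar>\<phi> 0 - \<psi> 0\<bar> \<le> e" using assms by simp
  hence "0 \<le> e" by linarith
  thus "J1_close T \<phi> \<psi> e" unfolding J1_close_def
    using assms time_change_id by (intro exI[of _ "\<lambda>t. t"]) auto
qed

text \<open>The distance to a closed set is the limit of its values at step approximations, and these depend
  continuously on finitely many values of the path.\<close>

lemma borel_of_J1_measurableI:
  fixes N :: "'b measure"
  assumes T: "0 < T"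
    and cad: "\<And>w. w \<in> space N \<Longrightarrow> X w \<in> cadlag T"
    and meas: "\<And>t. t \<in> {0..T} \<Longrightarrow> (\<lambda>w. X w t) \<in> borel_measurable N"
  shows "X \<in> measurable N (borel_of_topology (J1_topology T))"
proof -
  interpret J: Metric_space "cadlag T" "J1_dist T" by (rule Metric_space_J1[OF T])
  have closed: "{w \<in> space N. X w \<in> C} \<in> sets N" if C: "closedin (J1_topology T) C" for C
  proof (cases "C = {}")
    case False
    have CM: "C \<subseteq> cadlag T" using closedin_subset[OF C] topspace_J1_topology[OF T] by simp
    define g where "g = (\<lambda>\<phi>. Inf ((J1_dist T \<phi>) ` C))"
    have bdd: "bdd_below ((J1_dist T \<phi>) ` C)" for \<phi> using J.nonneg by (intro bdd_belowI[of _ 0]) auto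
    have g_lip1: "g \<phi> \<le> J1_dist T \<phi> \<psi> + g \<psi>" if "\<phi> \<in> cadlag T" "\<psi> \<in> cadlag T" for \<phi> \<psi>
    proof -
      have "g \<phi> - J1_dist T \<phi> \<psi> \<le> Inf ((J1_dist T \<psi>) ` C)"
      proof (rule cInf_greatest)
        fix x assume "x \<in> J1_dist T \<psi> ` C"
        then obtain y where y: "y \<in> C" "x = J1_dist T \<psi> y" by blast
        have "g \<phi> \<le> J1_dist T \<phi> y" unfolding g_def using y by (intro cInf_lower bdd) auto
        also have "\<dots> \<le> J1_dist T \<phi> \<psi> + x" using y CM that J.triangle by auto
        finally show "g \<phi> - J1_dist T \<phi> \<psi> \<le> x" by simp
      qed (use False in simp)
      thus ?thesis by (simp add: g_def)
    qed
    have g_lip: "\<bar>g \<phi> - g \<psi>\<bar> \<le> J1_dist T \<phi> \<psi>" if "\<phi> \<in> cadlag T" "\<psi> \<in> cadlag T" for \<phi> \<psi>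
      using g_lip1[OF that] g_lip1[OF that(2,1)] J.commute[of \<phi> \<psi>] by linarith
    have g0: "\<phi> \<in> C \<longleftrightarrow> g \<phi> = 0" if \<phi>: "\<phi> \<in> cadlag T" for \<phi>
    proof
      assume \<phi>C: "\<phi> \<in> C"
      have "g \<phi> \<le> J1_dist T \<phi> \<phi>" unfolding g_def using \<phi>C by (intro cInf_lower bdd) auto
      moreover have "0 \<le> g \<phi>" unfolding g_def using False J.nonneg by (intro cInf_greatest) auto
      ultimately show "g \<phi> = 0" using J.zero[OF \<phi> \<phi>] by simp
    next
      assume g: "g \<phi> = 0"
      show "\<phi> \<in> C"
      proof (rule ccontr)
        assume "\<phi> \<notin> C"
        moreover have "openin J.mtopology (cadlag T - C)"
          using C topspace_J1_topology[OF T] by (auto simp: closedin_def J1_topology_def)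
        ultimately obtain r where r: "r > 0" "J.mball \<phi> r \<subseteq> cadlag T - C"
          using \<phi> J.openin_mtopology by (metis DiffI)
        obtain y where "y \<in> C" "J1_dist T \<phi> y < r"
          using cInf_lessD[of "J1_dist T \<phi> ` C" r] g False r(1) by (auto simp: g_def)
        moreover from this have "y \<in> J.mball \<phi> r" using CM \<phi> by (simp add: J.in_mball subset_iff)
        ultimately show False using r(2) by blast
      qed
    qed
    \<comment> \<open>Capping the index at m keeps every sampling time in \<open>{0..T}\<close>,
      where measurability is available; on that interval \<open>step_path T m\<close> reads no index
      above m.\<close>
    define p where "p = (\<lambda>m w l. X w (T / real m * real (min l m)))"
    define S where "S = (\<lambda>m w. step_path T m (\<lambda>l. X w (T / real m * real l)))"
    have Seq: "S m w = step_path T m (p m w)" if m: "m \<ge> 1" for m w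
    proof -
        show ?thesis unfolding S_def step_path_def p_def
        using step_index_le[OF T m] by (auto simp: fun_eq_iff restrict_def min_def)
    qed
    have Sc: "S m w \<in> cadlag T" if "m \<ge> 1" for m w
      unfolding S_def by (rule step_path_cadlag[OF T that])
    have "(\<lambda>w. g (X w)) \<in> borel_measurable N"
    proof (rule borel_measurable_LIMSEQ_real)
      fix w assume w: "w \<in> space N"
      have "(\<lambda>m. J1_dist T (S (Suc m) w) (X w)) \<longlonglongrightarrow> 0"
        using step_path_approx[OF T cad[OF w]] unfolding S_def by (rule LIMSEQ_Suc)
      moreover have "\<forall>\<^sub>F m in sequentially. norm (g (S (Suc m) w) - g (X w)) \<le> J1_dist T (S (Suc m) w) (X w)"
        using g_lip[OF Sc cad[OF w]] by (intro always_eventually allI) simp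
      ultimately have "(\<lambda>m. g (S (Suc m) w) - g (X w)) \<longlonglongrightarrow> 0"
        by (rule Lim_null_comparison[rotated])
      thus "(\<lambda>m. g (S (Suc m) w)) \<longlonglongrightarrow> g (X w)" by (rule LIM_zero_cancel)
    next
      fix m0
      define m where "m = Suc m0"
      have m: "m \<ge> 1" by (simp add: m_def)
      \<comment> \<open>Continuity for the product topology on sequences, so that coordinatewise
        measurability of \<open>p m\<close> is enough to compose.\<close>
      have "continuous_on UNIV (\<lambda>x::nat \<Rightarrow> real. g (step_path T m x))"
      proof (rule continuous_at_imp_continuous_on, rule ballI)
        fix x :: "nat \<Rightarrow> real"
        have cs: "continuous_on UNIV (\<lambda>y. \<Sum>l\<le>m. \<bar>y l - x l\<bar>)"
          by (intro continuous_intros continuous_on_product_coordinates)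
        have "((\<lambda>y. \<Sum>l\<le>m. \<bar>y l - x l\<bar>) \<longlongrightarrow> (\<Sum>l\<le>m. \<bar>x l - x l\<bar>)) (at x)"
          using cs unfolding continuous_on_def by blast
        hence lim: "((\<lambda>y. \<Sum>l\<le>m. \<bar>y l - x l\<bar>) \<longlongrightarrow> 0) (at x)" by simp
        have "norm (g (step_path T m y) - g (step_path T m x)) \<le> (\<Sum>l\<le>m. \<bar>y l - x l\<bar>)" for y
        proof -
          have "\<bar>step_path T m y t - step_path T m x t\<bar> \<le> (\<Sum>l\<le>m. \<bar>y l - x l\<bar>)"
            if t: "t \<in> {0..T}" for t
          proof -
            show ?thesis using t step_index_le[OF T m t] unfolding step_path_def
              by (auto intro!: member_le_sum[where f = "\<lambda>l. \<bar>y l - x l\<bar>"])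
          qed
          hence "J1_dist T (step_path T m y) (step_path T m x) \<le> (\<Sum>l\<le>m. \<bar>y l - x l\<bar>)"
            by (intro J1_dist_le_sup[OF T] step_path_cadlag[OF T m])
          thus ?thesis using g_lip[OF step_path_cadlag[OF T m] step_path_cadlag[OF T m], of y x] by simp
        qed
        hence "((\<lambda>y. g (step_path T m y) - g (step_path T m x)) \<longlongrightarrow> 0) (at x)"
          by (intro Lim_null_comparison[OF _ lim] always_eventually) auto
        thus "isCont (\<lambda>x. g (step_path T m x)) x" unfolding isCont_def by (rule LIM_zero_cancel)
      qed
      hence 1: "(\<lambda>x::nat \<Rightarrow> real. g (step_path T m x)) \<in> borel_measurable borel"
        by (rule borel_measurable_continuous_onI)
      have "p m \<in> borel_measurable N"
      proof (rule measurable_coordinatewise_then_product)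
        fix l
        have "T / real m * real (min l m) \<in> {0..T}"
        proof -
          have "T * real (min l m) \<le> T * real m" using T by (intro mult_left_mono) auto
          thus ?thesis using T m by (simp add: field_simps)
        qed
        thus "(\<lambda>w. p m w l) \<in> borel_measurable N" unfolding p_def by (rule meas)
      qed
      from measurable_compose[OF this 1]
      show "(\<lambda>w. g (S (Suc m0) w)) \<in> borel_measurable N" using Seq[OF m] by (simp add: m_def)
    qed
    hence "{w \<in> space N. g (X w) = 0} \<in> sets N" by measurable
    moreover have "{w \<in> space N. g (X w) = 0} = {w \<in> space N. X w \<in> C}" using g0 cad by auto
    ultimately show ?thesis by simp
  qed simp
  show ?thesis unfolding borel_of_topology_def
  proof (rule measurable_measure_of)
    show "X \<in> space N \<rightarrow> topspace (J1_topology T)" using cad topspace_J1_topology[OF T] by auto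
    fix U assume "U \<in> {U. openin (J1_topology T) U}"
    hence U: "openin (J1_topology T) U" by simp
    have "{w \<in> space N. X w \<in> topspace (J1_topology T) - U} \<in> sets N"
      by (intro closed) (use U in auto)
    hence "space N - {w \<in> space N. X w \<in> topspace (J1_topology T) - U} \<in> sets N" by auto
    also have "space N - {w \<in> space N. X w \<in> topspace (J1_topology T) - U} = X -` U \<inter> space N"
      using cad topspace_J1_topology[OF T] openin_subset[OF U] by auto
    finally show "X -` U \<inter> space N \<in> sets N" .
  qed (auto dest: openin_subset)
qed

section \<open>Finite-dimensional functionals and the rate function\<close>

definition lin :: "nat \<Rightarrow> (nat \<Rightarrow> real) \<Rightarrow> (nat \<Rightarrow> real) \<Rightarrow> (real \<Rightarrow> real) \<Rightarrow> real" where
  "lin m t c \<phi> = (\<Sum>l=1..m. c l * \<phi> (t l))"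

text \<open>With times \<open>two s t\<close> and coefficients
  \<open>two (- \<alpha>) \<alpha>\<close>, the functional \<open>lin 2\<close> is \<alpha> times
  the increment from s to t.\<close>

definition two :: "'b \<Rightarrow> 'b \<Rightarrow> nat \<Rightarrow> 'b" where
  "two x y l = (if l = 1 then x else y)"

lemma lin_two: "lin 2 (two s t) (two p q) \<phi> = p * \<phi> s + q * \<phi> t"
  by (simp add: lin_def two_def numeral_2_eq_2)

text \<open>Dividing the hypothesis by k bounds the increment by a/k plus a multiple of t - s. A
  large k makes the first term small, and only then is the distance chosen; the resulting modulus
  depends on a and K but not on g.\<close>

lemma uniformly_continuous_on_modulus:
  fixes g :: "real \<Rightarrow> real"
  assumes K: "0 \<le> K"
    and mono: "\<And>s t. s \<in> D \<Longrightarrow> t \<in> D \<Longrightarrow> s \<le> t \<Longrightarrow> g s \<le> g t"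
    and mod: "\<And>s t k. s \<in> D \<Longrightarrow> t \<in> D \<Longrightarrow> s \<le> t \<Longrightarrow>
               real k * (g t - g s) \<le> a + K * (t - s) * (exp (real k) - 1)"
  shows "uniformly_continuous_on D g"
  unfolding uniformly_continuous_on_def
proof (intro allI impI)
  fix e :: real assume e: "0 < e"
  obtain k0 :: nat where "2 * a / e < real k0" using reals_Archimedean2 by blast
  define k where "k = Suc k0"
  have k: "0 < real k" "a / real k < e / 2"
    using \<open>2 * a / e < real k0\<close> e by (auto simp: k_def field_simps)
  define B where "B = K * (exp (real k) - 1)"
  have B: "0 \<le> B" using K by (simp add: B_def)
  \<comment> \<open>This makes B (t - s) smaller than k e/2; \<open>B + 1\<close> avoids a zero
    denominator.\<close>
  define d where "d = e * real k / (2 * (B + 1))"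
  have d: "0 < d" using e k B by (simp add: d_def)
  have key: "g t - g s < e" if st: "s \<in> D" "t \<in> D" "s \<le> t" "t - s < d" for s t
  proof -
    have "B * (t - s) \<le> (B + 1) * (t - s)" using st by (intro mult_right_mono) auto
    also have "\<dots> < (B + 1) * d" using st B by (intro mult_strict_left_mono) auto
    also have "\<dots> = e * real k / 2" using B by (simp add: d_def field_simps)
    finally have "B * (t - s) < real k * (e / 2)" by (simp add: mult.commute)
    moreover have "a < real k * (e / 2)" using k by (simp add: field_simps)
    moreover have "real k * (g t - g s) \<le> a + B * (t - s)"
      using mod[OF st(1-3), of k] by (simp add: B_def mult_ac)
    ultimately have "real k * (g t - g s) < real k * e" by (simp add: field_simps)
    thus ?thesis using k by simp
  qed
  show "\<exists>d>0. \<forall>x\<in>D. \<forall>x'\<in>D. dist x' x < d \<longrightarrow> dist (g x') (g x) < e"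
  proof (intro exI[of _ d] conjI ballI impI d)
    fix s t assume st: "s \<in> D" "t \<in> D" "dist t s < d"
    show "dist (g t) (g s) < e"
    proof (cases "s \<le> t")
      case True thus ?thesis using key[of s t] mono[of s t] st by (auto simp: dist_real_def)
    next
      case False thus ?thesis using key[of t s] mono[of t s] st by (auto simp: dist_real_def)
    qed
  qed
qed

text \<open>Integer values are left out on purpose: the property has to survive averaging and
  pointwise limits.\<close>

definition counting_like :: "real \<Rightarrow> (real \<Rightarrow> real) \<Rightarrow> bool" where
  "counting_like T \<phi> \<longleftrightarrow> \<phi> 0 = 0 \<and> mono_on {0..T} \<phi>"

lemma counting_like_bounds:
  assumes "0 < T" "counting_like T \<phi>" "t \<in> {0..T}"
  shows "0 \<le> \<phi> t" "\<phi> t \<le> \<phi> T"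
  using assms mono_onD[of "{0..T}" \<phi> 0 t] mono_onD[of "{0..T}" \<phi> t T] by (auto simp: counting_like_def)

lemma abs_lin_le:
  assumes "0 < T" "counting_like T \<phi>" "\<And>l. l \<in> {1..m} \<Longrightarrow> t l \<in> {0..T}"
  shows "\<bar>lin m t c \<phi>\<bar> \<le> (\<Sum>l=1..m. \<bar>c l\<bar>) * \<phi> T"
proof -
  have "\<bar>lin m t c \<phi>\<bar> \<le> (\<Sum>l=1..m. \<bar>c l * \<phi> (t l)\<bar>)" unfolding lin_def by (rule sum_abs)
  also have "\<dots> \<le> (\<Sum>l=1..m. \<bar>c l\<bar> * \<phi> T)"
    using counting_like_bounds[OF assms(1,2)] assms(3)
    by (intro sum_mono) (auto simp: abs_mult intro!: mult_left_mono)
  finally show ?thesis by (simp add: sum_distrib_right)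
qed

text \<open>The distinct nonzero times are sorted and the coefficients at equal times added up; time
  0 is dropped because \<psi> vanishes there. The assumption \<open>ne\<close> leaves at least one
  time, as \<open>rate\<close> requires.\<close>

lemma lin_merge_times:
  assumes t: "\<And>l. l \<in> {1..m} \<Longrightarrow> t l \<in> {0..T}" and ne: "\<not> t ` {1..m} \<subseteq> {0}"
  obtains m' t' c' where "m' \<ge> 1" "t' \<in> time_grids T m'"
    "\<And>\<psi>. \<psi> 0 = 0 \<Longrightarrow> lin m' t' c' \<psi> = lin m t c \<psi>"
proof -
  define S where "S = t ` {1..m} - {0}"
  have fin: "finite S" by (simp add: S_def)
  define h0 where "h0 = (!) (sorted_list_of_set S)"
  have h0: "bij_betw h0 {..<card S} S" "strict_mono_on {..<card S} h0"
    using fin sorted_wrt_nth_less[OF strict_sorted_list_of_set[of S]]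
    by (auto simp: h0_def intro!: bij_betw_nth strict_mono_onI)
  \<comment> \<open>List positions start at 0, grid indices at 1.\<close>
  define h where "h = (\<lambda>j. h0 (j - 1))"
  have "bij_betw (\<lambda>j. j - 1) {1..card S} {..<card S}"
    by (rule bij_betw_byWitness[where f' = Suc]) auto
  from bij_betw_trans[OF this h0(1)] have h1: "bij_betw h {1..card S} S"
    by (simp add: h_def comp_def)
  have h2: "strict_mono_on {1..card S} h"
  proof (rule strict_mono_onI)
    fix i j assume "i \<in> {1..card S}" "j \<in> {1..card S}" "i < j"
    thus "h i < h j" unfolding h_def by (intro strict_mono_onD[OF h0(2)]) auto
  qed
  note h = h1 h2
  define c' where "c' = (\<lambda>j. \<Sum>l\<in>{l\<in>{1..m}. t l = h j}. c l)"
  show ?thesis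
  proof (rule that[of "card S" h c'])
    show "card S \<ge> 1" using ne fin by (auto simp: S_def Suc_le_eq card_gt_0_iff)
    have "h ` {1..card S} = S" using h by (simp add: bij_betw_def)
    moreover have "S \<subseteq> {0<..T}" using t unfolding S_def by fastforce
    ultimately show "h \<in> time_grids T (card S)" using h by (simp add: time_grids_def)
    fix \<psi> :: "real \<Rightarrow> real" assume 0: "\<psi> 0 = 0"
    have "lin (card S) h c' \<psi> = (\<Sum>s\<in>S. (\<Sum>l\<in>{l\<in>{1..m}. t l = s}. c l) * \<psi> s)"
      unfolding lin_def c'_def
      using sum.reindex_bij_betw[OF h(1), of "\<lambda>s. (\<Sum>l\<in>{l\<in>{1..m}. t l = s}. c l) * \<psi> s"] .
    also have "\<dots> = (\<Sum>s\<in>t ` {1..m}. (\<Sum>l\<in>{l\<in>{1..m}. t l = s}. c l) * \<psi> s)"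
      by (rule sum.mono_neutral_left) (auto simp: S_def 0)
    also have "\<dots> = (\<Sum>s\<in>t ` {1..m}. \<Sum>l\<in>{l\<in>{1..m}. t l = s}. c l * \<psi> (t l))"
      by (intro sum.cong refl) (simp add: sum_distrib_right)
    also have "\<dots> = lin m t c \<psi>"
      unfolding lin_def by (rule sum.image_gen[symmetric]) simp
    finally show "lin (card S) h c' \<psi> = lin m t c \<psi>" .
  qed
qed

lemma lin_all_zero:
  assumes "t ` {1..m} \<subseteq> {0}" "\<psi> 0 = 0" shows "lin m t c \<psi> = 0"
proof -
  have "\<psi> (t l) = 0" if "l \<in> {1..m}" for l
  proof -
    have "t l = 0" using assms(1) that by blast
    thus ?thesis using assms(2) by simp
  qed
  thus ?thesis unfolding lin_def by (intro sum.neutral) simp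
qed

text \<open>A limit at \<open>at_right t\<close> says nothing about indices with s k = t, so these
  are split off by a principal filter; there the values agree trivially. At t = T the sequence is
  constant.\<close>

lemma tendsto_from_right:
  fixes \<phi> :: "real \<Rightarrow> real"
  assumes rc: "\<And>t. t \<in> {0..<T} \<Longrightarrow> (\<phi> \<longlongrightarrow> \<phi> t) (at_right t)"
    and s: "s \<longlonglongrightarrow> t" "\<And>k. t \<le> s k" "\<And>k. s k \<le> T" and t: "0 \<le> t"
  shows "(\<lambda>k. \<phi> (s k)) \<longlonglongrightarrow> \<phi> t"
proof (cases "t = T")
  case True
  hence "s k = T" for k using s(2,3)[of k] by simp
  thus ?thesis using True by simp
next
  case False
  have "t \<le> T" using s(2,3) order_trans by blast
  hence "(\<phi> \<longlongrightarrow> \<phi> t) (at_right t)" using False rc[of t] t by auto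
  hence "(\<phi> \<longlongrightarrow> \<phi> t) (at t within {t..})" by (simp add: at_within_Ici_at_right)
  moreover have "filterlim s (at t within {t..}) (inf sequentially (principal {k. s k \<noteq> t}))"
    unfolding filterlim_at eventually_inf_principal
    using s by (auto intro: filterlim_mono simp: le_infI1)
  ultimately have 1: "((\<lambda>k. \<phi> (s k)) \<longlongrightarrow> \<phi> t) (inf sequentially (principal {k. s k \<noteq> t}))"
    by (rule filterlim_compose)
  show ?thesis
  proof (rule tendstoI)
    fix e :: real assume e: "0 < e"
    from tendstoD[OF 1 e] have "\<forall>\<^sub>F k in sequentially. s k \<noteq> t \<longrightarrow> dist (\<phi> (s k)) (\<phi> t) < e"
      by (simp add: eventually_inf_principal)
    thus "\<forall>\<^sub>F k in sequentially. dist (\<phi> (s k)) (\<phi> t) < e"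
      by eventually_elim (use e in auto)
  qed
qed

text \<open>This is how a finite rate turns into exact statements: coefficients of unbounded size
  leave no room for a violation.\<close>

lemma le_by_all_multiples:
  fixes x a :: real
  assumes "\<And>n::nat. real n * x \<le> a" shows "x \<le> 0"
proof (rule ccontr)
  assume "\<not> x \<le> 0"
  then obtain n :: nat where "a < real n * x" using reals_Archimedean3[of x] by auto
  thus False using assms[of n] by simp
qed

text \<open>\<open>A_mgf\<close> compares an increment with a Poisson variable of mean K (t - s),
  whose exponential moment is the right-hand side. The arrival mechanism enters the large-deviation
  argument only through this bound and the regularity of the paths.\<close>

locale increasing_process = prob_space M for M :: "'a measure" +
  fixes A :: "'a \<Rightarrow> real \<Rightarrow> real" and T K :: real
  assumes T_pos: "0 < T" and K_nonneg: "0 \<le> K"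
    and A_meas: "\<And>t. t \<in> {0..T} \<Longrightarrow> (\<lambda>w. A w t) \<in> borel_measurable M"
    and A_inc: "\<And>w. w \<in> space M \<Longrightarrow> counting_like T (A w)"
    and A_rcont: "\<And>w t. w \<in> space M \<Longrightarrow> t \<in> {0..<T} \<Longrightarrow> (A w \<longlongrightarrow> A w t) (at_right t)"
    and A_mgf: "\<And>s t \<alpha>. 0 \<le> s \<Longrightarrow> s \<le> t \<Longrightarrow> t \<le> T \<Longrightarrow> 0 \<le> \<alpha> \<Longrightarrow>
      (\<integral>\<^sup>+w. ennreal (exp (\<alpha> * (A w t - A w s))) \<partial>M) \<le> ennreal (exp (K * (t - s) * (exp \<alpha> - 1)))"
begin

definition mgf :: "nat \<Rightarrow> (nat \<Rightarrow> real) \<Rightarrow> (nat \<Rightarrow> real) \<Rightarrow> real" where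
  "mgf m t c = expectation (\<lambda>w. exp (lin m t c (A w)))"

definition Lam :: "nat \<Rightarrow> (nat \<Rightarrow> real) \<Rightarrow> (nat \<Rightarrow> real) \<Rightarrow> real" where
  "Lam m t c = ln (mgf m t c)"

abbreviation imgf :: "real \<Rightarrow> real \<Rightarrow> real \<Rightarrow> real" where
  "imgf s t \<alpha> \<equiv> expectation (\<lambda>w. exp (\<alpha> * (A w t - A w s)))"

lemma T_mem: "T \<in> {0..T}" "0 \<in> {0..T}" using T_pos by auto

lemma A_zero: "w \<in> space M \<Longrightarrow> A w 0 = 0"
  using A_inc by (simp add: counting_like_def)

lemma A_nonneg: "w \<in> space M \<Longrightarrow> t \<in> {0..T} \<Longrightarrow> 0 \<le> A w t"
  and A_le_end: "w \<in> space M \<Longrightarrow> t \<in> {0..T} \<Longrightarrow> A w t \<le> A w T"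
  using counting_like_bounds[OF T_pos A_inc] by blast+

lemma A_mono: "w \<in> space M \<Longrightarrow> 0 \<le> s \<Longrightarrow> s \<le> t \<Longrightarrow> t \<le> T \<Longrightarrow> A w s \<le> A w t"
  using A_inc[of w] mono_onD[of "{0..T}" "A w" s t] by (auto simp: counting_like_def)

lemma measurable_lin [measurable]:
  "(\<And>l. l \<in> {1..m} \<Longrightarrow> t l \<in> {0..T}) \<Longrightarrow> (\<lambda>w. lin m t c (A w)) \<in> borel_measurable M"
  unfolding lin_def by (intro borel_measurable_sum borel_measurable_times borel_measurable_const A_meas) auto

lemma integrable_exp_increment:
  assumes "0 \<le> s" "s \<le> t" "t \<le> T" "0 \<le> \<alpha>"
  shows "integrable M (\<lambda>w. exp (\<alpha> * (A w t - A w s)))"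
    and "imgf s t \<alpha> \<le> exp (K * (t - s) * (exp \<alpha> - 1))"
proof -
  have "s \<in> {0..T}" "t \<in> {0..T}" using assms by auto
  note [measurable] = A_meas[OF this(1)] A_meas[OF this(2)]
  have [measurable]: "(\<lambda>w. exp (\<alpha> * (A w t - A w s))) \<in> borel_measurable M" by measurable
  show i: "integrable M (\<lambda>w. exp (\<alpha> * (A w t - A w s)))"
    using A_mgf[OF assms] by (intro integrableI_nonneg) (auto simp: less_top[symmetric] top_unique)
  have "ennreal (imgf s t \<alpha>) \<le> ennreal (exp (K * (t - s) * (exp \<alpha> - 1)))"
    using A_mgf[OF assms] i by (subst nn_integral_eq_integral[symmetric]) auto
  thus "imgf s t \<alpha> \<le> exp (K * (t - s) * (exp \<alpha> - 1))"
    by (simp add: ennreal_le_iff)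
qed

lemma integrable_exp_end: "integrable M (\<lambda>w. exp (r * A w T))"
proof (rule Bochner_Integration.integrable_bound)
  have "integrable M (\<lambda>w. exp (\<bar>r\<bar> * (A w T - A w 0)))"
    using T_pos by (intro integrable_exp_increment) auto
  thus "integrable M (\<lambda>w. exp (\<bar>r\<bar> * (A w T - A w 0)))" .
  show "(\<lambda>w. exp (r * A w T)) \<in> borel_measurable M"
    using A_meas[OF T_mem(1)] by measurable
  show "AE w in M. norm (exp (r * A w T)) \<le> norm (exp (\<bar>r\<bar> * (A w T - A w 0)))"
    using A_zero A_nonneg T_mem by (intro AE_I2) (auto intro!: mult_right_mono)
qed

text \<open>All exponential moments of A(T) are finite, and A(T) dominates the whole path, so this
  one criterion settles integrability for exponentials of path functionals.\<close>

lemma integrable_dominated: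
  assumes "Y \<in> borel_measurable M" "\<And>w. w \<in> space M \<Longrightarrow> \<bar>Y w\<bar> \<le> C * exp (r * A w T)"
  shows "integrable M (Y :: 'a \<Rightarrow> real)"
proof (rule Bochner_Integration.integrable_bound)
  show "integrable M (\<lambda>w. C * exp (r * A w T))" using integrable_exp_end by simp
  show "AE w in M. norm (Y w) \<le> norm (C * exp (r * A w T))"
    using assms(2) by (intro AE_I2) (fastforce intro: order_trans[OF _ abs_ge_self])
qed (fact assms(1))

lemma exp_lin_le:
  assumes "w \<in> space M" "\<And>l. l \<in> {1..m} \<Longrightarrow> t l \<in> {0..T}"
  shows "exp (lin m t c (A w)) \<le> exp ((\<Sum>l=1..m. \<bar>c l\<bar>) * A w T)"
proof -
  have "\<bar>lin m t c (A w)\<bar> \<le> (\<Sum>l=1..m. \<bar>c l\<bar>) * A w T"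
    by (rule abs_lin_le[OF T_pos A_inc[OF assms(1)]]) (rule assms(2))
  thus ?thesis by simp
qed

lemma integrable_exp_lin:
  assumes "\<And>l. l \<in> {1..m} \<Longrightarrow> t l \<in> {0..T}"
  shows "integrable M (\<lambda>w. exp (lin m t c (A w)))"
proof (rule integrable_dominated[of _ 1 "\<Sum>l=1..m. \<bar>c l\<bar>"])
  show "(\<lambda>w. exp (lin m t c (A w))) \<in> borel_measurable M"
    using measurable_lin[of m t c] assms by measurable
  show "\<bar>exp (lin m t c (A w))\<bar> \<le> 1 * exp ((\<Sum>l=1..m. \<bar>c l\<bar>) * A w T)" if "w \<in> space M" for w
    using exp_lin_le[OF that, of m t c] assms by simp
qed

lemma expectation_exp_pos:
  assumes "integrable M (\<lambda>w. exp (Y w))" shows "0 < expectation (\<lambda>w. exp (Y w :: real))"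
  using assms by (intro expectation_greater) auto

lemma mgf_pos: "(\<And>l. l \<in> {1..m} \<Longrightarrow> t l \<in> {0..T}) \<Longrightarrow> 0 < mgf m t c"
  unfolding mgf_def by (intro expectation_exp_pos integrable_exp_lin)

lemma exp_Lam: "(\<And>l. l \<in> {1..m} \<Longrightarrow> t l \<in> {0..T}) \<Longrightarrow> exp (Lam m t c) = mgf m t c"
  using mgf_pos by (simp add: Lam_def)

lemma log_exp_moment_eq:
  assumes "integrable M (\<lambda>w. exp (Y w))"
  shows "log_exp_moment M Y = ereal (ln (expectation (\<lambda>w. exp (Y w))))"
  using expectation_exp_pos[OF assms] unfolding log_exp_moment_def
  by (subst nn_integral_eq_integral[OF assms]) (auto simp: elog_def)

lemma Lambda_fdd_eq:
  assumes "\<And>l. l \<in> {1..m} \<Longrightarrow> t l \<in> {0..T}"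
  shows "Lambda_fdd M A m t c = ereal (Lam m t c)"
  using log_exp_moment_eq[OF integrable_exp_lin[where c = c, OF assms]]
  by (simp add: Lambda_fdd_def Lam_def mgf_def lin_def)

lemma time_grids_mem: "t \<in> time_grids T m \<Longrightarrow> l \<in> {1..m} \<Longrightarrow> t l \<in> {0..T}"
  unfolding time_grids_def by fastforce

lemma rate_ge_grid:
  assumes "m \<ge> 1" "t \<in> time_grids T m"
  shows "ereal (lin m t c \<phi> - Lam m t c) \<le> rate T M A \<phi>"
proof -
  have "ereal (lin m t c \<phi> - Lam m t c) = ereal (\<Sum>l=1..m. c l * \<phi> (t l)) - Lambda_fdd M A m t c"
    using Lambda_fdd_eq[where c = c, OF time_grids_mem[OF assms(2)]] by (simp add: lin_def)
  also have "\<dots> \<le> rate_fdd M A m t (\<lambda>l. \<phi> (t l))"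
    unfolding rate_fdd_def by (rule SUP_upper) simp
  also have "\<dots> \<le> rate T M A \<phi>" unfolding rate_def
    using assms by (intro SUP_upper2[of m] SUP_upper2[of t]) auto
  finally show ?thesis .
qed

lemma rate_leI:
  assumes "\<And>(m::nat) t c. m \<ge> 1 \<Longrightarrow> t \<in> time_grids T m \<Longrightarrow> ereal (lin m t c \<phi> - Lam m t c) \<le> b"
  shows "rate T M A \<phi> \<le> b"
  unfolding rate_def rate_fdd_def
proof (intro SUP_least)
  fix m :: nat and t c :: "nat \<Rightarrow> real" assume m: "m \<in> {1..}" and t: "t \<in> time_grids T m"
  have "ereal (\<Sum>l=1..m. c l * \<phi> (t l)) - Lambda_fdd M A m t c = ereal (lin m t c \<phi> - Lam m t c)"
    using Lambda_fdd_eq[where c = c, OF time_grids_mem[OF t]] by (simp add: lin_def)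
  thus "ereal (\<Sum>l=1..m. c l * \<phi> (t l)) - Lambda_fdd M A m t c \<le> b" using assms m t by simp
qed

lemma singleton_grid: "0 < s \<Longrightarrow> s \<le> T \<Longrightarrow> (\<lambda>_. s) \<in> time_grids T 1"
  by (auto simp: time_grids_def strict_mono_on_def)

lemma lin_zero_coeff: "lin m t (\<lambda>_. 0) \<phi> = 0" by (simp add: lin_def)

lemma Lam_zero_coeff: "Lam m t (\<lambda>_. 0) = 0"
  by (simp add: Lam_def mgf_def lin_zero_coeff prob_space)

lemma rate_nonneg: "0 \<le> rate T M A \<phi>"
  using rate_ge_grid[OF _ singleton_grid[of T], of "\<lambda>_. 0" \<phi>] T_pos
  by (simp add: lin_zero_coeff Lam_zero_coeff zero_ereal_def)

text \<open>Tuples with repetitions or with time 0 reduce to grids by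
  \<open>lin_merge_times\<close>, since \<phi> and the sample paths vanish at 0; if all times are 0
  the condition reads 0 \<le> a. Admitting such tuples allows times to be perturbed later without
  keeping them strictly ordered.\<close>

lemma rate_le_iff:
  assumes 0: "\<phi> 0 = 0"
  shows "rate T M A \<phi> \<le> ereal a \<longleftrightarrow>
    (\<forall>m t c. (\<forall>l\<in>{1..m}. t l \<in> {0..T}) \<longrightarrow> lin m t c \<phi> \<le> a + Lam m t c)"
proof (intro iffI allI impI)
  fix m :: nat and t c :: "nat \<Rightarrow> real"
  assume le: "rate T M A \<phi> \<le> ereal a" and t: "\<forall>l\<in>{1..m}. t l \<in> {0..T}"
  show "lin m t c \<phi> \<le> a + Lam m t c"
  proof (cases "t ` {1..m} \<subseteq> {0}")
    case True
    have "mgf m t c = expectation (\<lambda>w. 1)" unfolding mgf_def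
      by (intro Bochner_Integration.integral_cong) (auto simp: lin_all_zero[OF True] A_zero)
    hence "Lam m t c = 0" by (simp add: Lam_def prob_space)
    moreover have "0 \<le> ereal a" using rate_nonneg le by (rule order_trans)
    ultimately show ?thesis using lin_all_zero[of t m \<phi> c] True 0 by simp
  next
    case False
    obtain m' t' c' where *: "m' \<ge> 1" "t' \<in> time_grids T m'"
      "\<And>\<psi>. \<psi> 0 = 0 \<Longrightarrow> lin m' t' c' \<psi> = lin m t c \<psi>"
      using lin_merge_times[where c = c, OF t[rule_format] False] by metis
    have "mgf m' t' c' = mgf m t c" unfolding mgf_def
      by (intro Bochner_Integration.integral_cong) (auto simp: *(3) A_zero)
    moreover have "ereal (lin m' t' c' \<phi> - Lam m' t' c') \<le> ereal a"
      using rate_ge_grid[OF *(1,2)] le by (rule order_trans)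
    ultimately show ?thesis using *(3)[of \<phi>] 0 by (simp add: Lam_def)
  qed
next
  assume *: "\<forall>m t c. (\<forall>l\<in>{1..m}. t l \<in> {0..T}) \<longrightarrow> lin m t c \<phi> \<le> a + Lam m t c"
  show "rate T M A \<phi> \<le> ereal a"
    using * time_grids_mem by (intro rate_leI) (force simp: algebra_simps)
qed

section \<open>Regularity of paths of finite rate\<close>

lemma ln_mgf_increment_le:
  assumes "0 \<le> s" "s \<le> t" "t \<le> T"
  shows "0 \<le> \<alpha> \<Longrightarrow> ln (imgf s t \<alpha>) \<le> K * (t - s) * (exp \<alpha> - 1)"
    and "\<alpha> \<le> 0 \<Longrightarrow> ln (imgf s t \<alpha>) \<le> 0"
proof -
  assume \<alpha>: "0 \<le> \<alpha>"
  show "ln (imgf s t \<alpha>) \<le> K * (t - s) * (exp \<alpha> - 1)"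
    using integrable_exp_increment[OF assms \<alpha>] expectation_exp_pos[OF integrable_exp_increment(1)[OF assms \<alpha>]]
    by (metis ln_exp ln_le_cancel_iff exp_gt_zero)
next
  assume \<alpha>: "\<alpha> \<le> 0"
  have st: "s \<in> {0..T}" "t \<in> {0..T}" using assms by auto
  have le: "exp (\<alpha> * (A w t - A w s)) \<le> 1" if "w \<in> space M" for w
    using A_mono[OF that assms] \<alpha> by (simp add: mult_nonpos_nonneg)
  have i: "integrable M (\<lambda>w. exp (\<alpha> * (A w t - A w s)))"
    using A_meas[OF st(1)] A_meas[OF st(2)] le
    by (intro integrable_dominated[of _ 1 0]) (measurable, auto)
  have "imgf s t \<alpha> \<le> 1"
    using integral_mono[OF i, of "\<lambda>_. 1"] le by (simp add: prob_space)
  thus "ln (imgf s t \<alpha>) \<le> 0"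
    using expectation_exp_pos[OF i] by simp
qed

lemma Lam_two: "Lam 2 (two s t) (two (- \<alpha>) \<alpha>) = ln (imgf s t \<alpha>)"
  unfolding Lam_def mgf_def by (simp add: lin_two algebra_simps)

lemma Lam_one:
  "Lam 1 (\<lambda>_. t) (\<lambda>_. \<alpha>) = ln (imgf 0 t \<alpha>)"
proof -
  have "mgf 1 (\<lambda>_. t) (\<lambda>_. \<alpha>) = imgf 0 t \<alpha>"
    unfolding mgf_def by (intro Bochner_Integration.integral_cong) (auto simp: A_zero lin_def)
  thus ?thesis by (simp add: Lam_def)
qed

text \<open>Positive \<alpha> limits growth and will give continuity. Negative \<alpha> limits
  decrease, by a bound that does not grow with the size of \<alpha>, and will give
  monotonicity.\<close>

lemma increment_bound:
  assumes "0 \<le> s" "s \<le> t" "t \<le> T"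
    and "lin 2 (two s t) (two (- \<alpha>) \<alpha>) g \<le> a + Lam 2 (two s t) (two (- \<alpha>) \<alpha>)"
  shows "0 \<le> \<alpha> \<Longrightarrow> \<alpha> * (g t - g s) \<le> a + K * (t - s) * (exp \<alpha> - 1)"
    and "\<alpha> \<le> 0 \<Longrightarrow> \<alpha> * (g t - g s) \<le> a"
  using assms(4) ln_mgf_increment_le[OF assms(1-3), of \<alpha>] unfolding lin_two Lam_two
  by (auto simp: algebra_simps)

text \<open>Time 0 belongs to no grid, so the value there is reached as a limit from the right. For
  a fixed coefficient n or -n let t tend to 0, which removes the term with K, and only then let n
  grow.\<close>

lemma finite_rate_start:
  assumes \<phi>: "\<phi> \<in> cadlag T" and le: "rate T M A \<phi> \<le> ereal a"
  shows "\<phi> 0 = 0"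
proof -
  have one: "\<alpha> * \<phi> t \<le> a + ln (imgf 0 t \<alpha>)" if "0 < t" "t \<le> T" for t \<alpha>
  proof -
    have "ereal (lin 1 (\<lambda>_. t) (\<lambda>_. \<alpha>) \<phi> - Lam 1 (\<lambda>_. t) (\<lambda>_. \<alpha>)) \<le> ereal a"
      using rate_ge_grid[OF _ singleton_grid[OF that]] le order_trans by blast
    thus ?thesis by (simp add: Lam_one[symmetric] lin_def)
  qed
  have lim: "(\<phi> \<longlongrightarrow> \<phi> 0) (at_right 0)" using \<phi> T_pos by (auto simp: cadlag_def)
  have ev: "\<forall>\<^sub>F t in at_right 0. 0 < t \<and> t \<le> T"
    unfolding eventually_at_right_field using T_pos by (intro exI[of _ T]) auto
  have "- \<phi> 0 \<le> 0"
  proof (rule le_by_all_multiples)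
    fix n :: nat
    have "((\<lambda>t. - real n * \<phi> t) \<longlongrightarrow> - real n * \<phi> 0) (at_right 0)" by (intro tendsto_intros lim)
    moreover have "\<forall>\<^sub>F t in at_right 0. - real n * \<phi> t \<le> a"
      using ev
    proof eventually_elim
      case (elim t)
      thus ?case using one[of t "- real n"] ln_mgf_increment_le(2)[of 0 t "- real n"] by auto
    qed
    ultimately have "- real n * \<phi> 0 \<le> a" by (rule tendsto_upperbound) simp
    thus "real n * - \<phi> 0 \<le> a" by simp
  qed
  moreover have "\<phi> 0 \<le> 0"
  proof (rule le_by_all_multiples)
    fix n :: nat
    have "((\<lambda>t. real n * \<phi> t - K * (t - 0) * (exp (real n) - 1)) \<longlongrightarrow>
        real n * \<phi> 0 - K * (0 - 0) * (exp (real n) - 1)) (at_right 0)" by (intro tendsto_intros lim)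
    moreover have "\<forall>\<^sub>F t in at_right 0. real n * \<phi> t - K * (t - 0) * (exp (real n) - 1) \<le> a"
      using ev
    proof eventually_elim
      case (elim t)
      thus ?case using one[of t "real n"] ln_mgf_increment_le(1)[of 0 t "real n"] by auto
    qed
    ultimately have "real n * \<phi> 0 - K * (0 - 0) * (exp (real n) - 1) \<le> a" by (rule tendsto_upperbound) simp
    thus "real n * \<phi> 0 \<le> a" by simp
  qed
  ultimately show ?thesis by simp
qed

text \<open>The points \<open>D\<close> may be a dense subset and the coefficients integers: this is all that survives
  of the rate bound for pointwise limits along a countable family of functionals.\<close>

lemma increment_bounds_imp:
  assumes D: "D \<subseteq> {0..T}"
    and le: "\<And>s t \<alpha>. s \<in> D \<Longrightarrow> t \<in> D \<Longrightarrow> \<alpha> \<in> \<int> \<Longrightarrow>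
      lin 2 (two s t) (two (- \<alpha>) \<alpha>) g \<le> a + Lam 2 (two s t) (two (- \<alpha>) \<alpha>)"
  shows "mono_on D g" and "uniformly_continuous_on D g"
proof -
  have mono: "g s \<le> g t" if st: "s \<in> D" "t \<in> D" "s \<le> t" for s t
  proof -
    have "g s - g t \<le> 0"
    proof (rule le_by_all_multiples)
      fix n :: nat
      have "- real n * (g t - g s) \<le> a"
        using st D le[of s t "- real n"] by (intro increment_bound(2)[of s t]) auto
      thus "real n * (g s - g t) \<le> a" by (simp add: algebra_simps)
    qed
    thus ?thesis by simp
  qed
  thus "mono_on D g" by (auto intro: mono_onI)
  show "uniformly_continuous_on D g"
  proof (rule uniformly_continuous_on_modulus[OF K_nonneg mono])
    fix s t k assume st: "s \<in> D" "t \<in> D" "s \<le> t"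
    show "real k * (g t - g s) \<le> a + K * (t - s) * (exp (real k) - 1)"
      using st D le[of s t "real k"] by (intro increment_bound(1)) auto
  qed
qed

lemma finite_rate_regular:
  assumes \<phi>: "\<phi> \<in> cadlag T" and le: "rate T M A \<phi> \<le> ereal a"
  shows "counting_like T \<phi>" and "uniformly_continuous_on {0..T} \<phi>"
proof -
  have 0: "\<phi> 0 = 0" by (rule finite_rate_start[OF assms])
  have *: "lin 2 (two s t) (two (- \<alpha>) \<alpha>) \<phi> \<le> a + Lam 2 (two s t) (two (- \<alpha>) \<alpha>)"
    if "s \<in> {0..T}" "t \<in> {0..T}" for s t \<alpha>
    using iffD1[OF rate_le_iff[of \<phi> a] le, OF 0] that by (auto simp: two_def)
  show "counting_like T \<phi>" "uniformly_continuous_on {0..T} \<phi>"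
    using increment_bounds_imp[of "{0..T}" \<phi> a] * 0 by (auto simp: counting_like_def)
qed

text \<open>Dominated convergence; a one-sided bound on Y k is enough because exp is positive and
  increasing.\<close>

lemma expectation_exp_tendsto:
  assumes "\<And>k. Y k \<in> borel_measurable M" "Z \<in> borel_measurable M"
    and "\<And>w. w \<in> space M \<Longrightarrow> (\<lambda>k. Y k w) \<longlonglongrightarrow> Z w"
    and "\<And>k w. w \<in> space M \<Longrightarrow> Y k w \<le> r * A w T"
  shows "(\<lambda>k. expectation (\<lambda>w. exp (Y k w))) \<longlonglongrightarrow> expectation (\<lambda>w. exp (Z w :: real))"
proof (rule integral_dominated_convergence[where w = "\<lambda>w. exp (r * A w T)"])
  show "AE w in M. (\<lambda>k. exp (Y k w)) \<longlonglongrightarrow> exp (Z w)"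
    using assms(3) by (intro AE_I2 tendsto_exp) auto
qed (use assms integrable_exp_end in \<open>auto intro!: AE_I2\<close>)

lemma A_tendsto_right:
  assumes "w \<in> space M" "s \<longlonglongrightarrow> t" "\<And>k. t \<le> s k" "\<And>k. s k \<le> T" "0 \<le> t"
  shows "(\<lambda>k. A w (s k)) \<longlonglongrightarrow> A w t"
  using assms A_rcont by (intro tendsto_from_right[of T "A w"]) auto

text \<open>Continuity jointly in times and coefficients. The times approach from the right, where
  the sample paths are continuous, and convergent coefficients are bounded, which yields one
  dominating exponential.\<close>

lemma Lam_tendsto:
  assumes t: "\<And>l. l \<in> {1..m} \<Longrightarrow> t l \<in> {0..T}"
    and s: "\<And>l. l \<in> {1..m} \<Longrightarrow> (\<lambda>k. s k l) \<longlonglongrightarrow> t l"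
      "\<And>k l. l \<in> {1..m} \<Longrightarrow> t l \<le> s k l \<and> s k l \<le> T"
    and c: "\<And>l. l \<in> {1..m} \<Longrightarrow> (\<lambda>k. c k l) \<longlonglongrightarrow> d l"
  shows "(\<lambda>k. Lam m (s k) (c k)) \<longlonglongrightarrow> Lam m t d"
proof -
  have s_mem: "s k l \<in> {0..T}" if "l \<in> {1..m}" for k l using t[OF that] s(2)[OF that, of k] by auto
  have "\<exists>B. \<forall>k. \<bar>c k l\<bar> \<le> B" if "l \<in> {1..m}" for l
    using c[OF that] by (metis Bseq_def convergentI convergent_imp_Bseq real_norm_def)
  then obtain B where B: "\<And>k l. l \<in> {1..m} \<Longrightarrow> \<bar>c k l\<bar> \<le> B l" by metis
  have "(\<lambda>k. mgf m (s k) (c k)) \<longlonglongrightarrow> mgf m t d"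
    unfolding mgf_def
  proof (rule expectation_exp_tendsto[where r = "\<Sum>l=1..m. B l"])
    fix w assume w: "w \<in> space M"
    show "(\<lambda>k. lin m (s k) (c k) (A w)) \<longlonglongrightarrow> lin m t d (A w)"
      unfolding lin_def using s t c w by (intro tendsto_intros A_tendsto_right) auto
    fix k
    have "lin m (s k) (c k) (A w) \<le> (\<Sum>l=1..m. \<bar>c k l\<bar>) * A w T"
      using abs_lin_le[OF T_pos A_inc[OF w], of m "s k" "c k"] s_mem by auto
    also have "\<dots> \<le> (\<Sum>l=1..m. B l) * A w T"
      using A_nonneg[OF w T_mem(1)] B by (intro mult_right_mono sum_mono) auto
    finally show "lin m (s k) (c k) (A w) \<le> (\<Sum>l=1..m. B l) * A w T" .
  qed (use t s_mem in \<open>auto intro!: measurable_lin\<close>)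
  thus ?thesis unfolding Lam_def using mgf_pos[of m t d] t by (intro tendsto_ln) auto
qed

end

section \<open>Compactness of level sets\<close>

abbreviation round_up :: "real \<Rightarrow> nat \<Rightarrow> real \<Rightarrow> real" where
  "round_up T k \<equiv> ceil_to (T / real (Suc k))"

lemma ceil_to_le_end: "0 < T \<Longrightarrow> t \<le> T \<Longrightarrow> round_up T k t \<le> T"
  using ceil_to_mono[of "T / real (Suc k)" t T] ceil_to_end[of "Suc k" T] by simp

lemma tendsto_const_over_Suc: "(\<lambda>k. x / real (Suc k)) \<longlonglongrightarrow> (0::real)"
  using LIMSEQ_Suc[OF lim_const_over_n[of x]] by simp

lemma ceil_to_tendsto:
  assumes "0 < T" shows "(\<lambda>k. round_up T k t) \<longlonglongrightarrow> t"
proof (rule tendsto_sandwich[of "\<lambda>_. t" _ _ "\<lambda>k. t + T / real (Suc k)"])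
  have "(\<lambda>k. t + T / real (Suc k)) \<longlonglongrightarrow> t + 0" by (intro tendsto_intros tendsto_const_over_Suc)
  thus "(\<lambda>k. t + T / real (Suc k)) \<longlonglongrightarrow> t" by simp
  show "\<forall>\<^sub>F k in sequentially. t \<le> round_up T k t"
    using assms by (intro always_eventually allI ceil_to_ge) simp
  show "\<forall>\<^sub>F k in sequentially. round_up T k t \<le> t + T / real (Suc k)"
    using assms by (intro always_eventually allI less_imp_le ceil_to_less) simp
qed simp

text \<open>Rational multiples of T rather than rational times: T itself, the equidistant grids and
  all values of \<open>round_up\<close> on the interval then belong to the set, also for irrational
  T.\<close>

definition fractions :: "real \<Rightarrow> real set" where
  "fractions T = (\<lambda>q. T * q) ` (\<rat> \<inter> {0..1})"

lemma countable_fractions: "countable (fractions T)"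
  unfolding fractions_def by (intro countable_image countable_Int1 countable_rat)

lemma fractions_subset: "0 < T \<Longrightarrow> fractions T \<subseteq> {0..T}"
  unfolding fractions_def by (auto intro: mult_left_le)

lemma zero_in_fractions: "0 \<in> fractions T"
  unfolding fractions_def by force

lemma end_in_fractions: "T \<in> fractions T"
  unfolding fractions_def by force

lemma ceil_to_in_fractions:
  assumes "0 < T" "0 \<le> t" "t \<le> T" shows "round_up T k t \<in> fractions T"
proof -
  define q :: real where "q = of_int \<lceil>t / (T / real (Suc k))\<rceil> / real (Suc k)"
  have eq: "round_up T k t = T * q" by (simp add: ceil_to_def q_def)
  have "q \<in> \<rat>" unfolding q_def by (intro Rats_divide) auto
  moreover have "0 \<le> T * q" "T * q \<le> T"
    using ceil_to_le_end[OF assms(1,3)] ceil_to_ge[of "T / real (Suc k)" t] assms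
    unfolding eq[symmetric] by auto
  hence "q \<in> {0..1}" using assms(1) by (auto simp: zero_le_mult_iff)
  ultimately show ?thesis unfolding eq fractions_def by blast
qed

lemma grid_in_fractions:
  assumes "l \<le> m" "m \<ge> 1" shows "T / real m * real l \<in> fractions T"
  unfolding fractions_def using assms by (intro image_eqI[of _ _ "real l / real m"]) auto

lemma closure_fractions:
  assumes "0 < T" shows "closure (fractions T) = {0..T}"
proof
  show "closure (fractions T) \<subseteq> {0..T}" using fractions_subset[OF assms] by (intro closure_minimal) auto
  show "{0..T} \<subseteq> closure (fractions T)"
  proof
    fix t assume "t \<in> {0..T}"
    hence "round_up T k t \<in> fractions T" for k
      using ceil_to_in_fractions[OF assms] by simp
    thus "t \<in> closure (fractions T)"
      unfolding closure_sequential using ceil_to_tendsto[OF assms, of t]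
      by (intro exI[of _ "\<lambda>k. round_up T k t"] conjI allI)
  qed
qed

lemma rational_approx: "\<exists>d. (\<forall>k::nat. d k \<in> \<rat>) \<and> d \<longlonglongrightarrow> (c::real)"
proof -
  have "\<exists>q\<in>\<rat>. c < q \<and> q < c + 1 / real (Suc k)" for k by (rule Rats_dense_in_real) simp
  then obtain d where d: "\<And>k. d k \<in> \<rat>" "\<And>k. c < d k" "\<And>k. d k < c + 1 / real (Suc k)" by metis
  have "(\<lambda>k. c + 1 / real (Suc k)) \<longlonglongrightarrow> c + 0" by (intro tendsto_intros tendsto_const_over_Suc)
  hence "(\<lambda>k. c + 1 / real (Suc k)) \<longlonglongrightarrow> c" by simp
  hence "d \<longlonglongrightarrow> c"
    using d by (intro tendsto_sandwich[of "\<lambda>_. c" d _ "\<lambda>k. c + 1 / real (Suc k)"] always_eventually)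
      (auto intro: less_imp_le)
  thus ?thesis using d(1) by blast
qed

text \<open>The monotone \<phi> lies between its values at the neighbouring grid points p \<le> t
  \<le> q, where it is within e of \<psi>, and \<psi> changes by at most e over one cell. The
  modulus of continuity is that of \<psi> alone.\<close>

lemma grid_sandwich:
  assumes m: "m \<ge> 1" and T: "0 < T" and \<phi>: "counting_like T \<phi>"
    and grid: "\<And>l. l \<le> m \<Longrightarrow> \<bar>\<phi> (T / real m * real l) - \<psi> (T / real m * real l)\<bar> \<le> e"
    and osc: "\<And>s t. s \<in> {0..T} \<Longrightarrow> t \<in> {0..T} \<Longrightarrow> \<bar>s - t\<bar> \<le> T / real m \<Longrightarrow> \<bar>\<psi> s - \<psi> t\<bar> \<le> e"
    and t: "t \<in> {0..T}"
  shows "\<bar>\<phi> t - \<psi> t\<bar> \<le> 2 * e"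
proof -
  define h where "h = T / real m"
  have h: "0 < h" using m T by (simp add: h_def)
  define p q where "p = floor_to h t" and "q = ceil_to h t"
  have tm: "t / h \<le> real m" using t h m T by (simp add: h_def field_simps)
  have pe: "p = h * real (nat \<lfloor>t / h\<rfloor>)" "nat \<lfloor>t / h\<rfloor> \<le> m"
    using t h tm by (auto simp: p_def floor_to_def) linarith
  have qe: "q = h * real (nat \<lceil>t / h\<rceil>)" "nat \<lceil>t / h\<rceil> \<le> m"
    using t h tm by (auto simp: q_def ceil_to_def ceiling_le_iff) 
  have gp: "\<bar>\<phi> p - \<psi> p\<bar> \<le> e" using grid[OF pe(2)] by (simp add: pe(1) h_def)
  have gq: "\<bar>\<phi> q - \<psi> q\<bar> \<le> e" using grid[OF qe(2)] by (simp add: qe(1) h_def)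
  have p: "0 \<le> p" "p \<le> t" using t h by (auto simp: p_def floor_to_le floor_to_nonneg)
  have "q \<le> T" using ceil_to_mono[OF h, of t T] ceil_to_end[OF m T] t by (simp add: q_def h_def)
  hence q: "t \<le> q" "q \<le> T" using h by (auto simp: q_def ceil_to_ge)
  have "t / h - 1 < of_int \<lfloor>t / h\<rfloor>" by linarith
  hence "h * (t / h - 1) < p" unfolding p_def floor_to_def using h by (intro mult_strict_left_mono)
  hence tp: "t - p \<le> h" using h by (simp add: algebra_simps)
  have qt: "q - t \<le> h" using ceil_to_less[OF h, of t] by (simp add: q_def)
  have "\<phi> p \<le> \<phi> t" "\<phi> t \<le> \<phi> q"
    using \<phi> p q t mono_onD[of "{0..T}" \<phi> p t] mono_onD[of "{0..T}" \<phi> t q] by (auto simp: counting_like_def)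
  moreover have "\<bar>\<psi> p - \<psi> t\<bar> \<le> e" "\<bar>\<psi> q - \<psi> t\<bar> \<le> e"
    using tp qt p q t by (auto intro!: osc simp: h_def[symmetric])
  ultimately show ?thesis using gp gq by linarith
qed

lemma fine_grid:
  assumes \<psi>: "uniformly_continuous_on {0..T} \<psi>" and e: "0 < e"
  obtains m where "m \<ge> 1"
    "\<And>s t. s \<in> {0..T} \<Longrightarrow> t \<in> {0..T} \<Longrightarrow> \<bar>s - t\<bar> \<le> T / real m \<Longrightarrow> \<bar>\<psi> s - \<psi> t :: real\<bar> \<le> e"
proof -
  obtain d where d: "d > 0" "\<And>s t. s \<in> {0..T} \<Longrightarrow> t \<in> {0..T} \<Longrightarrow> dist t s < d \<Longrightarrow> dist (\<psi> t) (\<psi> s) < e"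
    using \<psi> e unfolding uniformly_continuous_on_def by metis
  obtain k where k: "T / real (Suc k) < d"
    using order_tendstoD(2)[OF tendsto_const_over_Suc[of T] d(1)] by (auto simp: eventually_sequentially)
  show ?thesis
  proof (rule that[of "Suc k"])
    fix s t assume "s \<in> {0..T}" "t \<in> {0..T}" "\<bar>s - t\<bar> \<le> T / real (Suc k)"
    thus "\<bar>\<psi> s - \<psi> t\<bar> \<le> e" using d(2)[of t s] k by (simp add: dist_real_def)
  qed simp
qed

text \<open>A grid fine enough for the modulus of \<psi> is finite and contained in
  \<open>fractions T\<close>, so pointwise convergence on the dense set is uniform on that grid;
  monotonicity does the rest.\<close>

lemma uniform_limit_counting_like:
  assumes T: "0 < T" and \<psi>: "uniformly_continuous_on {0..T} \<psi>"
    and \<phi>: "\<And>n. counting_like T (\<phi> n)"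
    and lim: "\<And>s. s \<in> fractions T \<Longrightarrow> (\<lambda>n. \<phi> n s) \<longlonglongrightarrow> \<psi> s" and e: "0 < e"
  shows "\<forall>\<^sub>F n in sequentially. \<forall>t\<in>{0..T}. \<bar>\<phi> n t - \<psi> t\<bar> \<le> e"
proof -
  obtain m where m: "m \<ge> 1"
    "\<And>s t. s \<in> {0..T} \<Longrightarrow> t \<in> {0..T} \<Longrightarrow> \<bar>s - t\<bar> \<le> T / real m \<Longrightarrow> \<bar>\<psi> s - \<psi> t\<bar> \<le> e / 2"
    using fine_grid[OF \<psi>, of "e / 2"] e by auto
  have "\<forall>\<^sub>F n in sequentially. \<forall>l\<in>{..m}. dist (\<phi> n (T / real m * real l)) (\<psi> (T / real m * real l)) < e / 2"
    using e m by (intro eventually_ball_finite ballI tendstoD lim grid_in_fractions) auto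
  thus ?thesis
  proof eventually_elim
    case (elim n)
    have "\<bar>\<phi> n t - \<psi> t\<bar> \<le> 2 * (e / 2)" if "t \<in> {0..T}" for t
    proof (rule grid_sandwich[OF m(1) T \<phi> _ m(2) that])
      show "\<bar>\<phi> n (T / real m * real l) - \<psi> (T / real m * real l)\<bar> \<le> e / 2" if "l \<le> m" for l
        using elim that by (auto simp: dist_real_def less_imp_le)
    qed
    thus ?case by simp
  qed
qed

lemma continuous_in_cadlag:
  assumes "continuous_on {0..T} h" shows "restrict h {0..T} \<in> cadlag T"
proof -
  let ?h = "restrict h {0..T}"
  have c: "(?h \<longlongrightarrow> ?h t) (at t within {0..T})" if "t \<in> {0..T}" for t
  proof -
    have "continuous_on {0..T} ?h" by (rule continuous_on_eq[OF assms]) simp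
    thus ?thesis using that unfolding continuous_on_def by blast
  qed
  have "(?h \<longlongrightarrow> ?h t) (at_right t)" if "t \<in> {0..<T}" for t
    using tendsto_mono[OF at_le[of "{t..T}" "{0..T}"] c[of t]] that by (auto simp: at_within_Icc_at_right)
  moreover have "(?h \<longlongrightarrow> ?h t) (at_left t)" if "t \<in> {0<..T}" for t
    using tendsto_mono[OF at_le[of "{0..t}" "{0..T}"] c[of t]] that by (auto simp: at_within_Icc_at_left)
  ultimately show ?thesis unfolding cadlag_def by blast
qed

text \<open>\<open>PiE\<close> fixes all values off \<open>{1..m}\<close>, so only finitely many
  coordinates vary and the set is countable.\<close>

definition test_functionals :: "real \<Rightarrow> (nat \<times> (nat \<Rightarrow> real) \<times> (nat \<Rightarrow> real)) set" where
  "test_functionals T = (SIGMA m:UNIV. PiE {1..m} (\<lambda>_. fractions T) \<times> PiE {1..m} (\<lambda>_. \<rat>))"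

definition test_functional :: "real \<Rightarrow> nat \<Rightarrow> nat \<times> (nat \<Rightarrow> real) \<times> (nat \<Rightarrow> real)" where
  "test_functional T = from_nat_into (test_functionals T)"

lemma countable_test_functionals: "countable (test_functionals T)"
  unfolding test_functionals_def
  by (intro countable_SIGMA countable_PiE countable_fractions countable_rat countableI_type) auto

lemma test_functional_range: "range (test_functional T) = test_functionals T"
proof -
  have "(0, (\<lambda>_. undefined), (\<lambda>_. undefined)) \<in> test_functionals T"
    by (simp add: test_functionals_def)
  thus ?thesis unfolding test_functional_def
    using countable_test_functionals by (intro range_from_nat_into) auto
qed

lemma test_functional_times:
  assumes "0 < T" "test_functional T j = (m, t, c)" "l \<in> {1..m}"
  shows "t l \<in> {0..T}" "t l \<in> fractions T"
proof -
  have "(m, t, c) \<in> test_functionals T" using assms(2) test_functional_range by (metis rangeI)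
  thus "t l \<in> fractions T" using assms(3) by (auto simp: test_functionals_def PiE_mem)
  thus "t l \<in> {0..T}" using fractions_subset[OF assms(1)] by blast
qed

lemma uniform_limit_imp_J1_limit:
  assumes T: "0 < T"
    and cad: "\<And>n. \<phi> n \<in> cadlag T" "\<psi> \<in> cadlag T"
    and lim: "\<And>e. 0 < e \<Longrightarrow> \<forall>\<^sub>F n in sequentially. \<forall>t\<in>{0..T}. \<bar>\<phi> n t - \<psi> t\<bar> \<le> e"
  shows "limitin (J1_topology T) \<phi> \<psi> sequentially"
proof -
  interpret J: Metric_space "cadlag T" "J1_dist T" by (rule Metric_space_J1[OF T])
  have "\<forall>\<^sub>F n in sequentially. J1_dist T (\<phi> n) \<psi> < e" if e: "0 < e" for e
  proof -
    have "\<forall>\<^sub>F n in sequentially. \<forall>t\<in>{0..T}. \<bar>\<phi> n t - \<psi> t\<bar> \<le> e / 2" using lim[of "e / 2"] e by simp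
    thus ?thesis
    proof eventually_elim
      case (elim n)
      have "J1_dist T (\<phi> n) \<psi> \<le> e / 2"
        using elim by (intro J1_dist_le_sup T cad) auto
      thus ?case using e by simp
    qed
  qed
  thus ?thesis unfolding J1_topology_def J.limitin_metric using cad by (auto elim: eventually_mono)
qed

section \<open>Extraction of limits from countably many half-space conditions\<close>

context increasing_process
begin

definition tested :: "real \<Rightarrow> nat \<Rightarrow> (real \<Rightarrow> real) \<Rightarrow> bool" where
  "tested a j \<phi> = (case test_functional T j of (m, t, c) \<Rightarrow> lin m t c \<phi> \<le> a + Lam m t c)"

lemma tested_index:
  assumes "\<And>l. l \<in> {1..m} \<Longrightarrow> t l \<in> fractions T" "\<And>l. l \<in> {1..m} \<Longrightarrow> c l \<in> \<rat>"
  shows "\<exists>j. \<forall>a \<phi>. tested a j \<phi> \<longleftrightarrow> lin m t c \<phi> \<le> a + Lam m t c"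
proof -
  have "(m, restrict t {1..m}, restrict c {1..m}) \<in> test_functionals T"
    using assms by (auto simp: test_functionals_def)
  then obtain j where j: "test_functional T j = (m, restrict t {1..m}, restrict c {1..m})"
    using test_functional_range by (metis rangeE)
  have "lin m (restrict t {1..m}) (restrict c {1..m}) = lin m t c"
    by (auto simp: lin_def fun_eq_iff)
  thus ?thesis by (intro exI[of _ j]) (simp add: tested_def j Lam_def mgf_def)
qed

text \<open>Times are rounded up because \<open>Lam_tendsto\<close> needs approximation from the
  right; for the continuous h the direction is immaterial.\<close>

lemma rate_le_of_dense:
  assumes h: "continuous_on {0..T} h" and 0: "h 0 = 0" and tested: "\<And>j. tested a j h"
  shows "rate T M A h \<le> ereal a"
  unfolding rate_le_iff[where \<phi> = h, OF 0]
proof (intro allI impI)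
  fix m :: nat and t c :: "nat \<Rightarrow> real"
  assume t: "\<forall>l\<in>{1..m}. t l \<in> {0..T}"
  define s where "s = (\<lambda>k l. round_up T k (t l :: real))"
  obtain e where e: "\<And>x k. e x (k::nat) \<in> \<rat>" "\<And>x. e x \<longlonglongrightarrow> (x::real)"
    using rational_approx by metis
  define d where "d = (\<lambda>k l. e (c l) k)"
  have s: "s k l \<in> fractions T" "t l \<le> s k l" "s k l \<le> T" "(\<lambda>k. s k l) \<longlonglongrightarrow> t l"
    if "l \<in> {1..m}" for k l
    using t[rule_format, OF that] T_pos unfolding s_def
    by (auto simp del: of_nat_Suc intro: ceil_to_in_fractions ceil_to_ge ceil_to_le_end ceil_to_tendsto)
  have dl: "(\<lambda>k. d k l) \<longlonglongrightarrow> c l" for l unfolding d_def by (rule e(2))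
  have le: "lin m (s k) (d k) h \<le> a + Lam m (s k) (d k)" for k
  proof -
    have "\<exists>j. \<forall>a \<phi>. tested a j \<phi> \<longleftrightarrow> lin m (s k) (d k) \<phi> \<le> a + Lam m (s k) (d k)"
      by (rule tested_index) (simp_all add: s(1) d_def e(1))
    thus ?thesis using tested by blast
  qed
  have "(\<lambda>k. h (s k l)) \<longlonglongrightarrow> h (t l)" if l: "l \<in> {1..m}" for l
    using continuous_on_tendsto_compose[OF h s(4)[OF l]] t l s(1)[OF l] fractions_subset[OF T_pos]
    by (auto simp: subset_iff)
  hence "(\<lambda>k. lin m (s k) (d k) h) \<longlonglongrightarrow> lin m t c h"
    unfolding lin_def using dl by (intro tendsto_sum tendsto_mult) auto
  moreover have "(\<lambda>k. a + Lam m (s k) (d k)) \<longlonglongrightarrow> a + Lam m t c"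
    using t s dl by (intro tendsto_add tendsto_const Lam_tendsto) auto
  ultimately show "lin m t c h \<le> a + Lam m t c"
    by (rule LIMSEQ_le) (use le in auto)
qed

text \<open>A diagonal subsequence converges pointwise on \<open>fractions T\<close>. Its limit g
  inherits every test, among them those on increments with integer coefficients, so it is uniformly
  continuous and extends to the closure. Continuity of the extension and monotonicity of the paths
  then upgrade the convergence to a uniform one.\<close>

lemma tested_sequence_compact:
  assumes \<phi>: "\<And>n. counting_like T (\<phi> n)" and tst: "\<And>n j. j \<le> n \<Longrightarrow> tested a j (\<phi> n)"
  obtains r \<psi> where "strict_mono (r :: nat \<Rightarrow> nat)" "\<psi> \<in> cadlag T" "rate T M A \<psi> \<le> ereal a"
    "\<And>e. 0 < e \<Longrightarrow> \<forall>\<^sub>F n in sequentially. \<forall>t\<in>{0..T}. \<bar>\<phi> (r n) t - \<psi> t\<bar> \<le> e"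
proof -
  let ?D = "fractions T"
  \<comment> \<open>The test of the value at T bounds the whole path, but it is in force only from
    index j0 on; hence the shift by j0 below.\<close>
  obtain j0 where j0: "\<And>a \<phi>. tested a j0 \<phi> \<longleftrightarrow> lin 1 (\<lambda>_. T) (\<lambda>_. 1) \<phi> \<le> a + Lam 1 (\<lambda>_. T) (\<lambda>_. 1)"
    using tested_index[of 1 "\<lambda>_. T" "\<lambda>_. 1"] end_in_fractions by auto
  define B where "B = a + Lam 1 (\<lambda>_. T) (\<lambda>_. 1)"
  have "norm (\<phi> (n + j0) x) \<le> B" if x: "x \<in> ?D" for n x
  proof -
    have "\<phi> (n + j0) T \<le> B" using tst[of j0 "n + j0"] by (simp add: j0 B_def lin_def)
    thus ?thesis using counting_like_bounds[OF T_pos \<phi>, of x "n + j0"] x fractions_subset[OF T_pos] by auto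
  qed
  then obtain k where k: "strict_mono (k :: nat \<Rightarrow> nat)"
    "\<And>x. x \<in> ?D \<Longrightarrow> \<exists>l. (\<lambda>n. \<phi> (k n + j0) x) \<longlonglongrightarrow> l"
    using function_convergent_subsequence[OF countable_fractions, of T "\<lambda>n. \<phi> (n + j0)" B] by blast
  define r where "r n = k n + j0" for n
  have r: "strict_mono r" using k(1) by (simp add: strict_mono_def r_def)
  obtain g where g: "\<And>x. x \<in> ?D \<Longrightarrow> (\<lambda>n. \<phi> (r n) x) \<longlonglongrightarrow> g x"
    using k(2) unfolding r_def by metis
  have tg: "tested a j g" for j
  proof -
    obtain m t c where j: "test_functional T j = (m, t, c)" by (cases "test_functional T j") auto
    have "(\<lambda>n. lin m t c (\<phi> (r n))) \<longlonglongrightarrow> lin m t c g"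
      unfolding lin_def using test_functional_times(2)[OF T_pos j] g by (intro tendsto_intros) auto
    moreover have "\<forall>\<^sub>F n in sequentially. lin m t c (\<phi> (r n)) \<le> a + Lam m t c"
      using eventually_ge_at_top[of j]
    proof eventually_elim
      case (elim n)
      \<comment> \<open>Subsequence indices satisfy r n \<ge> n, so test j is eventually in
        force.\<close>
      have "j \<le> r n" using elim seq_suble[OF r, of n] by simp
      from tst[OF this] show ?case by (simp add: tested_def j)
    qed
    ultimately have "lin m t c g \<le> a + Lam m t c" by (rule tendsto_upperbound) simp
    thus ?thesis by (simp add: tested_def j)
  qed
  have "uniformly_continuous_on ?D g"
  proof (rule increment_bounds_imp(2)[OF fractions_subset[OF T_pos]])
    fix s t \<alpha> :: real assume st: "s \<in> ?D" "t \<in> ?D" "\<alpha> \<in> \<int>"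
    have \<alpha>: "\<alpha> \<in> \<rat>" using st(3) Ints_subset_Rats by blast
    have "\<exists>j. \<forall>a \<phi>. tested a j \<phi> \<longleftrightarrow>
        lin 2 (two s t) (two (- \<alpha>) \<alpha>) \<phi> \<le> a + Lam 2 (two s t) (two (- \<alpha>) \<alpha>)"
      by (rule tested_index) (simp_all add: two_def st \<alpha>)
    thus "lin 2 (two s t) (two (- \<alpha>) \<alpha>) g \<le> a + Lam 2 (two s t) (two (- \<alpha>) \<alpha>)"
      using tg by blast
  qed
  then obtain h where h: "uniformly_continuous_on (closure ?D) h" "\<And>x. x \<in> ?D \<Longrightarrow> g x = h x"
    using uniformly_continuous_on_extension_on_closure by metis
  define \<psi> where "\<psi> = restrict h {0..T}"
  have \<psi>D: "\<psi> x = g x" if "x \<in> ?D" for x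
    using h(2)[OF that] that fractions_subset[OF T_pos] by (auto simp: \<psi>_def)
  have uc: "uniformly_continuous_on {0..T} \<psi>"
    using h(1) unfolding closure_fractions[OF T_pos] uniformly_continuous_on_def by (simp add: \<psi>_def)
  have "\<psi> \<in> cadlag T" unfolding \<psi>_def
    using h(1) closure_fractions[OF T_pos] by (intro continuous_in_cadlag uniformly_continuous_imp_continuous) simp
  moreover have "rate T M A \<psi> \<le> ereal a"
  proof (rule rate_le_of_dense)
    show "continuous_on {0..T} \<psi>" by (rule uniformly_continuous_imp_continuous[OF uc])
    have "(\<lambda>n. \<phi> (r n) 0) = (\<lambda>n. 0)" using \<phi> by (simp add: counting_like_def)
    thus "\<psi> 0 = 0" using g[OF zero_in_fractions] \<psi>D[OF zero_in_fractions] LIMSEQ_unique tendsto_const by metis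
    fix j
    obtain m t c where j: "test_functional T j = (m, t, c)" by (cases "test_functional T j") auto
    have "lin m t c \<psi> = lin m t c g" unfolding lin_def
      using test_functional_times(2)[OF T_pos j] \<psi>D by (intro sum.cong) auto
    thus "tested a j \<psi>" using tg[of j] by (simp add: tested_def j)
  qed
  moreover have "\<forall>\<^sub>F n in sequentially. \<forall>t\<in>{0..T}. \<bar>\<phi> (r n) t - \<psi> t\<bar> \<le> e" if "0 < e" for e
    using \<psi>D g that by (intro uniform_limit_counting_like T_pos uc \<phi>) auto
  ultimately show ?thesis using that r by blast
qed

lemma tested_of_rate:
  assumes "\<phi> 0 = 0" "rate T M A \<phi> \<le> ereal a" shows "tested a j \<phi>"
proof -
  obtain m t c where j: "test_functional T j = (m, t, c)" by (cases "test_functional T j") auto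
  show ?thesis
    using iffD1[OF rate_le_iff[of \<phi> a] assms(2)] assms(1) test_functional_times(1)[OF T_pos j]
    by (simp add: tested_def j)
qed

theorem good_rate: "good_rate_function (J1_topology T) (rate T M A)"
proof -
  interpret J: Metric_space "cadlag T" "J1_dist T" by (rule Metric_space_J1[OF T_pos])
  have "compactin (J1_topology T) {\<phi> \<in> cadlag T. rate T M A \<phi> \<le> ereal a}" for a
    unfolding J1_topology_def J.compactin_sequentially
  proof (intro conjI allI impI)
    fix \<sigma> :: "nat \<Rightarrow> real \<Rightarrow> real"
    assume "range \<sigma> \<subseteq> {\<phi> \<in> cadlag T. rate T M A \<phi> \<le> ereal a}"
    hence \<sigma>: "\<And>n. \<sigma> n \<in> cadlag T" "\<And>n. rate T M A (\<sigma> n) \<le> ereal a" by auto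
    obtain r \<psi> where r: "strict_mono (r :: nat \<Rightarrow> nat)" "\<psi> \<in> cadlag T" "rate T M A \<psi> \<le> ereal a"
      "\<And>e. 0 < e \<Longrightarrow> \<forall>\<^sub>F n in sequentially. \<forall>t\<in>{0..T}. \<bar>\<sigma> (r n) t - \<psi> t\<bar> \<le> e"
    proof (rule tested_sequence_compact[of \<sigma> a])
      show "counting_like T (\<sigma> n)" for n by (rule finite_rate_regular(1)[OF \<sigma>])
      show "tested a j (\<sigma> n)" for j n by (rule tested_of_rate[OF finite_rate_start[OF \<sigma>] \<sigma>(2)])
    qed (rule that)
    have "limitin (J1_topology T) (\<sigma> \<circ> r) \<psi> sequentially"
      using r \<sigma> by (intro uniform_limit_imp_J1_limit T_pos) auto
    thus "\<exists>l r. l \<in> {\<phi> \<in> cadlag T. rate T M A \<phi> \<le> ereal a} \<and> strict_mono r \<and>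
        limitin J.mtopology (\<sigma> \<circ> r) l sequentially"
      using r unfolding J1_topology_def by blast
  qed auto
  thus ?thesis unfolding good_rate_function_def topspace_J1_topology[OF T_pos] by blast
qed

text \<open>If no J worked, choosing for each J a path in C that passes the tests up to J would give
  a subsequence with a limit of rate at most a; closedness puts this limit into C.\<close>

lemma closed_set_finite_cover:
  assumes C: "closedin (J1_topology T) C" and a: "ereal a < (INF \<phi>\<in>C. rate T M A \<phi>)"
  shows "\<exists>J. \<forall>\<phi>\<in>C. counting_like T \<phi> \<longrightarrow> (\<exists>j\<le>J. \<not> tested a j \<phi>)"
proof (rule ccontr)
  assume "\<not> ?thesis"
  then obtain \<phi> where \<phi>: "\<And>J. \<phi> J \<in> C" "\<And>J. counting_like T (\<phi> J)" "\<And>J j. j \<le> J \<Longrightarrow> tested a j (\<phi> J)"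
    by metis
  have cad: "\<phi> J \<in> cadlag T" for J
    using \<phi>(1) closedin_subset[OF C] topspace_J1_topology[OF T_pos] by blast
  obtain r \<psi> where r: "strict_mono (r :: nat \<Rightarrow> nat)" "\<psi> \<in> cadlag T" "rate T M A \<psi> \<le> ereal a"
    "\<And>e. 0 < e \<Longrightarrow> \<forall>\<^sub>F n in sequentially. \<forall>t\<in>{0..T}. \<bar>\<phi> (r n) t - \<psi> t\<bar> \<le> e"
    by (rule tested_sequence_compact[OF \<phi>(2,3)], assumption, rule that)
  have "limitin (J1_topology T) (\<lambda>n. \<phi> (r n)) \<psi> sequentially"
    using r cad by (intro uniform_limit_imp_J1_limit T_pos) auto
  hence "\<psi> \<in> C" by (rule limitin_closedin[OF _ C]) (use \<phi>(1) in auto)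
  hence "(INF \<phi>\<in>C. rate T M A \<phi>) \<le> ereal a" using r(3) by (meson INF_lower order_trans)
  thus False using a by simp
qed

end

section \<open>Differentiability of the cumulant function\<close>

lemma elog_mono: "x \<le> y \<Longrightarrow> elog x \<le> elog y"
proof -
  assume xy: "x \<le> y"
  show ?thesis
  proof (cases "x = 0 \<or> y = \<infinity>")
    case True thus ?thesis by (auto simp: elog_def)
  next
    case False
    hence "x \<noteq> \<infinity>" "y \<noteq> 0" using xy by (auto simp: top_unique)
    moreover have "0 < enn2real x" using False \<open>x \<noteq> \<infinity>\<close> by (simp add: enn2real_positive_iff less_top zero_less_iff_neq_zero)
    moreover have "enn2real x \<le> enn2real y" using xy False by (intro enn2real_mono) (auto simp: less_top)
    ultimately show ?thesis using False by (simp add: elog_def)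
  qed
qed

lemma elog_ennreal: "0 < r \<Longrightarrow> elog (ennreal r) = ereal (ln r)"
  by (simp add: elog_def)

text \<open>From 1 - x \<le> exp (-x) one gets exp x - 1 \<le> x exp x = x + x (exp x - 1), and the
  last product is at most \<open>x\<^sup>2 * exp \<bar>x\<bar>\<close> for either sign of x.\<close>

lemma exp_le_quadratic:
  fixes x :: real shows "exp x \<le> 1 + x + x\<^sup>2 * exp \<bar>x\<bar>"
proof -
  have "1 - x \<le> exp (- x)" using exp_ge_add_one_self[of "- x"] by simp
  hence "exp x * (1 - x) \<le> exp x * exp (- x)" by (intro mult_left_mono) auto
  hence 1: "exp x - 1 \<le> x * exp x" by (simp add: exp_minus algebra_simps)
  have "x * (exp x - 1) \<le> x\<^sup>2 * exp \<bar>x\<bar>"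
  proof (cases "0 \<le> x")
    case True
    have "x * (exp x - 1) \<le> x * (x * exp x)" using 1 True by (intro mult_left_mono)
    thus ?thesis using True by (simp add: power2_eq_square)
  next
    case False
    have "x * (exp x - 1) \<le> x * x"
    proof (rule mult_left_mono_neg)
      show "x \<le> exp x - 1" using exp_ge_add_one_self[of x] by linarith
    qed (use False in simp)
    also have "\<dots> \<le> x\<^sup>2 * exp \<bar>x\<bar>" by (simp add: power2_eq_square mult_le_cancel_left1)
    finally show ?thesis .
  qed
  thus ?thesis using 1 by (simp add: algebra_simps)
qed

text \<open>Fermat's rule from a one-sided quadratic bound: a small step s against the sign of d
  loses s |d| in the linear term and gains only B s^2 in the quadratic one.\<close>

lemma linear_term_vanishes:
  fixes d B :: real
  assumes B: "0 \<le> B" and le: "\<And>h. \<bar>h\<bar> \<le> 1 \<Longrightarrow> 0 \<le> h * d + B * h\<^sup>2"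
  shows "d = 0"
proof (rule ccontr)
  assume d: "d \<noteq> 0"
  define s where "s = min 1 (\<bar>d\<bar> / (2 * (B + 1)))"
  have s: "0 < s" "s \<le> 1" using d B by (auto simp: s_def)
  have "s \<le> \<bar>d\<bar> / (2 * (B + 1))" by (simp add: s_def)
  hence s3: "s * (2 * (B + 1)) \<le> \<bar>d\<bar>" using B by (subst (asm) pos_le_divide_eq) auto
  have "B * s \<le> s * (2 * (B + 1)) / 2" using s by (simp add: algebra_simps)
  hence "B * s < \<bar>d\<bar>" using s s3 d by linarith
  hence "s * (B * s) < s * \<bar>d\<bar>" using s by simp
  moreover have "0 \<le> - sgn d * s * d + B * (- sgn d * s)\<^sup>2"
    using s by (intro le) (simp add: abs_mult abs_sgn_eq)
  hence "s * \<bar>d\<bar> \<le> B * s\<^sup>2" using d by (simp add: power_mult_distrib sgn_if split: if_splits)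
  ultimately show False by (simp add: power2_eq_square mult_ac)
qed

abbreviation shift :: "(nat \<Rightarrow> real) \<Rightarrow> nat \<Rightarrow> real \<Rightarrow> nat \<Rightarrow> real" where
  "shift \<alpha> l h \<equiv> \<alpha>(l := \<alpha> l + h)"

lemma lin_update:
  "l \<in> {1..m} \<Longrightarrow> lin m t (shift \<alpha> l h) \<phi> = lin m t \<alpha> \<phi> + h * \<phi> (t l)"
proof -
  assume l: "l \<in> {1..m}"
  have "lin m t (shift \<alpha> l h) \<phi> = (\<Sum>j=1..m. \<alpha> j * \<phi> (t j) + (if j = l then h * \<phi> (t l) else 0))"
    unfolding lin_def by (intro sum.cong) (auto simp: algebra_simps)
  also have "\<dots> = lin m t \<alpha> \<phi> + h * \<phi> (t l)" using l by (simp add: sum.distrib lin_def)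
  finally show ?thesis .
qed

context increasing_process
begin

text \<open>An upper parabola stands in for differentiability. It comes from
  \<open>exp_le_quadratic\<close> at h A(t_l) under the weight W; the inequality 1 + x \<le> exp x
  then removes the logarithm.\<close>

lemma Lam_quadratic:
  assumes t: "\<And>l. l \<in> {1..m} \<Longrightarrow> t l \<in> {0..T}" and l: "l \<in> {1..m}"
  shows "\<exists>D C. 0 \<le> C \<and> (\<forall>h. \<bar>h\<bar> \<le> 1 \<longrightarrow> Lam m t (shift \<alpha> l h) \<le> Lam m t \<alpha> + h * D + C * h\<^sup>2)"
proof -
  define W Y where "W = (\<lambda>w. exp (lin m t \<alpha> (A w)))" and "Y = (\<lambda>w. A w (t l))"
  define a where "a = (\<Sum>l=1..m. \<bar>\<alpha> l\<bar>)"
  have [measurable]: "W \<in> borel_measurable M" "Y \<in> borel_measurable M"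
    unfolding W_def Y_def using measurable_lin[of m t \<alpha>] t A_meas l by auto
  have Y: "0 \<le> Y w" "Y w \<le> A w T" if "w \<in> space M" for w
    using A_nonneg[OF that] A_le_end[OF that] t l by (auto simp: Y_def)
  have W: "0 < W w" "W w \<le> exp (a * A w T)" if "w \<in> space M" for w
    using exp_lin_le[OF that, of m t \<alpha>] t by (auto simp: W_def a_def)
  have iW: "integrable M W" unfolding W_def using t by (intro integrable_exp_lin) auto
  have Ye: "Y w \<le> exp (A w T)" if "w \<in> space M" for w
    using Y[OF that] exp_ge_add_one_self[of "A w T"] by linarith
  have iWY: "integrable M (\<lambda>w. W w * Y w)"
  proof (rule integrable_dominated[of _ 1 "a + 1"])
    fix w assume w: "w \<in> space M"
    have "W w * Y w \<le> exp (a * A w T) * exp (A w T)"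
      using W[OF w] Y[OF w] Ye[OF w] by (intro mult_mono) auto
    thus "\<bar>W w * Y w\<bar> \<le> 1 * exp ((a + 1) * A w T)"
      using W[OF w] Y[OF w] by (simp add: exp_add[symmetric] algebra_simps abs_mult)
  qed measurable
  let ?V = "\<lambda>w. W w * ((Y w)\<^sup>2 * exp (Y w))"
  have iWYY: "integrable M (\<lambda>w. ?V w)"
  \<comment> \<open>The square contributes two factors exp (A T), the factor exp Y a third one, and
    W contributes the a.\<close>
  proof (rule integrable_dominated[of _ 1 "a + 3"])
    fix w assume w: "w \<in> space M"
    have "?V w \<le> exp (a * A w T) * ((exp (A w T))\<^sup>2 * exp (A w T))"
      using W[OF w] Y[OF w] Ye[OF w] by (intro mult_mono power_mono) auto
    thus "\<bar>?V w\<bar> \<le> 1 * exp ((a + 3) * A w T)"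
      using W[OF w] by (simp add: exp_add[symmetric] exp_double[symmetric] algebra_simps abs_mult)
  qed measurable
  have mg: "mgf m t \<alpha> = expectation W" "0 < mgf m t \<alpha>"
    using mgf_pos[of m t \<alpha>] t by (auto simp: mgf_def W_def)
  \<comment> \<open>D is the mean of A(t_l) under the law tilted by W, and C is a tilted second
    moment with the extra weight exp Y.\<close>
  define D C where "D = expectation (\<lambda>w. W w * Y w) / mgf m t \<alpha>"
    and "C = expectation (\<lambda>w. ?V w) / mgf m t \<alpha>"
  have "0 \<le> expectation (\<lambda>w. ?V w)"
    using W by (intro integral_nonneg_AE AE_I2 mult_nonneg_nonneg) (auto intro: less_imp_le)
  hence C: "0 \<le> C" using mg by (simp add: C_def)
  have "Lam m t (shift \<alpha> l h) \<le> Lam m t \<alpha> + h * D + C * h\<^sup>2" if h: "\<bar>h\<bar> \<le> 1" for h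
  proof -
    have "mgf m t (shift \<alpha> l h) \<le>
        expectation (\<lambda>w. W w + h * (W w * Y w) + h\<^sup>2 * (?V w))"
      unfolding mgf_def
    proof (rule integral_mono)
      show "integrable M (\<lambda>w. exp (lin m t (shift \<alpha> l h) (A w)))"
        using t by (intro integrable_exp_lin) auto
      fix w assume w: "w \<in> space M"
      have "\<bar>h * Y w\<bar> \<le> 1 * Y w" unfolding abs_mult using Y(1)[OF w] h by (intro mult_mono) auto
      hence "(h * Y w)\<^sup>2 * exp \<bar>h * Y w\<bar> \<le> (h * Y w)\<^sup>2 * exp (Y w)"
        by (intro mult_left_mono) auto
      hence "exp (h * Y w) \<le> 1 + h * Y w + (h * Y w)\<^sup>2 * exp (Y w)"
        using exp_le_quadratic[of "h * Y w"] by linarith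
      hence "W w * exp (h * Y w) \<le> W w * (1 + h * Y w + (h * Y w)\<^sup>2 * exp (Y w))"
        using W[OF w] by (intro mult_left_mono) auto
      thus "exp (lin m t (shift \<alpha> l h) (A w)) \<le>
          W w + h * (W w * Y w) + h\<^sup>2 * (?V w)"
        unfolding lin_update[OF l] exp_add by (simp add: W_def Y_def power_mult_distrib algebra_simps)
    qed (use iW iWY iWYY in simp)
    also have "\<dots> = expectation W + h * expectation (\<lambda>w. W w * Y w)
        + h\<^sup>2 * expectation (\<lambda>w. ?V w)"
      using iW iWY iWYY by simp
    also have "\<dots> = mgf m t \<alpha> * (1 + (h * D + C * h\<^sup>2))"
      using mg by (simp add: D_def C_def algebra_simps)
    also have "\<dots> \<le> mgf m t \<alpha> * exp (h * D + C * h\<^sup>2)"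
      using mg by (intro mult_left_mono exp_ge_add_one_self) auto
    finally have "ln (mgf m t (shift \<alpha> l h)) \<le> ln (mgf m t \<alpha> * exp (h * D + C * h\<^sup>2))"
      using mgf_pos[of m t "shift \<alpha> l h"] t mg by (subst ln_le_cancel_iff) auto
    thus ?thesis using mg by (simp add: Lam_def ln_mult)
  qed
  thus ?thesis using C by blast
qed

lemma continuous_on_Lam:
  assumes t: "\<And>l. l \<in> {1..m} \<Longrightarrow> t l \<in> {0..T}"
  shows "continuous_on S (\<lambda>\<alpha>. Lam m t \<alpha>)"
proof (rule continuous_on_sequentiallyI)
  fix u :: "nat \<Rightarrow> nat \<Rightarrow> real" and a assume u: "u \<longlonglongrightarrow> a"
  have "(\<lambda>k. u k l) \<longlonglongrightarrow> a l" for l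
    using continuous_on_tendsto_compose[OF continuous_on_product_coordinates[of l] u] by simp
  thus "(\<lambda>k. Lam m t (u k)) \<longlonglongrightarrow> Lam m t a" using t by (intro Lam_tendsto) auto
qed

text \<open>Penalising the Legendre transform by \<open>\<delta>/2 |\<alpha>|\<^sup>2\<close> makes the supremum attained; at the maximiser the
  gradient of \<open>Lam\<close> is \<open>x - \<delta> \<alpha>\<close>, a point close to \<open>x\<close>.\<close>

lemma penalised_maximiser:
  assumes t: "\<And>l. l \<in> {1..m} \<Longrightarrow> t l \<in> {0..T}"
    and I: "\<And>\<alpha>. (\<Sum>l=1..m. \<alpha> l * x l) \<le> I + Lam m t \<alpha>" and \<delta>: "0 < \<delta>"
  obtains \<alpha> C where "\<And>l. l \<in> {1..m} \<Longrightarrow> \<delta> / 2 * (\<alpha> l)\<^sup>2 \<le> I" "0 \<le> C"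
    "\<And>l h. l \<in> {1..m} \<Longrightarrow> \<bar>h\<bar> \<le> 1 \<Longrightarrow>
        Lam m t (shift \<alpha> l h) \<le> Lam m t \<alpha> + h * (x l - \<delta> * \<alpha> l) + C * h\<^sup>2"
proof -
  define g where "g = (\<lambda>\<alpha>. (\<Sum>l=1..m. \<alpha> l * x l) - Lam m t \<alpha> - \<delta> / 2 * (\<Sum>l=1..m. (\<alpha> l)\<^sup>2))"
  \<comment> \<open>R solves \<delta>/2 R^2 = I + 1, so g is negative once a coordinate exceeds R in
    size, while g vanishes at 0. A maximum over the box is thus a maximum over all shifts.\<close>
  define R where "R = sqrt (2 * (I + 1) / \<delta>)"
  have I0: "0 \<le> I" using I[of "\<lambda>_. 0"] by (simp add: Lam_zero_coeff)
  have R: "0 \<le> R" "R\<^sup>2 = 2 * (I + 1) / \<delta>" using I0 \<delta> by (auto simp: R_def)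
  \<comment> \<open>Coordinates outside \<open>{1..m}\<close> are frozen at 0; the box is then
    compact by Tychonoff.\<close>
  define S :: "(nat \<Rightarrow> real) set" where "S = PiE UNIV (\<lambda>l. if l \<in> {1..m} then {-R..R} else {0})"
  have g0: "g (\<lambda>_. 0) = 0" by (simp add: g_def Lam_zero_coeff)
  have gle: "g \<alpha> \<le> I - \<delta> / 2 * (\<alpha> l)\<^sup>2" if "l \<in> {1..m}" for \<alpha> l
  proof -
    have "(\<alpha> l)\<^sup>2 \<le> (\<Sum>l=1..m. (\<alpha> l)\<^sup>2)" using that by (intro member_le_sum) auto
    hence "\<delta> / 2 * (\<alpha> l)\<^sup>2 \<le> \<delta> / 2 * (\<Sum>l=1..m. (\<alpha> l)\<^sup>2)" using \<delta> by (intro mult_left_mono) auto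
    thus ?thesis using I[of \<alpha>] by (simp add: g_def)
  qed
  have "compactin (product_topology (\<lambda>_. euclidean) UNIV) S"
    unfolding S_def compactin_PiE by (auto simp: compactin_euclidean_iff)
  hence "compact S" by (simp add: euclidean_product_topology compactin_euclidean_iff)
  moreover have "(\<lambda>_. 0) \<in> S" using R by (auto simp: S_def)
  moreover have "continuous_on S g"
    unfolding g_def by (intro continuous_intros continuous_on_Lam t continuous_on_subset[OF continuous_on_product_coordinates]) auto
  ultimately obtain \<alpha> where \<alpha>: "\<alpha> \<in> S" "\<And>\<beta>. \<beta> \<in> S \<Longrightarrow> g \<beta> \<le> g \<alpha>"
    using continuous_attains_sup[of S g] by blast
  have g_nonneg: "0 \<le> g \<alpha>" using \<alpha>(2)[OF \<open>(\<lambda>_. 0) \<in> S\<close>] g0 by simp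
  have max: "g (shift \<alpha> l h) \<le> g \<alpha>" if l: "l \<in> {1..m}" for l h
  proof (cases "\<bar>\<alpha> l + h\<bar> \<le> R")
    case True
    have "\<alpha> i \<in> (if i \<in> {1..m} then {-R..R} else {0})" for i
      using \<alpha>(1) by (simp add: S_def PiE_iff)
    hence "(shift \<alpha> l h) i \<in> (if i \<in> {1..m} then {-R..R} else {0})" for i
      using True l by (cases "i = l") (auto simp: abs_le_iff)
    hence "shift \<alpha> l h \<in> S" by (simp add: S_def PiE_iff)
    thus ?thesis by (rule \<alpha>(2))
  next
    case False
    hence "R\<^sup>2 \<le> (\<alpha> l + h)\<^sup>2" using R by (metis abs_le_square_iff abs_of_nonneg linorder_le_cases)
    hence "\<delta> / 2 * R\<^sup>2 \<le> \<delta> / 2 * (\<alpha> l + h)\<^sup>2" using \<delta> by (intro mult_left_mono) auto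
    moreover have "\<delta> / 2 * R\<^sup>2 = I + 1" using \<delta> by (simp add: R)
    ultimately have "g (shift \<alpha> l h) \<le> 0" using gle[OF l, of "shift \<alpha> l h"] by simp
    thus ?thesis using g_nonneg by simp
  qed
  have "\<exists>C\<ge>0. \<forall>h. \<bar>h\<bar> \<le> 1 \<longrightarrow> Lam m t (shift \<alpha> l h) \<le> Lam m t \<alpha> + h * (x l - \<delta> * \<alpha> l) + C * h\<^sup>2"
    if l: "l \<in> {1..m}" for l
  proof -
    have "\<exists>D C. 0 \<le> C \<and> (\<forall>h. \<bar>h\<bar> \<le> 1 \<longrightarrow> Lam m t (shift \<alpha> l h) \<le> Lam m t \<alpha> + h * D + C * h\<^sup>2)"
      by (rule Lam_quadratic[OF _ l]) (rule t)
    then obtain D C where DC: "0 \<le> C"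
      "\<And>h. \<bar>h\<bar> \<le> 1 \<Longrightarrow> Lam m t (shift \<alpha> l h) \<le> Lam m t \<alpha> + h * D + C * h\<^sup>2" by blast
    \<comment> \<open>Maximality of g bounds the increment of \<open>Lam\<close> from below and the
      parabola bounds it from above, so the two slopes agree.\<close>
    have "D - (x l - \<delta> * \<alpha> l) = 0"
    proof (rule linear_term_vanishes[of "C + \<delta> / 2"])
      fix h :: real assume h: "\<bar>h\<bar> \<le> 1"
      \<comment> \<open>The plain sum of \<alpha> j times x j is disguised as a functional at the
        times 1, ..., m so that \<open>lin_update\<close> applies to it.\<close>
      have "lin m (\<lambda>i. real i) (shift \<alpha> l h) (\<lambda>s. x (nat \<lfloor>s\<rfloor>)) =
          lin m (\<lambda>i. real i) \<alpha> (\<lambda>s. x (nat \<lfloor>s\<rfloor>)) + h * x l" using lin_update[OF l] by simp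
      hence 1: "(\<Sum>j=1..m. (shift \<alpha> l h) j * x j) = (\<Sum>j=1..m. \<alpha> j * x j) + h * x l"
        by (simp add: lin_def)
      have "(\<Sum>j=1..m. ((shift \<alpha> l h) j)\<^sup>2) =
          (\<Sum>j=1..m. (\<alpha> j)\<^sup>2 + (if j = l then 2 * \<alpha> l * h + h\<^sup>2 else 0))"
        by (intro sum.cong) (auto simp: power2_eq_square algebra_simps)
      also have "\<dots> = (\<Sum>j=1..m. (\<alpha> j)\<^sup>2) + (2 * \<alpha> l * h + h\<^sup>2)" using l by (simp add: sum.distrib)
      finally have 2: "(\<Sum>j=1..m. ((shift \<alpha> l h) j)\<^sup>2) = (\<Sum>j=1..m. (\<alpha> j)\<^sup>2) + (2 * \<alpha> l * h + h\<^sup>2)" .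
      from max[OF l, of h] DC(2)[OF h] show "0 \<le> h * (D - (x l - \<delta> * \<alpha> l)) + (C + \<delta> / 2) * h\<^sup>2"
        unfolding g_def 1 2 by (simp add: algebra_simps)
    qed (use DC \<delta> in auto)
    thus ?thesis using DC by (intro exI[of _ C]) auto
  qed
  then obtain C where C: "\<And>l. l \<in> {1..m} \<Longrightarrow> 0 \<le> C l"
    "\<And>l h. l \<in> {1..m} \<Longrightarrow> \<bar>h\<bar> \<le> 1 \<Longrightarrow>
      Lam m t (shift \<alpha> l h) \<le> Lam m t \<alpha> + h * (x l - \<delta> * \<alpha> l) + C l * h\<^sup>2" by metis
  show ?thesis
  proof (rule that[of \<alpha> "\<Sum>l=1..m. C l"])
    show "\<delta> / 2 * (\<alpha> l)\<^sup>2 \<le> I" if "l \<in> {1..m}" for l using gle[OF that, of \<alpha>] g_nonneg by simp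
    show "0 \<le> (\<Sum>l=1..m. C l)" using C(1) by (intro sum_nonneg) auto
    fix l and h :: real assume l: "l \<in> {1..m}" and h: "\<bar>h\<bar> \<le> 1"
    have "C l \<le> (\<Sum>l=1..m. C l)" using l C(1) by (intro member_le_sum) auto
    hence "C l * h\<^sup>2 \<le> (\<Sum>l=1..m. C l) * h\<^sup>2" by (intro mult_right_mono) auto
    thus "Lam m t (shift \<alpha> l h) \<le> Lam m t \<alpha> + h * (x l - \<delta> * \<alpha> l) + (\<Sum>l=1..m. C l) * h\<^sup>2"
      using C(2)[OF l h] by linarith
  qed
qed

end

section \<open>Independent copies and the upper bound\<close>

locale iid_increasing = increasing_process M A T K + N: prob_space N
  for M :: "'a measure" and A :: "'a \<Rightarrow> real \<Rightarrow> real" and T K :: real and N :: "'b measure" +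
  fixes X :: "nat \<Rightarrow> 'b \<Rightarrow> real \<Rightarrow> real"
  assumes A_ext: "\<And>w. w \<in> space M \<Longrightarrow> A w \<in> extensional {0..T}"
    and iid: "iid_copies T N X M A"
begin

abbreviation path_space :: "(real \<Rightarrow> real) measure" where
  "path_space \<equiv> PiM {0..T} (\<lambda>_. borel)"

abbreviation mean :: "nat \<Rightarrow> 'b \<Rightarrow> real \<Rightarrow> real" where
  "mean \<equiv> sample_mean T X"

section \<open>Transfer of laws and path properties to the copies\<close>

lemma X_cadlag: "i \<ge> 1 \<Longrightarrow> w \<in> space N \<Longrightarrow> X i w \<in> cadlag T"
  and X_indep: "N.indep_vars (\<lambda>_. path_space) X {1..}"
  and X_distr: "i \<ge> 1 \<Longrightarrow> distr N path_space (X i) = distr M path_space A"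
  using iid by (auto simp: iid_copies_def)

lemma X_meas: "i \<ge> 1 \<Longrightarrow> X i \<in> measurable N path_space"
  using X_indep by (simp add: N.indep_vars_def)

lemma A_path_meas: "A \<in> measurable M path_space"
  using A_ext A_meas by (intro measurable_PiM_single') (auto simp: PiE_iff)

lemma X_meas_at: "i \<ge> 1 \<Longrightarrow> t \<in> {0..T} \<Longrightarrow> (\<lambda>w. X i w t) \<in> borel_measurable N"
  using measurable_compose[OF X_meas measurable_component_singleton] by blast

lemma nn_integral_X:
  assumes "g \<in> borel_measurable path_space" "i \<ge> 1"
  shows "(\<integral>\<^sup>+w. g (X i w) \<partial>N) = (\<integral>\<^sup>+w. g (A w) \<partial>M)"
proof -
  have "(\<integral>\<^sup>+w. g (X i w) \<partial>N) = (\<integral>\<^sup>+\<phi>. g \<phi> \<partial>distr N path_space (X i))"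
    using assms X_meas by (subst nn_integral_distr) auto
  also have "\<dots> = (\<integral>\<^sup>+w. g (A w) \<partial>M)"
    unfolding X_distr[OF assms(2)] using assms A_path_meas by (subst nn_integral_distr) auto
  finally show ?thesis .
qed

lemma measurable_lin_path:
  "(\<And>l. l \<in> {1..m} \<Longrightarrow> t l \<in> {0..T}) \<Longrightarrow> lin m t c \<in> borel_measurable path_space"
  unfolding lin_def[abs_def]
  by (intro borel_measurable_sum borel_measurable_times borel_measurable_const measurable_component_singleton) auto

text \<open>An event of the product sigma-algebra has the same probability for A and for a copy.
  What holds surely for A therefore holds almost surely for the copies.\<close>

lemma AE_transfer:
  assumes i: "i \<ge> 1" and P: "{\<phi> \<in> space path_space. P \<phi>} \<in> sets path_space"
    and A: "\<And>w. w \<in> space M \<Longrightarrow> P (A w)"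
  shows "AE w in N. P (X i w)"
proof -
  define G where "G = {\<phi> \<in> space path_space. P \<phi>}"
  have G: "G \<in> sets path_space" using P by (simp add: G_def)
  have "A w \<in> G" if w: "w \<in> space M" for w
    using measurable_space[OF A_path_meas w] A[OF w] unfolding G_def by blast
  hence "AE w in M. A w \<in> G" by auto
  hence "AE \<phi> in distr M path_space A. \<phi> \<in> G"
    using A_path_meas G by (subst AE_distr_iff) (auto simp: pred_def)
  hence "AE \<phi> in distr N path_space (X i). \<phi> \<in> G" by (subst X_distr[OF i])
  hence "AE w in N. X i w \<in> G"
    using X_meas[OF i] G by (subst (asm) AE_distr_iff) (auto simp: pred_def)
  thus ?thesis by (rule AE_mp) (auto simp: G_def)
qed

text \<open>Monotonicity on all of \<open>{0..T}\<close> involves uncountably many coordinates, so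
  it is transferred on \<open>fractions T\<close> only and extended by the right continuity of the
  copies.\<close>

lemma AE_X_counting_like:
  assumes i: "i \<ge> 1" shows "AE w in N. counting_like T (X i w)"
proof -
  have comp: "(\<lambda>\<phi>. \<phi> s) \<in> borel_measurable path_space" if "s \<in> {0..T}" for s
    using that by (intro measurable_component_singleton)
  have "AE w in N. X i w 0 = 0"
    using A_zero by (intro AE_transfer i borel_measurable_eq comp borel_measurable_const T_mem)
  moreover have "AE w in N. \<forall>s\<in>fractions T. \<forall>t\<in>fractions T. s \<le> t \<longrightarrow> X i w s \<le> X i w t"
  proof (intro AE_ball_countable[THEN iffD2] countable_fractions ballI)
    fix s t assume "s \<in> fractions T" "t \<in> fractions T"
    hence st: "s \<in> {0..T}" "t \<in> {0..T}" using fractions_subset[OF T_pos] by auto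
    show "AE w in N. s \<le> t \<longrightarrow> X i w s \<le> X i w t"
    proof (cases "s \<le> t")
      case True
      have "AE w in N. X i w s \<le> X i w t"
        using A_mono st True by (intro AE_transfer i borel_measurable_le comp) auto
      thus ?thesis by (rule AE_mp) auto
    qed simp
  qed
  ultimately have "AE w in N. X i w 0 = 0 \<and>
      (\<forall>s\<in>fractions T. \<forall>t\<in>fractions T. s \<le> t \<longrightarrow> X i w s \<le> X i w t)" by (rule AE_conjI)
  thus ?thesis
  proof (rule AE_mp, intro AE_I2 impI)
    fix w assume w: "w \<in> space N" and G': "X i w 0 = 0 \<and>
      (\<forall>s\<in>fractions T. \<forall>t\<in>fractions T. s \<le> t \<longrightarrow> X i w s \<le> X i w t)"
    have cad: "X i w \<in> cadlag T" by (rule X_cadlag[OF i w])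
    have "X i w s \<le> X i w t" if st: "s \<in> {0..T}" "t \<in> {0..T}" "s \<le> t" for s t
    proof -
      have lim: "(\<lambda>k. X i w (round_up T k u)) \<longlonglongrightarrow> X i w u" if u: "u \<in> {0..T}" for u
      proof (rule tendsto_from_right[of T "X i w"])
        show "(X i w \<longlongrightarrow> X i w v) (at_right v)" if "v \<in> {0..<T}" for v
          using cad that by (simp add: cadlag_def)
        show "(\<lambda>k. round_up T k u) \<longlonglongrightarrow> u" by (rule ceil_to_tendsto[OF T_pos])
        show "u \<le> round_up T k u" for k by (rule ceil_to_ge) (use T_pos in simp)
        show "round_up T k u \<le> T" for k by (rule ceil_to_le_end) (use T_pos u in auto)
      qed (use u in auto)
      show ?thesis
      proof (rule LIMSEQ_le[OF lim[OF st(1)] lim[OF st(2)]], intro exI[of _ 0] allI impI)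
        fix k :: nat
        have "round_up T k s \<le> round_up T k t"
          using T_pos st by (intro ceil_to_mono) auto
        moreover have "round_up T k s \<in> fractions T" "round_up T k t \<in> fractions T"
          using T_pos st by (auto simp del: of_nat_Suc intro!: ceil_to_in_fractions)
        ultimately show "X i w (round_up T k s) \<le> X i w (round_up T k t)"
          using G' by blast
      qed
    qed
    thus "counting_like T (X i w)" using G' by (auto simp: counting_like_def intro!: mono_onI)
  qed
qed

lemma mean_at: "t \<in> {0..T} \<Longrightarrow> mean n w t = (1 / real n) * (\<Sum>i=1..n. X i w t)"
  by (simp add: sample_mean_def)

lemma mean_cadlag: "w \<in> space N \<Longrightarrow> mean n w \<in> cadlag T"
proof -
  assume w: "w \<in> space N"
  have X: "X i w \<in> cadlag T" if "i \<in> {1..n}" for i using X_cadlag w that by simp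
  define S where "S = (\<lambda>t. (1 / real n) * (\<Sum>i=1..n. X i w t))"
  have eq: "mean n w t = S t" if "t \<in> {0..T}" for t using that by (simp add: S_def mean_at)
  have "(mean n w \<longlongrightarrow> mean n w t) (at_right t)" if t: "t \<in> {0..<T}" for t
  proof -
    have "(S \<longlongrightarrow> S t) (at_right t)"
      unfolding S_def using X t by (intro tendsto_intros) (auto simp: cadlag_def)
    moreover have "\<forall>\<^sub>F s in at_right t. mean n w s = S s"
      unfolding eventually_at_right_field using t eq by (intro exI[of _ T]) auto
    ultimately show ?thesis using eq[of t] t tendsto_cong[of "mean n w" S "at_right t"] by simp
  qed
  moreover have "\<exists>l. (mean n w \<longlongrightarrow> l) (at_left t)" if t: "t \<in> {0<..T}" for t
  proof -
    have "\<forall>i\<in>{1..n}. \<exists>l. (X i w \<longlongrightarrow> l) (at_left t)" using X t by (auto simp: cadlag_def)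
    then obtain l where l: "\<And>i. i \<in> {1..n} \<Longrightarrow> (X i w \<longlongrightarrow> l i) (at_left t)" by metis
    have "(S \<longlongrightarrow> (1 / real n) * (\<Sum>i=1..n. l i)) (at_left t)"
      unfolding S_def using l by (intro tendsto_intros) auto
    moreover have "\<forall>\<^sub>F s in at_left t. mean n w s = S s"
      unfolding eventually_at_left_field using t eq by (intro exI[of _ 0]) auto
    ultimately show ?thesis using tendsto_cong[of "mean n w" S "at_left t"] by blast
  qed
  ultimately show ?thesis unfolding cadlag_def by (auto simp: sample_mean_def)
qed

lemma mean_meas_at: "t \<in> {0..T} \<Longrightarrow> (\<lambda>w. mean n w t) \<in> borel_measurable N"
  by (subst mean_at, assumption) (intro borel_measurable_times borel_measurable_const borel_measurable_sum X_meas_at, auto)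

lemma mean_measurable: "mean n \<in> measurable N (borel_of_topology (J1_topology T))"
  using mean_cadlag mean_meas_at by (intro borel_of_J1_measurableI T_pos)

lemma AE_mean_counting_like: "AE w in N. counting_like T (mean n w)"
proof -
  have "AE w in N. \<forall>i\<in>{1..n}. counting_like T (X i w)"
    using AE_X_counting_like by (intro AE_ball_countable[THEN iffD2]) auto
  thus ?thesis
  proof (rule AE_mp, intro AE_I2 impI)
    fix w assume X: "\<forall>i\<in>{1..n}. counting_like T (X i w)"
    have "mean n w s \<le> mean n w t" if st: "s \<in> {0..T}" "t \<in> {0..T}" "s \<le> t" for s t
      unfolding mean_at[OF st(1)] mean_at[OF st(2)]
      using X st by (intro mult_left_mono sum_mono) (auto simp: counting_like_def mono_on_def)
    moreover have "mean n w 0 = 0" using X T_mem mean_at by (simp add: counting_like_def)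
    ultimately show "counting_like T (mean n w)" by (auto simp: counting_like_def intro!: mono_onI)
  qed
qed

lemma lin_mean:
  assumes t: "\<And>l. l \<in> {1..m} \<Longrightarrow> t l \<in> {0..T}" and n: "n \<ge> 1"
  shows "real n * lin m t c (mean n w) = (\<Sum>i=1..n. lin m t c (X i w))"
proof -
  have "real n * lin m t c (mean n w) = (\<Sum>l=1..m. c l * (\<Sum>i=1..n. X i w (t l)))"
    unfolding lin_def sum_distrib_left[of "real n"]
  proof (intro sum.cong refl)
    fix l assume "l \<in> {1..m}"
    from mean_at[OF t[OF this], of n w] n
    show "real n * (c l * mean n w (t l)) = c l * (\<Sum>i=1..n. X i w (t l))" by simp
  qed
  also have "\<dots> = (\<Sum>l=1..m. \<Sum>i=1..n. c l * X i w (t l))" by (simp add: sum_distrib_left)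
  also have "\<dots> = (\<Sum>i=1..n. lin m t c (X i w))" unfolding lin_def by (rule sum.swap)
  finally show ?thesis .
qed

text \<open>n times a functional of the mean is a sum over the copies, so independence and equality
  of laws give the n-th power of \<open>mgf\<close>. The free constant b carries the threshold of an
  exponential Markov bound.\<close>

lemma mean_mgf:
  assumes t: "\<And>l. l \<in> {1..m} \<Longrightarrow> t l \<in> {0..T}" and n: "n \<ge> 1"
  shows "(\<integral>\<^sup>+w. ennreal (exp (real n * lin m t c (mean n w) + b)) \<partial>N) = ennreal (exp (real n * Lam m t c + b))"
proof -
  define g where "g = (\<lambda>\<phi>. ennreal (exp (lin m t c \<phi>)))"
  have [measurable]: "g \<in> borel_measurable path_space"
    unfolding g_def using measurable_lin_path[of m t c] t by measurable
  have "N.indep_vars (\<lambda>_. borel) (\<lambda>i w. g (X i w)) {1..n}"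
    by (rule N.indep_vars_compose2[where M' = "\<lambda>_. path_space"])
      (auto intro: N.indep_vars_subset[OF X_indep])
  hence prod: "(\<integral>\<^sup>+w. (\<Prod>i\<in>{1..n}. g (X i w)) \<partial>N) = (\<Prod>i\<in>{1..n}. \<integral>\<^sup>+w. g (X i w) \<partial>N)"
    by (intro N.indep_vars_nn_integral) auto
  have one: "(\<integral>\<^sup>+w. g (X i w) \<partial>N) = ennreal (mgf m t c)" if "i \<in> {1..n}" for i
  proof -
    have "(\<integral>\<^sup>+w. g (X i w) \<partial>N) = (\<integral>\<^sup>+w. g (A w) \<partial>M)" using that by (intro nn_integral_X) auto
    also have "\<dots> = ennreal (mgf m t c)"
      unfolding g_def mgf_def using t by (intro nn_integral_eq_integral integrable_exp_lin) auto
    finally show ?thesis .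
  qed
  have "ennreal (exp (real n * lin m t c (mean n w) + b)) = ennreal (exp b) * (\<Prod>i\<in>{1..n}. g (X i w))" for w
  proof -
    have "real n * lin m t c (mean n w) = (\<Sum>i=1..n. lin m t c (X i w))"
      by (rule lin_mean[OF _ n]) (rule t)
    thus ?thesis
      by (simp add: g_def exp_add exp_sum prod_ennreal ennreal_mult'[symmetric] mult.commute)
  qed
  hence "(\<integral>\<^sup>+w. ennreal (exp (real n * lin m t c (mean n w) + b)) \<partial>N) =
      (\<integral>\<^sup>+w. ennreal (exp b) * (\<Prod>i\<in>{1..n}. g (X i w)) \<partial>N)" by simp
  also have "\<dots> = ennreal (exp b) * (\<integral>\<^sup>+w. (\<Prod>i\<in>{1..n}. g (X i w)) \<partial>N)"
  proof (rule nn_integral_cmult, rule borel_measurable_prod_ennreal)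
    fix i assume "i \<in> {1..n}"
    thus "(\<lambda>w. g (X i w)) \<in> borel_measurable N"
      by (intro measurable_compose[OF X_meas]) auto
  qed
  also have "(\<integral>\<^sup>+w. (\<Prod>i\<in>{1..n}. g (X i w)) \<partial>N) = (\<Prod>i\<in>{1..n}. ennreal (mgf m t c))"
    unfolding prod by (intro prod.cong refl one)
  also have "\<dots> = ennreal (mgf m t c) ^ n" by simp
  also have "ennreal (mgf m t c) = ennreal (exp (Lam m t c))" using exp_Lam[of m t c] t by simp
  also have "ennreal (exp b) * ennreal (exp (Lam m t c)) ^ n = ennreal (exp (real n * Lam m t c + b))"
    by (simp add: ennreal_power ennreal_mult'[symmetric] exp_add exp_of_nat_mult mult.commute)
  finally show ?thesis .
qed

lemma measurable_lin_mean:
  "(\<And>l. l \<in> {1..m} \<Longrightarrow> t l \<in> {0..T}) \<Longrightarrow> (\<lambda>w. lin m t c (mean n w)) \<in> borel_measurable N"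
  unfolding lin_def
  by (intro borel_measurable_sum borel_measurable_times borel_measurable_const mean_meas_at) auto

text \<open>Chernoff's bound with the coefficients of the test itself: a violation means lin > a +
  Lam, and the factor exp (n Lam) from \<open>mean_mgf\<close> cancels, which leaves the same bound
  for every j.\<close>

lemma not_tested_prob:
  assumes n: "n \<ge> 1"
  shows "{w \<in> space N. \<not> tested a j (mean n w)} \<in> sets N"
    and "emeasure N {w \<in> space N. \<not> tested a j (mean n w)} \<le> ennreal (exp (- real n * a))"
proof -
  obtain m t c where j: "test_functional T j = (m, t, c)" by (cases "test_functional T j") auto
  have t: "\<And>l. l \<in> {1..m} \<Longrightarrow> t l \<in> {0..T}" by (rule test_functional_times(1)[OF T_pos j])
  have [measurable]: "(\<lambda>w. lin m t c (mean n w)) \<in> borel_measurable N"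
    by (rule measurable_lin_mean) (rule t)
  define B where "B = {w \<in> space N. \<not> tested a j (mean n w)}"
  have B: "B = {w \<in> space N. a + Lam m t c < lin m t c (mean n w)}"
    by (auto simp: B_def tested_def j)
  show m: "{w \<in> space N. \<not> tested a j (mean n w)} \<in> sets N"
    unfolding B_def[symmetric] B by measurable
  define b where "b = - real n * (a + Lam m t c)"
  have "emeasure N B = (\<integral>\<^sup>+w. indicator B w \<partial>N)" using m B_def by simp
  also have "\<dots> \<le> (\<integral>\<^sup>+w. ennreal (exp (real n * lin m t c (mean n w) + b)) \<partial>N)"
  proof (rule nn_integral_mono)
    fix w assume "w \<in> space N"
    show "indicator B w \<le> ennreal (exp (real n * lin m t c (mean n w) + b))"
    proof (cases "w \<in> B")
      case True
      hence "real n * (a + Lam m t c) \<le> real n * lin m t c (mean n w)"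
        by (intro mult_left_mono) (auto simp: B)
      hence "0 \<le> real n * lin m t c (mean n w) + b" by (simp add: b_def)
      thus ?thesis using True by simp
    qed simp
  qed
  also have "\<dots> = ennreal (exp (real n * Lam m t c + b))" by (rule mean_mgf[OF _ n]) (rule t)
  also have "real n * Lam m t c + b = - real n * a" by (simp add: b_def algebra_simps)
  finally show "emeasure N {w \<in> space N. \<not> tested a j (mean n w)} \<le> ennreal (exp (- real n * a))"
    by (simp add: B_def)
qed

text \<open>The number of half-spaces is fixed before n grows, so the union bound costs only ln (J +
  1) / n. Afterwards a increases to the infimum.\<close>

lemma LDP_upper:
  assumes C: "closedin (J1_topology T) C"
  shows "limsup (\<lambda>n. ereal (1 / real n) * elog (emeasure N {w \<in> space N. mean n w \<in> C}))
    \<le> - (INF \<phi>\<in>C. rate T M A \<phi>)"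
proof -
  let ?p = "\<lambda>n. emeasure N {w \<in> space N. mean n w \<in> C}"
  let ?L = "limsup (\<lambda>n. ereal (1 / real n) * elog (?p n))"
  have key: "?L \<le> - ereal a" if a: "ereal a < (INF \<phi>\<in>C. rate T M A \<phi>)" for a
  proof -
    obtain J where J: "\<And>\<phi>. \<phi> \<in> C \<Longrightarrow> counting_like T \<phi> \<Longrightarrow> \<exists>j\<le>J. \<not> tested a j \<phi>"
      using closed_set_finite_cover[OF C a] by blast
    have bound: "ereal (1 / real n) * elog (?p n)
        \<le> ereal (ln (real (Suc J)) / real n - a)" if n: "n \<ge> 1" for n
    proof -
      define B where "B j = {w \<in> space N. \<not> tested a j (mean n w)}" for j
      have B: "B j \<in> sets N" "emeasure N (B j) \<le> ennreal (exp (- real n * a))" for j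
        using not_tested_prob[OF n] by (auto simp: B_def)
      have "?p n \<le> emeasure N (\<Union>j\<in>{..J}. B j)"
      proof (rule emeasure_mono_AE)
        show "AE w in N. w \<in> {w \<in> space N. mean n w \<in> C} \<longrightarrow> w \<in> (\<Union>j\<in>{..J}. B j)"
          using AE_mean_counting_like[of n] by eventually_elim (use J in \<open>auto simp: B_def\<close>)
      qed (use B in auto)
      also have "\<dots> \<le> (\<Sum>j\<in>{..J}. emeasure N (B j))"
        using B by (intro emeasure_subadditive_finite) auto
      also have "\<dots> \<le> (\<Sum>j\<in>{..J}. ennreal (exp (- real n * a)))" using B by (intro sum_mono)
      also have "\<dots> = ennreal (real (Suc J) * exp (- real n * a))"
        by (subst sum_ennreal) auto
      finally have "elog (?p n)
          \<le> elog (ennreal (real (Suc J) * exp (- real n * a)))" by (rule elog_mono)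
      also have "\<dots> = ereal (ln (real (Suc J)) - real n * a)"
        by (subst elog_ennreal) (auto simp: ln_mult)
      finally have "ereal (1 / real n) * elog (?p n)
          \<le> ereal (1 / real n) * ereal (ln (real (Suc J)) - real n * a)"
        by (intro ereal_mult_left_mono) auto
      also have "\<dots> = ereal (ln (real (Suc J)) / real n - a)" using n by (simp add: field_simps)
      finally show ?thesis .
    qed
    have "?L \<le> limsup (\<lambda>n. ereal (ln (real (Suc J)) / real n - a))"
      using bound by (intro Limsup_mono) (auto simp: eventually_sequentially)
    also have "\<dots> = ereal (0 - a)"
      by (intro lim_imp_Limsup tendsto_intros lim_const_over_n) auto
    finally show ?thesis by simp
  qed
  have "(INF \<phi>\<in>C. rate T M A \<phi>) \<le> - ?L"
  \<comment> \<open>Approximation from below by finite a also covers an infinite infimum.\<close>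
  proof (rule dense_le)
    fix x assume x: "x < (INF \<phi>\<in>C. rate T M A \<phi>)"
    show "x \<le> - ?L"
    proof (cases x)
      case (real a)
      thus ?thesis using key[of a] x ereal_minus_le_minus[of "- x" ?L] by simp
    qed (use x in auto)
  qed
  thus ?thesis using ereal_minus_le_minus[of "- (INF \<phi>\<in>C. rate T M A \<phi>)" ?L] by simp
qed

end

section \<open>The lower bound\<close>

text \<open>Change of measure without constructing the tilted measure: off the box around y some
  coordinate deviates by at least \<epsilon>, and there the weight is dominated by an exponential
  with one coefficient moved by h or -h. After integration the side terms are moments given by
  \<open>mean_mgf\<close>.\<close>

lemma exp_tilt_split:
  assumes \<epsilon>: "0 \<le> \<epsilon>" and h: "0 \<le> h"
  shows "exp (real n * lin m t \<alpha> \<phi>) \<le>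
      (if \<forall>l\<in>{1..m}. \<bar>\<phi> (t l) - y l\<bar> < \<epsilon> then exp (real n * (\<Sum>l=1..m. \<alpha> l * y l + \<epsilon> * \<bar>\<alpha> l\<bar>)) else 0)
      + (\<Sum>l=1..m. exp (real n * lin m t (shift \<alpha> l h) \<phi> + real n * (- h * y l - h * \<epsilon>))
                 + exp (real n * lin m t (shift \<alpha> l (- h)) \<phi> + real n * (h * y l - h * \<epsilon>)))"
    (is "?L \<le> ?B + sum ?S _")
proof (cases "\<forall>l\<in>{1..m}. \<bar>\<phi> (t l) - y l\<bar> < \<epsilon>")
  case True
  have "lin m t \<alpha> \<phi> \<le> (\<Sum>l=1..m. \<alpha> l * y l + \<epsilon> * \<bar>\<alpha> l\<bar>)"
    unfolding lin_def
  proof (rule sum_mono)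
    fix l assume "l \<in> {1..m}"
    hence "\<bar>\<phi> (t l) - y l\<bar> \<le> \<epsilon>" using True by (blast intro: less_imp_le)
    hence "\<bar>\<alpha> l\<bar> * \<bar>\<phi> (t l) - y l\<bar> \<le> \<bar>\<alpha> l\<bar> * \<epsilon>" by (rule mult_left_mono) simp
    hence "\<alpha> l * (\<phi> (t l) - y l) \<le> \<bar>\<alpha> l\<bar> * \<epsilon>"
      using abs_ge_self[of "\<alpha> l * (\<phi> (t l) - y l)"] by (simp only: abs_mult)
    thus "\<alpha> l * \<phi> (t l) \<le> \<alpha> l * y l + \<epsilon> * \<bar>\<alpha> l\<bar>" by (simp add: algebra_simps)
  qed
  hence "?L \<le> ?B" using True by (auto intro!: mult_left_mono)
  moreover have "0 \<le> sum ?S {1..m}" by (intro sum_nonneg add_nonneg_nonneg) auto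
  ultimately show ?thesis by linarith
next
  case False
  then obtain l where l: "l \<in> {1..m}" "\<epsilon> \<le> \<bar>\<phi> (t l) - y l\<bar>" by auto
  have "?L \<le> ?S l"
  proof (cases "y l \<le> \<phi> (t l)")
    case True
    hence "0 \<le> h * (\<phi> (t l) - y l - \<epsilon>)" using l h by (intro mult_nonneg_nonneg) auto
    hence "0 \<le> real n * (h * (\<phi> (t l) - y l - \<epsilon>))" by simp
    hence "?L \<le> exp (real n * lin m t (shift \<alpha> l h) \<phi> + real n * (- h * y l - h * \<epsilon>))"
      unfolding lin_update[OF l(1)] by (simp add: algebra_simps)
    thus ?thesis by (smt (verit) exp_ge_zero)
  next
    case False
    hence "0 \<le> h * (y l - \<phi> (t l) - \<epsilon>)" using l h by (intro mult_nonneg_nonneg) auto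
    hence "0 \<le> real n * (h * (y l - \<phi> (t l) - \<epsilon>))" by simp
    hence "?L \<le> exp (real n * lin m t (shift \<alpha> l (- h)) \<phi> + real n * (h * y l - h * \<epsilon>))"
      unfolding lin_update[OF l(1)] by (simp add: algebra_simps)
    thus ?thesis by (smt (verit) exp_ge_zero)
  qed
  also have "?S l \<le> sum ?S {1..m}" using l by (intro member_le_sum) auto
  finally show ?thesis unfolding if_not_P[OF False] by simp
qed

context iid_increasing
begin

text \<open>The parabola makes y the gradient of \<open>Lam\<close> at \<alpha>, that is, the tilted
  mean. The side terms of \<open>exp_tilt_split\<close> are then exponentially smaller than exp (n
  Lam \<alpha>), so eventually at least half of the tilted mass sits in the box, where the weight is
  at most exp (n b).\<close>

lemma tilted_lower_bound:
  assumes t: "\<And>l. l \<in> {1..m} \<Longrightarrow> t l \<in> {0..T}" and \<epsilon>: "0 < \<epsilon>" and C: "0 \<le> C"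
    and Lam: "\<And>l h. l \<in> {1..m} \<Longrightarrow> \<bar>h\<bar> \<le> 1 \<Longrightarrow>
        Lam m t (shift \<alpha> l h) \<le> Lam m t \<alpha> + h * y l + C * h\<^sup>2"
  shows "\<forall>\<^sub>F n in sequentially.
    exp (- real n * ((\<Sum>l=1..m. \<alpha> l * y l) - Lam m t \<alpha> + \<epsilon> * (\<Sum>l=1..m. \<bar>\<alpha> l\<bar>))) / 2
      \<le> measure N {w \<in> space N. \<forall>l\<in>{1..m}. \<bar>mean n w (t l) - y l\<bar> < \<epsilon>}"
proof -
  \<comment> \<open>So small that C h^2 \<le> h \<epsilon> / 2: half of the gain h \<epsilon>
    survives as \<kappa>.\<close>
  define h where "h = min 1 (\<epsilon> / (2 * (C + 1)))"
  have h: "0 < h" "h \<le> 1" using \<epsilon> C by (auto simp: h_def)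
  have "h \<le> \<epsilon> / (2 * (C + 1))" by (simp add: h_def)
  hence "h * (2 * (C + 1)) \<le> \<epsilon>" using C by (subst (asm) pos_le_divide_eq) auto
  hence "C * h \<le> \<epsilon> / 2" using h by (simp add: algebra_simps)
  hence "h * (C * h) \<le> h * (\<epsilon> / 2)" using h by (intro mult_left_mono) auto
  hence Ch: "C * h\<^sup>2 \<le> h * \<epsilon> / 2" by (simp add: power2_eq_square algebra_simps)
  define \<kappa> where "\<kappa> = h * \<epsilon> / 2"
  have \<kappa>: "0 < \<kappa>" using h \<epsilon> by (simp add: \<kappa>_def)
  define b where "b = (\<Sum>l=1..m. \<alpha> l * y l + \<epsilon> * \<bar>\<alpha> l\<bar>)"
  have "(\<lambda>n. real m * 2 * exp (- \<kappa> * real n)) \<longlonglongrightarrow> 0" using \<kappa> by real_asymp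
  hence "\<forall>\<^sub>F n in sequentially. real m * 2 * exp (- \<kappa> * real n) < 1 / 2"
    by (rule order_tendstoD) simp
  with eventually_ge_at_top[of 1] show ?thesis
  proof eventually_elim
    case (elim n)
    hence n: "n \<ge> 1" by simp
    define B where "B = {w \<in> space N. \<forall>l\<in>{1..m}. \<bar>mean n w (t l) - y l\<bar> < \<epsilon>}"
    have Bm: "B \<in> sets N"
    proof -
      have "{w \<in> space N. \<bar>mean n w (t l) - y l\<bar> < \<epsilon>} \<in> sets N" if "l \<in> {1..m}" for l
        using mean_meas_at[OF t[OF that], of n] by measurable
      thus ?thesis unfolding B_def by (intro sets.sets_Collect_finite_All) auto
    qed
    let ?U = "\<lambda>l w. exp (real n * lin m t (shift \<alpha> l h) (mean n w) + real n * (- h * y l - h * \<epsilon>))"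
    let ?V = "\<lambda>l w. exp (real n * lin m t (shift \<alpha> l (- h)) (mean n w) + real n * (h * y l - h * \<epsilon>))"
    let ?u = "\<lambda>l w. ennreal (?U l w)"
    let ?v = "\<lambda>l w. ennreal (?V l w)"
    have int: "(\<integral>\<^sup>+w. ennreal (exp (real n * lin m t c (mean n w) + r)) \<partial>N) = ennreal (exp (real n * Lam m t c + r))"
      for c r by (rule mean_mgf[OF _ n]) (rule t)
    have lm: "(\<lambda>w. lin m t c (mean n w)) \<in> borel_measurable N" for c
      by (rule measurable_lin_mean) (rule t)
    have um: "?u l \<in> borel_measurable N" "?v l \<in> borel_measurable N" for l
      using lm[of "shift \<alpha> l h"] lm[of "shift \<alpha> l (- h)"] by measurable
    let ?Z = "exp (real n * Lam m t \<alpha>)"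
    have "ennreal ?Z = (\<integral>\<^sup>+w. ennreal (exp (real n * lin m t \<alpha> (mean n w) + 0)) \<partial>N)"
      unfolding int by simp
    also have "\<dots> \<le> (\<integral>\<^sup>+w. ennreal (exp (real n * b)) * indicator B w + (\<Sum>l=1..m. ?u l w + ?v l w) \<partial>N)"
    proof (rule nn_integral_mono)
      fix w assume w: "w \<in> space N"
      have "exp (real n * lin m t \<alpha> (mean n w)) \<le> (if w \<in> B then exp (real n * b) else 0)
        + (\<Sum>l=1..m. ?U l w + ?V l w)"
      proof -
        have iff: "w \<in> B \<longleftrightarrow> (\<forall>l\<in>{1..m}. \<bar>mean n w (t l) - y l\<bar> < \<epsilon>)" using w by (simp add: B_def)
        show ?thesis unfolding b_def iff by (rule exp_tilt_split) (use t \<epsilon> h in auto)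
      qed
      hence "ennreal (exp (real n * lin m t \<alpha> (mean n w))) \<le> ennreal ((if w \<in> B then exp (real n * b) else 0)
        + (\<Sum>l=1..m. ?U l w + ?V l w))"
        by (rule ennreal_leI)
      also have "\<dots> = ennreal (exp (real n * b)) * indicator B w + (\<Sum>l=1..m. ?u l w + ?v l w)"
        by (subst ennreal_plus) (auto simp: sum_nonneg ennreal_plus[symmetric] sum_ennreal simp del: ennreal_plus)
      finally show "ennreal (exp (real n * lin m t \<alpha> (mean n w) + 0)) \<le>
          ennreal (exp (real n * b)) * indicator B w + (\<Sum>l=1..m. ?u l w + ?v l w)" by simp
    qed
    also have "\<dots> = ennreal (exp (real n * b)) * emeasure N B
        + (\<Sum>l=1..m. (\<integral>\<^sup>+w. ?u l w \<partial>N) + (\<integral>\<^sup>+w. ?v l w \<partial>N))"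
      using um Bm by (simp add: nn_integral_add nn_integral_sum nn_integral_cmult_indicator)
    also have "(\<Sum>l=1..m. (\<integral>\<^sup>+w. ?u l w \<partial>N) + (\<integral>\<^sup>+w. ?v l w \<partial>N))
        \<le> (\<Sum>l=1..m. ennreal (2 * exp (real n * (Lam m t \<alpha> - \<kappa>))))"
    proof (rule sum_mono)
      fix l assume l: "l \<in> {1..m}"
      have "Lam m t (shift \<alpha> l h) + (- h * y l - h * \<epsilon>) \<le> Lam m t \<alpha> - \<kappa>"
        using Lam[OF l, of h] h Ch by (simp add: \<kappa>_def)
      hence 1: "real n * (Lam m t (shift \<alpha> l h) + (- h * y l - h * \<epsilon>)) \<le> real n * (Lam m t \<alpha> - \<kappa>)"
        by (intro mult_left_mono) auto
      have "Lam m t (shift \<alpha> l (- h)) + (h * y l - h * \<epsilon>) \<le> Lam m t \<alpha> - \<kappa>"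
        using Lam[OF l, of "- h"] h Ch by (simp add: \<kappa>_def)
      hence 2: "real n * (Lam m t (shift \<alpha> l (- h)) + (h * y l - h * \<epsilon>)) \<le> real n * (Lam m t \<alpha> - \<kappa>)"
        by (intro mult_left_mono) auto
      have "(\<integral>\<^sup>+w. ?u l w \<partial>N) + (\<integral>\<^sup>+w. ?v l w \<partial>N)
          \<le> ennreal (exp (real n * (Lam m t \<alpha> - \<kappa>))) + ennreal (exp (real n * (Lam m t \<alpha> - \<kappa>)))"
        unfolding int using 1 2 by (intro add_mono ennreal_leI) (simp_all add: distrib_left)
      thus "(\<integral>\<^sup>+w. ?u l w \<partial>N) + (\<integral>\<^sup>+w. ?v l w \<partial>N) \<le> ennreal (2 * exp (real n * (Lam m t \<alpha> - \<kappa>)))"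
        by (simp add: ennreal_plus[symmetric] del: ennreal_plus)
    qed
    also have "(\<Sum>l=1..m. ennreal (2 * exp (real n * (Lam m t \<alpha> - \<kappa>))))
        = ennreal (real m * 2 * exp (- \<kappa> * real n) * ?Z)"
      by (subst sum_ennreal) (simp_all add: exp_diff exp_minus algebra_simps divide_inverse)
    also have "ennreal (exp (real n * b)) * emeasure N B
        + ennreal (real m * 2 * exp (- \<kappa> * real n) * ?Z)
        = ennreal (exp (real n * b) * measure N B + real m * 2 * exp (- \<kappa> * real n) * ?Z)"
      by (simp add: N.emeasure_eq_measure ennreal_mult'[symmetric] ennreal_plus[symmetric] del: ennreal_plus)
    finally have "ennreal ?Z \<le> ennreal
        (exp (real n * b) * measure N B + real m * 2 * exp (- \<kappa> * real n) * ?Z)"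
      by (simp only: add_left_mono)
    hence "?Z \<le>
        exp (real n * b) * measure N B + real m * 2 * exp (- \<kappa> * real n) * ?Z"
      by (subst (asm) ennreal_le_iff) (simp_all add: add_nonneg_nonneg)
    moreover have "real m * 2 * exp (- \<kappa> * real n) * ?Z \<le> 1 / 2 * ?Z"
      using elim by (intro mult_right_mono) auto
    ultimately have "?Z / 2 \<le> exp (real n * b) * measure N B" by linarith
    hence "exp (- (real n * b)) * (?Z / 2)
        \<le> exp (- (real n * b)) * (exp (real n * b) * measure N B)" by (intro mult_left_mono) auto
    also have "\<dots> = measure N B" by (simp add: exp_minus)
    also have "exp (- (real n * b)) * (?Z / 2) = exp (- real n * (b - Lam m t \<alpha>)) / 2"
      by (simp add: exp_add[symmetric] algebra_simps)
    also have "b - Lam m t \<alpha> = (\<Sum>l=1..m. \<alpha> l * y l) - Lam m t \<alpha> + \<epsilon> * (\<Sum>l=1..m. \<bar>\<alpha> l\<bar>)"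
      by (simp add: b_def sum.distrib sum_distrib_left)
    finally show ?case unfolding B_def .
  qed
qed

lemma fdd_lower_bound:
  assumes t: "\<And>l. l \<in> {1..m} \<Longrightarrow> t l \<in> {0..T}"
    and I: "\<And>\<alpha>. (\<Sum>l=1..m. \<alpha> l * x l) \<le> I + Lam m t \<alpha>" and e: "0 < e" and \<eta>: "0 < \<eta>"
  shows "\<forall>\<^sub>F n in sequentially. exp (- real n * (I + \<eta>)) / 2
      \<le> measure N {w \<in> space N. \<forall>l\<in>{1..m}. \<bar>mean n w (t l) - x l\<bar> < e}"
proof -
  have I0: "0 \<le> I" using I[of "\<lambda>_. 0"] by (simp add: Lam_zero_coeff)
  \<comment> \<open>Chosen so that 2 \<delta> I \<le> (e/2)^2. As \<delta>/2 times the square of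
    \<open>\<alpha> l\<close> is at most I, each coordinate of the target moves by at most
    e/2.\<close>
  define \<delta> where "\<delta> = e\<^sup>2 / (8 * (I + 1))"
  have \<delta>: "0 < \<delta>" using e I0 by (simp add: \<delta>_def)
  have \<delta>I: "2 * \<delta> * I \<le> (e / 2)\<^sup>2"
    using I0 e by (simp add: \<delta>_def field_simps power2_eq_square)
  obtain \<alpha> C where \<alpha>: "\<And>l. l \<in> {1..m} \<Longrightarrow> \<delta> / 2 * (\<alpha> l)\<^sup>2 \<le> I" and C: "0 \<le> C"
    and Lam: "\<And>l h. l \<in> {1..m} \<Longrightarrow> \<bar>h\<bar> \<le> 1 \<Longrightarrow>
        Lam m t (shift \<alpha> l h) \<le> Lam m t \<alpha> + h * (x l - \<delta> * \<alpha> l) + C * h\<^sup>2"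
    by (rule penalised_maximiser[of m t x I \<delta>, OF t I \<delta>], assumption, rule that)
  define y where "y l = x l - \<delta> * \<alpha> l" for l
  have xy: "\<bar>x l - y l\<bar> \<le> e / 2" if l: "l \<in> {1..m}" for l
  proof -
    have "(\<delta> * \<alpha> l)\<^sup>2 = 2 * \<delta> * (\<delta> / 2 * (\<alpha> l)\<^sup>2)" by (simp add: power2_eq_square)
    also have "\<dots> \<le> 2 * \<delta> * I" using \<alpha>[OF l] \<delta> by (intro mult_left_mono) auto
    finally have "(\<delta> * \<alpha> l)\<^sup>2 \<le> (e / 2)\<^sup>2" using \<delta>I by simp
    hence "\<bar>\<delta> * \<alpha> l\<bar> \<le> e / 2" using e by (simp add: abs_le_square_iff[symmetric])
    thus ?thesis by (simp add: y_def)
  qed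
  define S where "S = (\<Sum>l=1..m. \<bar>\<alpha> l\<bar>)"
  have S: "0 \<le> S" by (simp add: S_def sum_nonneg)
  \<comment> \<open>The first entry puts the box around y inside the one around x, the second keeps
    the loss \<epsilon> S below \<eta>.\<close>
  define \<epsilon> where "\<epsilon> = min (e / 2) (\<eta> / (S + 1))"
  have \<epsilon>: "0 < \<epsilon>" using e \<eta> S by (simp add: \<epsilon>_def)
  have \<epsilon>e: "\<epsilon> \<le> e / 2" unfolding \<epsilon>_def by (rule min.cobounded1)
  have "\<epsilon> * S \<le> \<eta> / (S + 1) * (S + 1)" using S \<epsilon> \<eta> by (intro mult_mono) (auto simp: \<epsilon>_def)
  hence \<epsilon>S: "\<epsilon> * S \<le> \<eta>" using S by simp
  \<comment> \<open>Passing from x to y subtracts \<delta> times the sum of the squares of the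
    coefficients, so the displaced target does not cost more.\<close>
  have "(\<Sum>l=1..m. \<alpha> l * y l) \<le> (\<Sum>l=1..m. \<alpha> l * x l)"
    using \<delta> by (intro sum_mono) (simp add: y_def algebra_simps)
  hence "(\<Sum>l=1..m. \<alpha> l * y l) - Lam m t \<alpha> + \<epsilon> * S \<le> I + \<eta>" using I[of \<alpha>] \<epsilon>S by simp
  hence le: "exp (- real n * (I + \<eta>)) \<le> exp (- real n * ((\<Sum>l=1..m. \<alpha> l * y l) - Lam m t \<alpha> + \<epsilon> * S))" for n
    by (simp add: mult_left_mono)
  have "\<forall>\<^sub>F n in sequentially.
    exp (- real n * ((\<Sum>l=1..m. \<alpha> l * y l) - Lam m t \<alpha> + \<epsilon> * (\<Sum>l=1..m. \<bar>\<alpha> l\<bar>))) / 2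
      \<le> measure N {w \<in> space N. \<forall>l\<in>{1..m}. \<bar>mean n w (t l) - y l\<bar> < \<epsilon>}"
    by (rule tilted_lower_bound[OF _ \<epsilon> C]) (use t Lam in \<open>auto simp: y_def\<close>)
  thus ?thesis
  proof eventually_elim
    case (elim n)
    have m: "{w \<in> space N. \<bar>mean n w (t l) - x l\<bar> < e} \<in> sets N" if "l \<in> {1..m}" for l
      using mean_meas_at[OF t[OF that], of n] by measurable
    have "exp (- real n * (I + \<eta>)) / 2 \<le> measure N {w \<in> space N. \<forall>l\<in>{1..m}. \<bar>mean n w (t l) - y l\<bar> < \<epsilon>}"
      using elim le[of n] unfolding S_def by linarith
    also have "\<dots> \<le> measure N {w \<in> space N. \<forall>l\<in>{1..m}. \<bar>mean n w (t l) - x l\<bar> < e}"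
    proof (rule N.finite_measure_mono)
      show "{w \<in> space N. \<forall>l\<in>{1..m}. \<bar>mean n w (t l) - y l\<bar> < \<epsilon>}
          \<subseteq> {w \<in> space N. \<forall>l\<in>{1..m}. \<bar>mean n w (t l) - x l\<bar> < e}"
      proof safe
        fix w l assume *: "\<forall>l\<in>{1..m}. \<bar>mean n w (t l) - y l\<bar> < \<epsilon>" "l \<in> {1..m}"
        hence "\<bar>mean n w (t l) - y l\<bar> < \<epsilon>" by blast
        thus "\<bar>mean n w (t l) - x l\<bar> < e" using xy[OF *(2)] \<epsilon>e by linarith
      qed
      show "{w \<in> space N. \<forall>l\<in>{1..m}. \<bar>mean n w (t l) - x l\<bar> < e} \<in> sets N"
        using m by (intro sets.sets_Collect_finite_All) auto
    qed
    finally show ?case .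
  qed
qed

text \<open>A finite rate makes \<phi> uniformly continuous, so a monotone path that is close to it
  on a fine grid is close to it everywhere, hence in \<open>J1_dist\<close>.\<close>

lemma path_lower_bound:
  assumes G: "openin (J1_topology T) G" and \<phi>: "\<phi> \<in> G" and rate: "rate T M A \<phi> = ereal I" and \<eta>: "0 < \<eta>"
  shows "\<forall>\<^sub>F n in sequentially. exp (- real n * (I + \<eta>)) / 2 \<le> measure N {w \<in> space N. mean n w \<in> G}"
proof -
  interpret J: Metric_space "cadlag T" "J1_dist T" by (rule Metric_space_J1[OF T_pos])
  have cad: "\<phi> \<in> cadlag T" using \<phi> openin_subset[OF G] topspace_J1_topology[OF T_pos] by blast
  obtain r where r: "r > 0" "J.mball \<phi> r \<subseteq> G"
    using G \<phi> unfolding J1_topology_def J.openin_mtopology by blast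
  have reg: "counting_like T \<phi>" "uniformly_continuous_on {0..T} \<phi>"
    using finite_rate_regular[OF cad, of I] rate by auto
  \<comment> \<open>\<open>grid_sandwich\<close> doubles the error, and 2 e = r/2 is still below
    r.\<close>
  define e where "e = r / 4"
  have e: "0 < e" using r by (simp add: e_def)
  obtain m where m: "m \<ge> 1"
    "\<And>s t. s \<in> {0..T} \<Longrightarrow> t \<in> {0..T} \<Longrightarrow> \<bar>s - t\<bar> \<le> T / real m \<Longrightarrow> \<bar>\<phi> s - \<phi> t\<bar> \<le> e"
    by (rule fine_grid[OF reg(2) e], rule that)
  define t where "t = (\<lambda>l. T / real m * real l)"
  have t: "t l \<in> {0..T}" if "l \<in> {1..m}" for l
    using grid_in_fractions[of l m T] fractions_subset[OF T_pos] that m by (auto simp: t_def)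
  have 0: "\<phi> 0 = 0" using reg(1) by (simp add: counting_like_def)
  have "(\<Sum>l=1..m. \<alpha> l * \<phi> (t l)) \<le> I + Lam m t \<alpha>" for \<alpha>
    using iffD1[OF rate_le_iff[of \<phi> I]] 0 rate t unfolding lin_def by simp
  hence "\<forall>\<^sub>F n in sequentially. exp (- real n * (I + \<eta>)) / 2
      \<le> measure N {w \<in> space N. \<forall>l\<in>{1..m}. \<bar>mean n w (t l) - \<phi> (t l)\<bar> < e}"
    by (intro fdd_lower_bound t e \<eta>)
  thus ?thesis
  proof eventually_elim
    case (elim n)
    have Gm: "{w \<in> space N. mean n w \<in> G} \<in> sets N"
    proof -
      have "G \<in> sets (borel_of_topology (J1_topology T))"
        unfolding borel_of_topology_def using G by (subst sets_measure_of) (auto dest: openin_subset)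
      from measurable_sets[OF mean_measurable this, of n] show ?thesis
        by (simp add: vimage_def Int_def conj_commute)
    qed
    note elim
    also have "measure N {w \<in> space N. \<forall>l\<in>{1..m}. \<bar>mean n w (t l) - \<phi> (t l)\<bar> < e}
        \<le> measure N {w \<in> space N. mean n w \<in> G}"
    proof (rule N.finite_measure_mono_AE[OF _ Gm])
      show "AE w in N. w \<in> {w \<in> space N. \<forall>l\<in>{1..m}. \<bar>mean n w (t l) - \<phi> (t l)\<bar> < e}
          \<longrightarrow> w \<in> {w \<in> space N. mean n w \<in> G}"
        using AE_mean_counting_like[of n]
      proof (rule AE_mp, intro AE_I2 impI)
        fix w assume w: "w \<in> space N" and cl: "counting_like T (mean n w)"
          and "w \<in> {w \<in> space N. \<forall>l\<in>{1..m}. \<bar>mean n w (t l) - \<phi> (t l)\<bar> < e}"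
        hence close: "\<And>l. l \<in> {1..m} \<Longrightarrow> \<bar>mean n w (t l) - \<phi> (t l)\<bar> < e" by blast
        have "\<bar>\<phi> s - mean n w s\<bar> \<le> 2 * e" if "s \<in> {0..T}" for s
        proof -
          have "\<bar>mean n w s - \<phi> s\<bar> \<le> 2 * e"
          proof (rule grid_sandwich[OF m(1) T_pos cl _ m(2) that])
            show "\<bar>mean n w (T / real m * real l) - \<phi> (T / real m * real l)\<bar> \<le> e" if "l \<le> m" for l
            \<comment> \<open>Time 0 is not sampled, but both paths start at 0.\<close>
            proof (cases "l = 0")
              case True thus ?thesis using cl 0 e by (simp add: counting_like_def)
            next
              case False thus ?thesis using close[of l] that by (simp add: t_def)
            qed
          qed
          thus ?thesis by linarith
        qed
        hence "J1_dist T \<phi> (mean n w) \<le> 2 * e" by (intro J1_dist_le_sup T_pos cad mean_cadlag w)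
        hence "mean n w \<in> J.mball \<phi> r" using r(1) cad mean_cadlag[OF w] by (simp add: J.in_mball e_def)
        thus "w \<in> {w \<in> space N. mean n w \<in> G}" using r(2) w by blast
      qed
    qed
    finally show ?case .
  qed
qed

lemma LDP_lower:
  assumes G: "openin (J1_topology T) G"
  shows "liminf (\<lambda>n. ereal (1 / real n) * elog (emeasure N {w \<in> space N. mean n w \<in> G}))
    \<ge> - (INF \<phi>\<in>G. rate T M A \<phi>)"
proof -
  let ?p = "\<lambda>n. emeasure N {w \<in> space N. mean n w \<in> G}"
  let ?L = "liminf (\<lambda>n. ereal (1 / real n) * elog (?p n))"
  have "- ?L \<le> rate T M A \<phi>" if \<phi>: "\<phi> \<in> G" for \<phi>
  proof (cases "rate T M A \<phi>")
    case (real I)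
    have L: "- ereal (I + \<eta>) \<le> ?L" if \<eta>: "0 < \<eta>" for \<eta>
    proof -
      have "ereal (0 - (I + \<eta>)) = liminf (\<lambda>n. ereal (ln (1 / 2) / real n - (I + \<eta>)))"
        by (intro lim_imp_Liminf[symmetric] tendsto_intros lim_const_over_n) auto
      also have "\<dots> \<le> ?L"
      proof (rule Liminf_mono)
        show "\<forall>\<^sub>F n in sequentially. ereal (ln (1 / 2) / real n - (I + \<eta>)) \<le>
            ereal (1 / real n) * elog (?p n)"
          using path_lower_bound[OF G \<phi> real \<eta>] eventually_ge_at_top[of 1]
        proof eventually_elim
          case (elim n)
          have "ereal (ln (1 / 2) / real n - (I + \<eta>))
              = ereal (1 / real n) * ereal (ln (exp (- real n * (I + \<eta>)) / 2))"
            using elim(2) by (simp add: ln_div field_simps)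
          also have "ereal (ln (exp (- real n * (I + \<eta>)) / 2)) = elog (ennreal (exp (- real n * (I + \<eta>)) / 2))"
            by (subst elog_ennreal) auto
          also have "ereal (1 / real n) * \<dots> \<le> ereal (1 / real n) * elog (?p n)"
            using elim(1) by (intro ereal_mult_left_mono elog_mono) (auto simp: N.emeasure_eq_measure intro!: ennreal_leI)
          finally show ?case .
        qed
      qed
      finally show ?thesis by simp
    qed
    have "- ?L \<le> ereal I + ereal \<eta>" if "0 < \<eta>" for \<eta>
      using iffD2[OF ereal_minus_le_minus L[OF that]] by (simp only: ereal_uminus_uminus plus_ereal.simps)
    hence "- ?L \<le> ereal I" by (rule ereal_le_epsilon2)
    thus ?thesis unfolding real .
  qed (use rate_nonneg[of \<phi>] in auto)
  hence "- ?L \<le> (INF \<phi>\<in>G. rate T M A \<phi>)" by (rule INF_greatest)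
  thus ?thesis by (rule iffD1[OF ereal_uminus_le_reorder])
qed

theorem LDP: "satisfies_LDP N (J1_topology T) mean (rate T M A)"
  unfolding satisfies_LDP_def using mean_measurable rate_nonneg LDP_upper LDP_lower by blast

end

section \<open>The variational representation\<close>

text \<open>The common ground of a fixed cadlag path and the sample paths of A. The bound is
  explicit so that it can be A(T) in the latter case and feed dominated convergence.\<close>

definition right_regular :: "real \<Rightarrow> real \<Rightarrow> (real \<Rightarrow> real) \<Rightarrow> bool" where
  "right_regular T B \<psi> \<longleftrightarrow>
     (\<forall>t\<in>{0..<T}. (\<psi> \<longlongrightarrow> \<psi> t) (at_right t)) \<and> (\<forall>t\<in>{0..T}. \<bar>\<psi> t\<bar> \<le> B)"

abbreviation grid_time :: "real \<Rightarrow> nat \<Rightarrow> nat \<Rightarrow> real" where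
  "grid_time T k \<equiv> (\<lambda>l. T / real (Suc k) * real l)"

section \<open>Riemann sums of right-continuous paths\<close>

lemma continuous_on_Icc_bounded:
  fixes \<theta> :: "real \<Rightarrow> real"
  assumes "continuous_on {a..b} \<theta>" shows "\<exists>C. \<forall>t\<in>{a..b}. \<bar>\<theta> t\<bar> \<le> C"
  using compact_imp_bounded[OF compact_continuous_image[OF assms compact_Icc]] by (auto simp: bounded_iff)

lemma right_regular_mult:
  assumes "continuous_on {0..T} \<theta>" "\<And>t. t \<in> {0..T} \<Longrightarrow> \<bar>\<theta> t\<bar> \<le> C" "right_regular T B \<psi>" "0 < T"
  shows "right_regular T (C * B) (\<lambda>t. \<theta> t * \<psi> t)"
  unfolding right_regular_def
proof (intro conjI ballI)
  fix t assume t: "t \<in> {0..<T}"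
  have "(\<theta> \<longlongrightarrow> \<theta> t) (at t within {0..T})" using assms(1) t by (auto simp: continuous_on_def)
  hence "(\<theta> \<longlongrightarrow> \<theta> t) (at t within {t..T})" by (rule tendsto_within_subset) (use t in auto)
  hence "(\<theta> \<longlongrightarrow> \<theta> t) (at_right t)" using t by (simp add: at_within_Icc_at_right)
  thus "((\<lambda>t. \<theta> t * \<psi> t) \<longlongrightarrow> \<theta> t * \<psi> t) (at_right t)"
    using assms(3) t by (intro tendsto_mult) (auto simp: right_regular_def)
next
  fix t assume t: "t \<in> {0..T}"
  have "\<bar>\<psi> t\<bar> \<le> B" using assms(3) t by (simp add: right_regular_def)
  moreover have "0 \<le> C" using assms(2)[OF t] by linarith
  ultimately show "\<bar>\<theta> t * \<psi> t\<bar> \<le> C * B"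
    unfolding abs_mult using assms(2)[OF t] by (intro mult_mono) auto
qed

text \<open>Composition with rounding up turns an arbitrary f into a finite combination of
  indicators of intervals, which can be measured and integrated explicitly.\<close>

lemma ceil_step_sum:
  fixes f :: "real \<Rightarrow> real"
  assumes T: "0 < T" and m: "m \<ge> 1"
  shows "indicator {0<..T} t * f (ceil_to (T / real m) t) =
    (\<Sum>l=1..m. f (T / real m * real l) * indicator {T / real m * (real l - 1)<..T / real m * real l} t)"
    (is "_ = (\<Sum>l=1..m. ?g l)")
proof -
  define h where "h = T / real m"
  have h: "0 < h" "h * real m = T" using T m by (auto simp: h_def)
  have iff: "t \<in> {h * (real l - 1)<..h * real l} \<longleftrightarrow> int l = \<lceil>t / h\<rceil>" for l
  proof -
    have "t \<in> {h * (real l - 1)<..h * real l} \<longleftrightarrow> real l - 1 < t / h \<and> t / h \<le> real l"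
      using h by (simp add: field_simps)
    also have "\<dots> \<longleftrightarrow> int l = \<lceil>t / h\<rceil>" using ceiling_eq_iff[of "t / h" "int l"] by auto
    finally show ?thesis .
  qed
  show ?thesis
  proof (cases "t \<in> {0<..T}")
    case True
    have "0 < t / h" "t / h \<le> real m" using True h by (auto simp: field_simps)
    hence c: "0 < \<lceil>t / h\<rceil>" "\<lceil>t / h\<rceil> \<le> int m" by (auto simp: ceiling_le_iff)
    define l0 where "l0 = nat \<lceil>t / h\<rceil>"
    have l0': "int l0 = \<lceil>t / h\<rceil>" using c(1) unfolding l0_def by (intro nat_0_le) linarith
    have "1 \<le> l0" "l0 \<le> m" using c unfolding l0'[symmetric] by linarith+
    hence l0: "l0 \<in> {1..m}" "int l0 = \<lceil>t / h\<rceil>" using l0' by auto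
    have "?g l = (if l = l0 then f (h * real l0) else 0)" for l
    proof -
      have m: "t \<in> {h * (real l - 1)<..h * real l} \<longleftrightarrow> l = l0" using iff[of l] l0(2) by linarith
      show ?thesis unfolding h_def[symmetric] indicator_def m by simp
    qed
    hence "(\<Sum>l=1..m. ?g l) = f (h * real l0)" using l0 by simp
    moreover have "real l0 = of_int \<lceil>t / h\<rceil>" unfolding l0(2)[symmetric] by simp
    hence "h * real l0 = ceil_to h t" by (simp only: ceil_to_def)
    ultimately show ?thesis using True by (simp add: h_def)
  next
    case False
    have "?g l = 0" if l: "l \<in> {1..m}" for l
    proof -
      have "h * 0 \<le> h * (real l - 1)" "h * real l \<le> h * real m" using l h by (auto intro: mult_left_mono)
      hence "t \<notin> {h * (real l - 1)<..h * real l}"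
        using False h(2) by (simp only: greaterThanAtMost_iff mult_zero_right) linarith
      thus ?thesis by (simp add: h_def)
    qed
    hence "(\<Sum>l=1..m. ?g l) = 0" by (intro sum.neutral ballI)
    moreover have "indicator {0<..T} t = (0::real)" using False by simp
    ultimately show ?thesis by (simp only: mult_zero_left)
  qed
qed

text \<open>Right-endpoint sums integrate f after rounding up; right continuity gives pointwise
  convergence, hence measurability, and B dominates. The cells are open on the left, so the point 0
  is added separately; for the integral it is a null set.\<close>

lemma
  assumes T: "0 < T" and f: "right_regular T B f"
  shows right_regular_measurable: "(\<lambda>t. indicator {0..T} t * f t) \<in> borel_measurable borel"
    and right_regular_riemann: "(\<lambda>k. \<Sum>l=1..Suc k. T / real (Suc k) * f (grid_time T k l))
      \<longlonglongrightarrow> (LBINT t:{0..T}. f t)"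
proof -
  define g where "g k t = indicator {0<..T} t * f (round_up T k t)" for k t
  have g_eq: "g k t = (\<Sum>l=1..Suc k. f (grid_time T k l)
      * indicator {T / real (Suc k) * (real l - 1)<..T / real (Suc k) * real l} t)" for k t
    unfolding g_def by (rule ceil_step_sum[OF T]) simp
  have gm: "g k \<in> borel_measurable borel" for k
    unfolding g_eq[abs_def] by measurable
  have lim: "(\<lambda>k. g k t) \<longlonglongrightarrow> indicator {0<..T} t * f t" for t
  proof (cases "t \<in> {0<..T}")
    case True
    have "(\<lambda>k. f (round_up T k t)) \<longlonglongrightarrow> f t"
    proof (rule tendsto_from_right[of T f])
      show "(f \<longlongrightarrow> f v) (at_right v)" if "v \<in> {0..<T}" for v using f that by (simp add: right_regular_def)
      show "(\<lambda>k. round_up T k t) \<longlonglongrightarrow> t" by (rule ceil_to_tendsto[OF T])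
      show "t \<le> round_up T k t" for k by (rule ceil_to_ge) (use T in simp)
      show "round_up T k t \<le> T" for k by (rule ceil_to_le_end) (use T True in auto)
    qed (use True in auto)
    thus ?thesis using True by (simp add: g_def)
  qed (simp add: g_def)
  have fm: "(\<lambda>t. indicator {0<..T} t * f t) \<in> borel_measurable borel"
    by (rule borel_measurable_LIMSEQ_real[OF lim]) (use gm in auto)
  have eq: "indicator {0..T} t * f t = indicator {0<..T} t * f t + indicator {0} t * f 0" for t
    using T by (auto simp: indicator_def)
  show "(\<lambda>t. indicator {0..T} t * f t) \<in> borel_measurable borel"
    unfolding eq using fm by measurable
  hence fm': "(\<lambda>t. indicator {0..T} t * f t) \<in> borel_measurable lborel" by simp
  have "0 \<le> \<bar>f 0\<bar>" "\<bar>f 0\<bar> \<le> B" using f T by (auto simp: right_regular_def)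
  hence B: "0 \<le> B" by linarith
  have "(\<lambda>k. integral\<^sup>L lborel (g k)) \<longlonglongrightarrow> integral\<^sup>L lborel (\<lambda>t. indicator {0<..T} t * f t)"
  proof (rule integral_dominated_convergence[where w = "\<lambda>t. B * indicator {0<..T} t"])
    fix k
    show "AE t in lborel. norm (g k t) \<le> B * indicator {0<..T} t"
    proof (rule AE_I2)
      fix t
      show "norm (g k t) \<le> B * indicator {0<..T} t"
      proof (cases "t \<in> {0<..T}")
        case True
        have "t \<le> round_up T k t" "round_up T k t \<le> T"
          using T True by (auto simp del: of_nat_Suc intro!: ceil_to_ge ceil_to_le_end)
        hence "\<bar>f (round_up T k t)\<bar> \<le> B" using f True by (auto simp: right_regular_def)
        thus ?thesis using True by (simp add: g_def)
      qed (simp add: g_def)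
    qed
  qed (use lim gm fm T in auto)
  moreover have "integral\<^sup>L lborel (g k) = (\<Sum>l=1..Suc k. T / real (Suc k) * f (grid_time T k l))" for k
  proof -
    define h where "h = T / real (Suc k)"
    have h: "0 < h" using T by (simp add: h_def)
    have "integral\<^sup>L lborel (g k) = (\<Sum>l=1..Suc k. f (h * real l) * (h * real l - h * (real l - 1)))"
      unfolding g_eq[abs_def] h_def[symmetric]
    proof (subst Bochner_Integration.integral_sum)
      fix l
      show "integrable lborel (\<lambda>t. f (h * real l) * indicator {h * (real l - 1)<..h * real l} t)"
        using h by simp
    next
      show "(\<Sum>l=1..Suc k. LBINT t. f (h * real l) * indicator {h * (real l - 1)<..h * real l} t)
          = (\<Sum>l=1..Suc k. f (h * real l) * (h * real l - h * (real l - 1)))"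
        using h by (intro sum.cong refl) (simp add: measure_def algebra_simps)
    qed
    also have "\<dots> = (\<Sum>l=1..Suc k. h * f (h * real l))"
      by (intro sum.cong refl) (simp add: algebra_simps)
    finally show ?thesis by (simp add: h_def)
  qed
  moreover have "integral\<^sup>L lborel (\<lambda>t. indicator {0<..T} t * f t) = (LBINT t:{0..T}. f t)"
    unfolding set_lebesgue_integral_def
    using fm fm' AE_lborel_singleton[of 0]
    by (intro integral_cong_AE) (auto simp: indicator_def elim!: eventually_mono)
  ultimately show "(\<lambda>k. \<Sum>l=1..Suc k. T / real (Suc k) * f (grid_time T k l))
      \<longlonglongrightarrow> (LBINT t:{0..T}. f t)" by simp
qed

lemma right_regular_integral_bound:
  assumes T: "0 < T" and f: "right_regular T B f"
  shows "\<bar>LBINT t:{0..T}. f t\<bar> \<le> T * B"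
proof (rule tendsto_upperbound)
  show "(\<lambda>k. \<bar>\<Sum>l=1..Suc k. T / real (Suc k) * f (grid_time T k l)\<bar>) \<longlonglongrightarrow> \<bar>LBINT t:{0..T}. f t\<bar>"
    by (intro tendsto_rabs right_regular_riemann[OF T f])
  have "\<bar>\<Sum>l=1..Suc k. T / real (Suc k) * f (grid_time T k l)\<bar> \<le> T * B" for k
  proof -
    have "\<bar>\<Sum>l=1..Suc k. T / real (Suc k) * f (grid_time T k l)\<bar>
        \<le> (\<Sum>l=1..Suc k. T / real (Suc k) * B)"
    proof (rule order_trans[OF sum_abs sum_mono])
      fix l assume "l \<in> {1..Suc k}"
      hence "grid_time T k l \<in> {0..T}"
        using grid_in_fractions[of l "Suc k" T] fractions_subset[OF T] by auto
      thus "\<bar>T / real (Suc k) * f (grid_time T k l)\<bar> \<le> T / real (Suc k) * B"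
        unfolding abs_mult using T f by (intro mult_mono) (auto simp: right_regular_def)
    qed
    thus ?thesis by simp
  qed
  thus "\<forall>\<^sub>F k in sequentially. \<bar>\<Sum>l=1..Suc k. T / real (Suc k) * f (grid_time T k l)\<bar> \<le> T * B"
    by simp
qed simp

text \<open>The Beta(2,2) density: continuous on the whole line, supported in [0,1], with 6 as
  normalising constant.\<close>

definition hump :: "real \<Rightarrow> real" where
  "hump v = max 0 (6 * (v * (1 - v)))"

lemma hump_nonneg: "0 \<le> hump v" and hump_zero: "v \<le> 0 \<or> 1 \<le> v \<Longrightarrow> hump v = 0"
  by (auto simp: hump_def mult_nonneg_nonpos mult_nonpos_nonneg)

lemma hump_eq: "hump v = indicator {0..1} v *\<^sub>R (6 * (v * (1 - v)))"
proof (cases "v \<in> {0..1}")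
  case True thus ?thesis by (simp add: hump_def)
next
  case False
  thus ?thesis using hump_zero[of v] by auto
qed

lemma continuous_on_hump: "continuous_on S hump"
  unfolding hump_def[abs_def] by (intro continuous_intros)

lemma hump_integral: "integrable lborel hump" "integral\<^sup>L lborel hump = 1"
proof -
  have *: "has_bochner_integral lborel (\<lambda>v. indicator {0..1} v *\<^sub>R (6 * (v * (1 - v)) :: real))
      ((3 * 1\<^sup>2 - 2 * 1 ^ 3) - (3 * 0\<^sup>2 - 2 * 0 ^ 3))"
    by (rule has_bochner_integral_FTC_Icc[where F = "\<lambda>v. 3 * v\<^sup>2 - 2 * v ^ 3"])
      (auto intro!: derivative_eq_intros continuous_intros
        simp: has_real_derivative_iff_has_vector_derivative[symmetric] power2_eq_square algebra_simps)
  thus "integrable lborel hump" "integral\<^sup>L lborel hump = 1"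
    unfolding hump_eq[abs_def] has_bochner_integral_iff by auto
qed

text \<open>Mass one on [0, 1/(k+1)], to the right of 0 because the paths are only
  right-continuous.\<close>

definition bump :: "nat \<Rightarrow> real \<Rightarrow> real" where
  "bump k v = real (Suc k) * hump (real (Suc k) * v)"

text \<open>Substituting t = s + v/(k+1) gives an integral against the probability density
  \<open>hump\<close>, whence the bound by B. The window shrinks to s from the right and, as s < T,
  ends up inside the interval.\<close>

lemma
  assumes T: "0 < T" and f: "right_regular T B f" and s: "0 \<le> s" "s < T"
  shows bump_integrable: "integrable lborel (\<lambda>t. indicator {0..T} t * (bump k (t - s) * f t))"
    and bump_bound: "\<bar>LBINT t:{0..T}. bump k (t - s) * f t\<bar> \<le> B"
    and bump_tendsto: "(\<lambda>k. LBINT t:{0..T}. bump k (t - s) * f t) \<longlonglongrightarrow> f s"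
proof -
  \<comment> \<open>Extended by zero, since for small k the window may reach beyond T.\<close>
  define F where "F = (\<lambda>t. indicator {0..T} t * f t)"
  have [measurable]: "F \<in> borel_measurable borel"
    unfolding F_def by (rule right_regular_measurable[OF T f])
  have [measurable]: "hump \<in> borel_measurable borel"
    by (rule borel_measurable_continuous_onI[OF continuous_on_hump])
  have "0 \<le> \<bar>f 0\<bar>" "\<bar>f 0\<bar> \<le> B" using f T by (auto simp: right_regular_def)
  hence B: "0 \<le> B" by linarith
  have FB: "\<bar>F t\<bar> \<le> B" for t using f B by (auto simp: F_def right_regular_def indicator_def)
  let ?z = "\<lambda>k v. s + 1 / real (Suc k) * v"
  define G where "G k v = hump v * F (?z k v)" for k v
  have [measurable]: "G k \<in> borel_measurable borel" for k unfolding G_def[abs_def] by measurable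
  have GB: "\<bar>G k v\<bar> \<le> B * hump v" for k v
  proof -
    have "hump v * \<bar>F (?z k v)\<bar> \<le> hump v * B" by (intro mult_left_mono FB hump_nonneg)
    thus ?thesis using hump_nonneg[of v] by (simp add: G_def abs_mult mult.commute)
  qed
  have Gi: "integrable lborel (G k)" for k
  proof (rule Bochner_Integration.integrable_bound[of _ "\<lambda>v. B * hump v"])
    show "AE v in lborel. norm (G k v) \<le> norm (B * hump v)"
      using B GB hump_nonneg by (intro AE_I2) (simp add: abs_mult)
  qed (use hump_integral in auto)
  have aff: "bump k (?z k v - s) * F (?z k v) = real (Suc k) * G k v" for k v
    by (simp add: bump_def G_def)
  have eqF: "indicator {0..T} t * (bump k (t - s) * f t) = bump k (t - s) * F t" for k t
    by (simp add: F_def)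
  have int: "integrable lborel (\<lambda>t. bump k (t - s) * F t)" for k
  proof -
    have "integrable lborel (\<lambda>v. (\<lambda>t. bump k (t - s) * F t) (s + 1 / real (Suc k) * v))"
      unfolding aff using Gi by simp
    thus ?thesis using lborel_integrable_real_affine_iff[of "1 / real (Suc k)" "\<lambda>t. bump k (t - s) * F t" s] by simp
  qed
  thus "integrable lborel (\<lambda>t. indicator {0..T} t * (bump k (t - s) * f t))" unfolding eqF .
  have val: "(LBINT t:{0..T}. bump k (t - s) * f t) = integral\<^sup>L lborel (G k)" for k
  proof -
    have "(LBINT t:{0..T}. bump k (t - s) * f t) = (LBINT t. bump k (t - s) * F t)"
      unfolding set_lebesgue_integral_def real_scaleR_def eqF ..
    also have "\<dots> = \<bar>1 / real (Suc k)\<bar> *\<^sub>R (LBINT v. bump k (?z k v - s) * F (?z k v))"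
      by (rule lborel_integral_real_affine) simp
    also have "\<dots> = integral\<^sup>L lborel (G k)" unfolding aff by simp
    finally show ?thesis .
  qed
  have "\<bar>integral\<^sup>L lborel (G k)\<bar> \<le> integral\<^sup>L lborel (\<lambda>v. B * hump v)"
  proof (rule order_trans[OF integral_abs_bound], rule integral_mono)
    show "\<bar>G k v\<bar> \<le> B * hump v" for v
      by (rule GB)
  qed (use Gi hump_integral in auto)
  thus "\<bar>LBINT t:{0..T}. bump k (t - s) * f t\<bar> \<le> B" unfolding val using hump_integral by simp
  have "(\<lambda>k. integral\<^sup>L lborel (G k)) \<longlonglongrightarrow> integral\<^sup>L lborel (\<lambda>v. hump v * f s)"
  proof (rule integral_dominated_convergence[where w = "\<lambda>v. B * hump v"])
    show "AE v in lborel. norm (G k v) \<le> B * hump v" for k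
      using GB by (intro AE_I2) simp
    show "AE v in lborel. (\<lambda>k. G k v) \<longlonglongrightarrow> hump v * f s"
    proof (rule AE_I2)
      fix v
      show "(\<lambda>k. G k v) \<longlonglongrightarrow> hump v * f s"
      proof (cases "0 < v")
        case True
        have "(\<lambda>k. s + v / real (Suc k)) \<longlonglongrightarrow> s + 0" by (intro tendsto_intros tendsto_const_over_Suc)
        hence l: "(\<lambda>k. ?z k v) \<longlonglongrightarrow> s" by simp
        have "filterlim (\<lambda>k. ?z k v) (at_right s) sequentially"
          unfolding filterlim_at using l True by (auto intro!: always_eventually)
        moreover have "(f \<longlongrightarrow> f s) (at_right s)" using f s by (auto simp: right_regular_def)
        ultimately have "(\<lambda>k. f (?z k v)) \<longlonglongrightarrow> f s" by (rule filterlim_compose[rotated])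
        moreover have "\<forall>\<^sub>F k in sequentially. f (?z k v) = F (?z k v)"
          using order_tendstoD(2)[OF l s(2)] by eventually_elim (use s True in \<open>auto simp: F_def\<close>)
        ultimately have "(\<lambda>k. F (?z k v)) \<longlonglongrightarrow> f s"
          by (rule Lim_transform_eventually)
        thus ?thesis unfolding G_def by (intro tendsto_intros)
      qed (simp add: G_def hump_zero)
    qed
  qed (use hump_integral in auto)
  thus "(\<lambda>k. LBINT t:{0..T}. bump k (t - s) * f t) \<longlonglongrightarrow> f s"
    unfolding val using hump_integral by simp
qed

lemma continuous_on_bump: "continuous_on S (\<lambda>t. bump k (t - s))"
  unfolding bump_def by (intro continuous_intros continuous_on_compose2[OF continuous_on_hump[of UNIV]]) auto

lemma cadlag_right_regular:
  assumes "0 < T" "\<phi> \<in> cadlag T" shows "\<exists>B. right_regular T B \<phi>"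
  using cadlag_bounded[OF assms] assms(2) by (auto simp: right_regular_def cadlag_def)

definition pairing :: "real \<Rightarrow> (real \<Rightarrow> real) \<Rightarrow> real \<Rightarrow> (real \<Rightarrow> real) \<Rightarrow> real" where
  "pairing T \<theta> \<gamma> \<psi> = (LBINT t:{0..T}. \<theta> t * \<psi> t) + \<gamma> * \<psi> T"

text \<open>The last grid time is T, so the point mass \<gamma> is absorbed into the last
  coefficient.\<close>

definition riemann_coeff :: "real \<Rightarrow> (real \<Rightarrow> real) \<Rightarrow> real \<Rightarrow> nat \<Rightarrow> nat \<Rightarrow> real" where
  "riemann_coeff T \<theta> \<gamma> k l =
     T / real (Suc k) * \<theta> (grid_time T k l) + (if l = Suc k then \<gamma> else 0)"

lemma grid_time_grid: "0 < T \<Longrightarrow> grid_time T k \<in> time_grids T (Suc k)"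
proof -
  assume T: "0 < T"
  have "T / real (Suc k) * real l \<le> T / real (Suc k) * real (Suc k)" if "l \<le> Suc k" for l
    using T that by (intro mult_left_mono) auto
  hence "grid_time T k l \<le> T" if "l \<le> Suc k" for l using that by fastforce
  moreover have "0 < grid_time T k l" if "1 \<le> l" for l using T that by simp
  moreover have "strict_mono_on {1..Suc k} (grid_time T k)"
    using T by (intro strict_mono_onI mult_strict_left_mono) auto
  ultimately show ?thesis by (auto simp: time_grids_def)
qed

lemma grid_time_mem: "0 < T \<Longrightarrow> l \<in> {1..Suc k} \<Longrightarrow> grid_time T k l \<in> {0..T}"
  using grid_time_grid[of T k] by (fastforce simp: time_grids_def)

lemma lin_riemann:
  "lin (Suc k) (grid_time T k) (riemann_coeff T \<theta> \<gamma> k) \<psi> =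
     (\<Sum>l=1..Suc k. T / real (Suc k) * (\<theta> (grid_time T k l) * \<psi> (grid_time T k l))) + \<gamma> * \<psi> T"
proof -
  have "lin (Suc k) (grid_time T k) (riemann_coeff T \<theta> \<gamma> k) \<psi> =
    (\<Sum>l=1..Suc k. T / real (Suc k) * (\<theta> (grid_time T k l) * \<psi> (grid_time T k l))
       + (if l = Suc k then \<gamma> * \<psi> T else 0))"
    unfolding lin_def riemann_coeff_def
  proof (intro sum.cong refl)
    fix l
    have "T / real (Suc k) * real (Suc k) = T" by (rule nonzero_eq_divide_eq[THEN iffD1]) simp_all
    thus "(T / real (Suc k) * \<theta> (grid_time T k l) + (if l = Suc k then \<gamma> else 0))
        * \<psi> (grid_time T k l) =
      T / real (Suc k) * (\<theta> (grid_time T k l) * \<psi> (grid_time T k l))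
        + (if l = Suc k then \<gamma> * \<psi> T else 0)"
      by (cases "l = Suc k") (simp_all only: if_True if_False distrib_right mult.assoc mult_zero_left simp_thms)
  qed
  thus ?thesis by (simp add: sum.distrib del: of_nat_Suc sum.cl_ivl_Suc)
qed

lemma lin_riemann_tendsto:
  assumes T: "0 < T" and \<theta>: "continuous_on {0..T} \<theta>" and \<psi>: "right_regular T B \<psi>"
  shows "(\<lambda>k. lin (Suc k) (grid_time T k) (riemann_coeff T \<theta> \<gamma> k) \<psi>) \<longlonglongrightarrow> pairing T \<theta> \<gamma> \<psi>"
proof -
  obtain C where C: "\<And>t. t \<in> {0..T} \<Longrightarrow> \<bar>\<theta> t\<bar> \<le> C"
    using continuous_on_Icc_bounded[OF \<theta>] by blast
  show ?thesis unfolding lin_riemann pairing_def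
    by (intro tendsto_add tendsto_const right_regular_riemann[OF T right_regular_mult[OF \<theta> C \<psi> T]])
qed

context increasing_process
begin

lemma A_right_regular: "w \<in> space M \<Longrightarrow> right_regular T (A w T) (A w)"
  using A_rcont A_nonneg A_le_end by (auto simp: right_regular_def)

lemma pairing_measurable:
  assumes "continuous_on {0..T} \<theta>"
  shows "(\<lambda>w. pairing T \<theta> \<gamma> (A w)) \<in> borel_measurable M"
proof (rule borel_measurable_LIMSEQ_real)
  show "(\<lambda>k. lin (Suc k) (grid_time T k) (riemann_coeff T \<theta> \<gamma> k) (A w)) \<longlonglongrightarrow> pairing T \<theta> \<gamma> (A w)"
    if "w \<in> space M" for w
    by (rule lin_riemann_tendsto[OF T_pos assms A_right_regular[OF that]])
  show "(\<lambda>w. lin (Suc k) (grid_time T k) (riemann_coeff T \<theta> \<gamma> k) (A w)) \<in> borel_measurable M" for k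
    by (intro measurable_lin grid_time_mem T_pos)
qed

lemma integrable_exp_pairing:
  assumes \<theta>: "continuous_on {0..T} \<theta>"
  shows "integrable M (\<lambda>w. exp (pairing T \<theta> \<gamma> (A w)))"
proof -
  obtain C where C: "\<And>t. t \<in> {0..T} \<Longrightarrow> \<bar>\<theta> t\<bar> \<le> C"
    using continuous_on_Icc_bounded[OF \<theta>] by blast
  show ?thesis
  proof (rule integrable_dominated[of _ 1 "T * C + \<bar>\<gamma>\<bar>"])
    fix w assume w: "w \<in> space M"
    have "\<bar>LBINT t:{0..T}. \<theta> t * A w t\<bar> \<le> T * (C * A w T)"
      by (intro right_regular_integral_bound T_pos right_regular_mult[OF \<theta> C A_right_regular[OF w]])
    moreover have "\<gamma> * A w T \<le> \<bar>\<gamma>\<bar> * A w T" using A_nonneg[OF w T_mem(1)] by (intro mult_right_mono) auto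
    ultimately show "\<bar>exp (pairing T \<theta> \<gamma> (A w))\<bar> \<le> 1 * exp ((T * C + \<bar>\<gamma>\<bar>) * A w T)"
      by (simp add: pairing_def algebra_simps)
  qed (use pairing_measurable[OF \<theta>] in measurable)
qed

lemma Lambda_path_eq:
  assumes \<theta>: "continuous_on {0..T} \<theta>"
  shows "Lambda_path T M A \<theta> \<gamma> = ereal (ln (expectation (\<lambda>w. exp (pairing T \<theta> \<gamma> (A w)))))"
  using log_exp_moment_eq[OF integrable_exp_pairing[OF \<theta>]]
  by (simp add: Lambda_path_def pairing_def)

text \<open>Riemann sums are functionals on equidistant grids, each bounded through
  \<open>rate_ge_grid\<close>; the functional of \<phi> and the cumulant both converge.\<close>

lemma pairing_le_rate:
  assumes \<phi>: "\<phi> \<in> cadlag T" and \<theta>: "continuous_on {0..T} \<theta>"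
  shows "ereal (pairing T \<theta> \<gamma> \<phi>) - Lambda_path T M A \<theta> \<gamma> \<le> rate T M A \<phi>"
proof -
  let ?t = "grid_time T" and ?c = "riemann_coeff T \<theta> \<gamma>"
  obtain B where B: "right_regular T B \<phi>" using cadlag_right_regular[OF T_pos \<phi>] by blast
  obtain C where C: "\<And>t. t \<in> {0..T} \<Longrightarrow> \<bar>\<theta> t\<bar> \<le> C"
    using continuous_on_Icc_bounded[OF \<theta>] by blast
  \<comment> \<open>A bound on the absolute coefficient sums that is uniform in k gives a single
    dominating exponential of A(T).\<close>
  have csum: "(\<Sum>l=1..Suc k. \<bar>?c k l\<bar>) \<le> T * C + \<bar>\<gamma>\<bar>" for k
  proof -
    have "(\<Sum>l=1..Suc k. \<bar>?c k l\<bar>) \<le> (\<Sum>l=1..Suc k. T / real (Suc k) * C + (if l = Suc k then \<bar>\<gamma>\<bar> else 0))"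
    proof (rule sum_mono)
      fix l assume "l \<in> {1..Suc k}"
      hence "\<bar>\<theta> (grid_time T k l)\<bar> \<le> C"
        using C grid_time_mem[OF T_pos, of l k] by simp
      moreover define x where "x = T / real (Suc k) * \<theta> (grid_time T k l)"
      ultimately have "\<bar>x\<bar> \<le> T / real (Suc k) * C"
        unfolding x_def abs_mult using T_pos by (intro mult_mono) auto
      thus "\<bar>?c k l\<bar> \<le> T / real (Suc k) * C + (if l = Suc k then \<bar>\<gamma>\<bar> else 0)"
        unfolding riemann_coeff_def x_def[symmetric] using abs_triangle_ineq[of x \<gamma>] by (split if_split)+ linarith
    qed
    also have "\<dots> = T * C + \<bar>\<gamma>\<bar>" by (subst sum.distrib) simp
    finally show ?thesis .
  qed
  define E where "E = expectation (\<lambda>w. exp (pairing T \<theta> \<gamma> (A w)))"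
  have "(\<lambda>k. mgf (Suc k) (?t k) (?c k)) \<longlonglongrightarrow> E"
    unfolding mgf_def E_def
  proof (rule expectation_exp_tendsto[where r = "T * C + \<bar>\<gamma>\<bar>"])
    show "(\<lambda>w. lin (Suc k) (?t k) (?c k) (A w)) \<in> borel_measurable M" for k
      by (intro measurable_lin grid_time_mem T_pos)
    fix w assume w: "w \<in> space M"
    show "(\<lambda>k. lin (Suc k) (?t k) (?c k) (A w)) \<longlonglongrightarrow> pairing T \<theta> \<gamma> (A w)"
      by (rule lin_riemann_tendsto[OF T_pos \<theta> A_right_regular[OF w]])
    fix k
    have "\<bar>lin (Suc k) (?t k) (?c k) (A w)\<bar> \<le> (\<Sum>l=1..Suc k. \<bar>?c k l\<bar>) * A w T"
      by (intro abs_lin_le T_pos A_inc w grid_time_mem)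
    also have "\<dots> \<le> (T * C + \<bar>\<gamma>\<bar>) * A w T" using A_nonneg[OF w T_mem(1)] csum by (intro mult_right_mono)
    finally show "lin (Suc k) (?t k) (?c k) (A w) \<le> (T * C + \<bar>\<gamma>\<bar>) * A w T" by simp
  qed (rule pairing_measurable[OF \<theta>])
  moreover have "0 < E"
    unfolding E_def by (intro expectation_exp_pos integrable_exp_pairing \<theta>)
  ultimately have "(\<lambda>k. lin (Suc k) (?t k) (?c k) \<phi> - Lam (Suc k) (?t k) (?c k))
      \<longlonglongrightarrow> pairing T \<theta> \<gamma> \<phi> - ln E"
    unfolding Lam_def by (intro tendsto_diff tendsto_ln lin_riemann_tendsto[OF T_pos \<theta> B]) auto
  hence "(\<lambda>k. ereal (lin (Suc k) (?t k) (?c k) \<phi> - Lam (Suc k) (?t k) (?c k)))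
      \<longlonglongrightarrow> ereal (pairing T \<theta> \<gamma> \<phi> - ln E)" by (rule tendsto_ereal)
  hence "ereal (pairing T \<theta> \<gamma> \<phi> - ln E) \<le> rate T M A \<phi>"
    by (rule tendsto_upperbound) (intro always_eventually allI rate_ge_grid grid_time_grid T_pos, simp_all)
  thus ?thesis unfolding Lambda_path_eq[OF \<theta>] E_def by simp
qed

text \<open>Evaluation at a time before T is the limit of integrals against bumps just to its right,
  for \<phi> and for every sample path alike; evaluation at T is carried by \<gamma>. Bump integrals
  of a sample path never exceed A(T), which provides the domination.\<close>

lemma rate_le_pairing:
  assumes \<phi>: "\<phi> \<in> cadlag T"
    and b: "\<And>\<theta> \<gamma>. continuous_on {0..T} \<theta> \<Longrightarrow> ereal (pairing T \<theta> \<gamma> \<phi>) - Lambda_path T M A \<theta> \<gamma> \<le> b"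
  shows "rate T M A \<phi> \<le> b"
proof (rule rate_leI)
  fix m t c assume m: "m \<ge> 1" and t: "t \<in> time_grids T m"
  let ?L = "{l\<in>{1..m}. t l < T}" and ?R = "{l\<in>{1..m}. \<not> t l < T}"
  have tm: "t l \<in> {0..T}" "0 \<le> t l" "t l \<le> T" if "l \<in> {1..m}" for l using time_grids_mem[OF t that] by auto
  define \<theta> where "\<theta> k u = (\<Sum>l\<in>?L. c l * bump k (u - t l))" for k u
  define \<gamma> where "\<gamma> = (\<Sum>l\<in>?R. c l)"
  have \<theta>c: "continuous_on {0..T} (\<theta> k)" for k
    unfolding \<theta>_def by (intro continuous_intros continuous_on_bump)
  have pf: "pairing T (\<theta> k) \<gamma> \<psi> =
      (\<Sum>l\<in>?L. c l * (LBINT u:{0..T}. bump k (u - t l) * \<psi> u))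
      + (\<Sum>l\<in>?R. c l * \<psi> (t l))"
    if \<psi>: "right_regular T B \<psi>" for \<psi> B k
  proof -
    have "(LBINT u:{0..T}. \<theta> k u * \<psi> u) = (LBINT u. (\<Sum>l\<in>?L.
        c l * (indicator {0..T} u * (bump k (u - t l) * \<psi> u))))"
      unfolding set_lebesgue_integral_def \<theta>_def
      by (intro Bochner_Integration.integral_cong refl) (simp add: sum_distrib_left sum_distrib_right mult_ac)
    also have "\<dots> = (\<Sum>l\<in>?L.
        LBINT u. c l * (indicator {0..T} u * (bump k (u - t l) * \<psi> u)))"
      by (intro Bochner_Integration.integral_sum integrable_mult_right bump_integrable[OF T_pos \<psi>]) (auto intro: tm(2))
    also have "\<dots> = (\<Sum>l\<in>?L. c l * (LBINT u:{0..T}. bump k (u - t l) * \<psi> u))"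
      unfolding set_lebesgue_integral_def by (intro sum.cong refl) simp
    finally have 1: "(LBINT u:{0..T}. \<theta> k u * \<psi> u) =
      (\<Sum>l\<in>?L. c l * (LBINT u:{0..T}. bump k (u - t l) * \<psi> u))" .
    have "t l = T" if "l \<in> ?R" for l
      using tm(3)[of l] that by auto
    hence "\<gamma> * \<psi> T = (\<Sum>l\<in>?R. c l * \<psi> (t l))"
      unfolding \<gamma>_def sum_distrib_right by (intro sum.cong) auto
    thus ?thesis using 1 by (simp add: pairing_def)
  qed
  have split: "lin m t c \<psi> = (\<Sum>l\<in>?L. c l * \<psi> (t l)) + (\<Sum>l\<in>?R. c l * \<psi> (t l))"
    for \<psi>
  proof -
    have "lin m t c \<psi> = (\<Sum>l\<in>?L \<union> ?R. c l * \<psi> (t l))"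
      unfolding lin_def by (rule sum.cong) auto
    also have "\<dots> = (\<Sum>l\<in>?L. c l * \<psi> (t l)) + (\<Sum>l\<in>?R. c l * \<psi> (t l))"
      by (rule sum.union_disjoint) auto
    finally show ?thesis .
  qed
  have lim: "(\<lambda>k. pairing T (\<theta> k) \<gamma> \<psi>) \<longlonglongrightarrow> lin m t c \<psi>" if \<psi>: "right_regular T B \<psi>" for \<psi> B
    unfolding pf[OF \<psi>] split by (intro tendsto_intros bump_tendsto[OF T_pos \<psi>]) (auto intro: tm(2))
  obtain B where B: "right_regular T B \<phi>" using cadlag_right_regular[OF T_pos \<phi>] by blast
  define r where "r = (\<Sum>l\<in>?L. \<bar>c l\<bar>) + (\<Sum>l\<in>?R. \<bar>c l\<bar>)"
  let ?E = "\<lambda>k. expectation (\<lambda>w. exp (pairing T (\<theta> k) \<gamma> (A w)))"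
  have "(\<lambda>k. ?E k) \<longlonglongrightarrow> mgf m t c"
    unfolding mgf_def
  proof (rule expectation_exp_tendsto[where r = r])
    show "(\<lambda>w. pairing T (\<theta> k) \<gamma> (A w)) \<in> borel_measurable M" for k
      by (rule pairing_measurable[OF \<theta>c])
    show "(\<lambda>w. lin m t c (A w)) \<in> borel_measurable M" by (intro measurable_lin tm)
    fix w assume w: "w \<in> space M"
    note reg = A_right_regular[OF w]
    show "(\<lambda>k. pairing T (\<theta> k) \<gamma> (A w)) \<longlonglongrightarrow> lin m t c (A w)" by (rule lim[OF reg])
    fix k
    have le: "c l * x \<le> \<bar>c l\<bar> * A w T" if "\<bar>x\<bar> \<le> A w T" for l x
    proof -
      have "c l * x \<le> \<bar>c l\<bar> * \<bar>x\<bar>" using abs_ge_self[of "c l * x"] by (simp add: abs_mult)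
      also have "\<dots> \<le> \<bar>c l\<bar> * A w T" using that by (intro mult_left_mono) auto
      finally show ?thesis .
    qed
    show "pairing T (\<theta> k) \<gamma> (A w) \<le> r * A w T"
      unfolding pf[OF reg] r_def distrib_right sum_distrib_right
    proof (intro add_mono sum_mono le)
      show "\<bar>LBINT u:{0..T}. bump k (u - t l) * A w u\<bar> \<le> A w T" if "l \<in> ?L" for l
        using that tm(2)[of l] by (intro bump_bound[OF T_pos reg]) auto
      show "\<bar>A w (t l)\<bar> \<le> A w T" if "l \<in> ?R" for l
        using that tm(1)[of l] A_nonneg[OF w, of "t l"] A_le_end[OF w, of "t l"] by auto
    qed
  qed
  moreover have "0 < mgf m t c" by (intro mgf_pos tm)
  ultimately have "(\<lambda>k. pairing T (\<theta> k) \<gamma> \<phi> - ln (?E k))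
      \<longlonglongrightarrow> lin m t c \<phi> - Lam m t c"
    unfolding Lam_def by (intro tendsto_diff tendsto_ln lim[OF B]) auto
  hence "(\<lambda>k. ereal (pairing T (\<theta> k) \<gamma> \<phi> - ln (?E k)))
      \<longlonglongrightarrow> ereal (lin m t c \<phi> - Lam m t c)" by (rule tendsto_ereal)
  thus "ereal (lin m t c \<phi> - Lam m t c) \<le> b"
  proof (rule tendsto_upperbound)
    show "\<forall>\<^sub>F k in sequentially.
        ereal (pairing T (\<theta> k) \<gamma> \<phi> - ln (?E k)) \<le> b"
      using b[OF \<theta>c] unfolding Lambda_path_eq[OF \<theta>c] by (intro always_eventually allI) simp
  qed simp
qed

theorem rate_variational:
  assumes "\<phi> \<in> cadlag T"
  shows "rate T M A \<phi> = (SUP (\<theta>, \<gamma>) \<in> {\<theta>. continuous_on {0..T} \<theta>} \<times> UNIV.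
    ereal ((LBINT t:{0..T}. \<theta> t * \<phi> t) + \<gamma> * \<phi> T) - Lambda_path T M A \<theta> \<gamma>)" (is "_ = ?J")
proof (rule antisym)
  show "rate T M A \<phi> \<le> ?J"
  proof (rule rate_le_pairing[OF assms])
    fix \<theta> :: "real \<Rightarrow> real" and \<gamma> assume "continuous_on {0..T} \<theta>"
    thus "ereal (pairing T \<theta> \<gamma> \<phi>) - Lambda_path T M A \<theta> \<gamma> \<le> ?J"
      unfolding pairing_def by (intro SUP_upper2[of "(\<theta>, \<gamma>)"]) auto
  qed
  show "?J \<le> rate T M A \<phi>"
    using pairing_le_rate[OF assms] by (intro SUP_least) (auto simp: pairing_def)
qed

end

section \<open>The arrival process\<close>

locale arrivals = prob_space M for M :: "'a measure" +
  fixes \<Delta> T :: real and \<tau> :: "int \<Rightarrow> 'a \<Rightarrow> real" and f :: "real \<Rightarrow> real"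
  assumes T_pos: "0 < T"
    and indep: "indep_vars (\<lambda>_. borel) \<tau> UNIV"
    and density: "\<And>k. distributed M lborel (\<tau> k) (\<lambda>x. ennreal (f x))"
    and intensity: "(SUP u\<in>{0..T}. \<Sum>\<^sub>\<infinity>k\<in>(UNIV :: int set). ennreal (f (u - of_int k * \<Delta>))) < \<infinity>"
begin

abbreviation A :: "'a \<Rightarrow> real \<Rightarrow> real" where
  "A \<equiv> arrival_process T \<Delta> \<tau>"

definition arr :: "int \<Rightarrow> 'a \<Rightarrow> real" where
  "arr k w = of_int k * \<Delta> + \<tau> k w"

definition K :: real where
  "K = enn2real (SUP u\<in>{0..T}. \<Sum>\<^sub>\<infinity>k\<in>(UNIV :: int set). ennreal (f (u - of_int k * \<Delta>)))"

definition hits :: "'a \<Rightarrow> int set" where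
  "hits w = {k. 0 < arr k w \<and> arr k w \<le> T}"

text \<open>Restricting to a finite window of indices makes the exponential moment a finite product
  of independent factors; the window then grows to all integers.\<close>

definition count :: "real \<Rightarrow> real \<Rightarrow> nat \<Rightarrow> 'a \<Rightarrow> real" where
  "count s t n w = (\<Sum>k\<in>{- int n..int n}. indicator {s<..t} (arr k w))"

lemma \<tau>_meas [measurable]: "\<tau> k \<in> borel_measurable M"
  using indep by (simp add: indep_vars_def)

lemma arr_meas [measurable]: "arr k \<in> borel_measurable M"
  unfolding arr_def[abs_def] by measurable

lemma count_meas [measurable]: "count s t n \<in> borel_measurable M"
  unfolding count_def[abs_def] by measurable

lemma f_meas [measurable]: "(\<lambda>x. ennreal (f x)) \<in> borel_measurable borel"
  using density[of 0] by (simp add: distributed_def)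

lemma A_at: "t \<in> {0..T} \<Longrightarrow>
    A w t = (if finite (hits w) then real (card {k. 0 < arr k w \<and> arr k w \<le> t}) else 0)"
  by (simp add: arrival_process_def hits_def arr_def)

lemma hits_subset_window: "finite (hits w) \<Longrightarrow> \<forall>\<^sub>F n in sequentially. hits w \<subseteq> {- int n..int n}"
proof -
  assume fin: "finite (hits w)"
  define n0 where "n0 = Max (insert 0 ((\<lambda>k. nat \<bar>k\<bar>) ` hits w))"
  have n0: "nat \<bar>k\<bar> \<le> n0" if "k \<in> hits w" for k
    unfolding n0_def using fin that by (intro Max_ge) auto
  have "hits w \<subseteq> {- int n..int n}" if "n \<ge> n0" for n
    using n0 that by fastforce
  thus ?thesis by (auto simp: eventually_sequentially)
qed

lemma A_eq_count:
  assumes fin: "finite (hits w)" and st: "0 \<le> s" "s \<le> t" "t \<le> T" and sub: "hits w \<subseteq> {- int n..int n}"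
  shows "A w t - A w s = count s t n w"
proof -
  have card: "A w u = (\<Sum>k\<in>{- int n..int n}. indicator {0<..u} (arr k w))" if "u \<in> {0..T}" for u
  proof -
    have "{k. 0 < arr k w \<and> arr k w \<le> u} = {k \<in> {- int n..int n}. arr k w \<in> {0<..u}}"
      using sub that by (auto simp: hits_def)
    hence "A w u = real (card {k \<in> {- int n..int n}. arr k w \<in> {0<..u}})" using A_at[OF that] fin by simp
    also have "\<dots> = (\<Sum>k\<in>{k \<in> {- int n..int n}. arr k w \<in> {0<..u}}. indicator {0<..u} (arr k w))"
      by simp
    also have "\<dots> = (\<Sum>k\<in>{- int n..int n}. indicator {0<..u} (arr k w))"
      by (rule sum.mono_neutral_left) (auto simp: indicator_def)
    finally show ?thesis .
  qed
  have "A w t - A w s = (\<Sum>k\<in>{- int n..int n}. indicator {0<..t} (arr k w) - indicator {0<..s} (arr k w))"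
    using card[of t] card[of s] st by (simp add: sum_subtractf)
  also have "\<dots> = count s t n w"
    unfolding count_def using st by (intro sum.cong) (auto simp: indicator_def)
  finally show ?thesis .
qed

text \<open>A set of integers is finite exactly when it is bounded, which is a countable combination
  of events.\<close>

lemma finite_hits_meas [measurable]: "Measurable.pred M (\<lambda>w. finite (hits w))"
proof -
  have iff: "finite (hits w) \<longleftrightarrow> (\<exists>n::nat. \<forall>k::int. 0 < arr k w \<and> arr k w \<le> T \<longrightarrow> \<bar>k\<bar> \<le> int n)" for w
  proof
    assume "finite (hits w)"
    from hits_subset_window[OF this] obtain n where "hits w \<subseteq> {- int n..int n}"
      by (auto simp: eventually_sequentially)
    thus "\<exists>n::nat. \<forall>k::int. 0 < arr k w \<and> arr k w \<le> T \<longrightarrow> \<bar>k\<bar> \<le> int n"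
      by (intro exI[of _ n]) (auto simp: hits_def abs_le_iff)
  next
    assume "\<exists>n::nat. \<forall>k::int. 0 < arr k w \<and> arr k w \<le> T \<longrightarrow> \<bar>k\<bar> \<le> int n"
    then obtain n :: nat where "\<And>k. 0 < arr k w \<and> arr k w \<le> T \<Longrightarrow> \<bar>k\<bar> \<le> int n" by blast
    hence "hits w \<subseteq> {- int n..int n}" unfolding hits_def by fastforce
    thus "finite (hits w)" by (rule finite_subset) simp
  qed
  show ?thesis unfolding iff by measurable
qed

lemma A_zero: "A w 0 = 0"
proof -
  have "{k. 0 < arr k w \<and> arr k w \<le> 0} = {}" by auto
  thus ?thesis using A_at[of 0 w] T_pos by (simp only: card.empty) simp
qed

lemma A_measurable: "t \<in> {0..T} \<Longrightarrow> (\<lambda>w. A w t) \<in> borel_measurable M"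
proof (rule borel_measurable_LIMSEQ_real)
  assume t: "t \<in> {0..T}"
  fix w
  show "(\<lambda>n. if finite (hits w) then count 0 t n w else 0) \<longlonglongrightarrow> A w t"
  proof (cases "finite (hits w)")
    case True
    from hits_subset_window[OF this]
    have "\<forall>\<^sub>F n in sequentially. (if finite (hits w) then count 0 t n w else 0) = A w t"
      by eventually_elim (use A_eq_count[OF True, of 0 t] t True A_zero in auto)
    thus ?thesis by (rule tendsto_eventually)
  next
    case False thus ?thesis using A_at[OF t] by simp
  qed
qed measurable

lemma A_counting_like: "counting_like T (A w)"
proof -
  have "A w s \<le> A w t" if st: "s \<in> {0..T}" "t \<in> {0..T}" "s \<le> t" for s t
  proof (cases "finite (hits w)")
    case True
    have "finite {k. 0 < arr k w \<and> arr k w \<le> t}"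
      by (rule finite_subset[OF _ True]) (use st in \<open>auto simp: hits_def\<close>)
    hence "card {k. 0 < arr k w \<and> arr k w \<le> s} \<le> card {k. 0 < arr k w \<and> arr k w \<le> t}"
      using st by (intro card_mono) auto
    thus ?thesis using A_at st True by simp
  next
    case False thus ?thesis using A_at st by simp
  qed
  thus ?thesis using A_zero by (auto simp: counting_like_def intro!: mono_onI)
qed

text \<open>With finitely many arrivals in (0,T], none falls in (t,s] for s close to t; with
  infinitely many the path is identically zero.\<close>

lemma A_right_continuous:
  assumes t: "t \<in> {0..<T}" shows "(A w \<longlongrightarrow> A w t) (at_right t)"
proof (rule tendsto_eventually)
  have sT: "\<forall>\<^sub>F s in at_right t. t < s \<and> s < T"
    unfolding eventually_at_right_field using t by (intro exI[of _ T]) auto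
  show "\<forall>\<^sub>F s in at_right t. A w s = A w t"
  proof (cases "finite (hits w)")
    case False
    from sT show ?thesis by eventually_elim (use False t A_at in auto)
  next
    case True
    have "\<forall>\<^sub>F s in at_right t. \<forall>k\<in>hits w. arr k w \<le> s \<longrightarrow> arr k w \<le> t"
    proof (intro eventually_ball_finite True ballI)
      fix k
      show "\<forall>\<^sub>F s in at_right t. arr k w \<le> s \<longrightarrow> arr k w \<le> t"
      proof (cases "arr k w \<le> t")
        case False
        thus ?thesis unfolding eventually_at_right_field by (intro exI[of _ "arr k w"]) auto
      qed simp
    qed
    with sT show ?thesis
    proof eventually_elim
      case (elim s)
      hence "{k. 0 < arr k w \<and> arr k w \<le> s} = {k. 0 < arr k w \<and> arr k w \<le> t}"
        by (auto simp: hits_def)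
      moreover have "s \<in> {0..T}" "t \<in> {0..T}" using elim t by auto
      ultimately show ?case by (simp add: A_at)
    qed
  qed
qed

section \<open>Poisson domination of the counts\<close>

lemma intensity_bound:
  assumes u: "u \<in> {0..T}" and F: "finite F"
  shows "(\<Sum>k\<in>F. ennreal (f (u - of_int k * \<Delta>))) \<le> ennreal K"
proof -
  have "(\<Sum>k\<in>F. ennreal (f (u - of_int k * \<Delta>))) \<le> (\<Sum>\<^sub>\<infinity>k\<in>(UNIV :: int set). ennreal (f (u - of_int k * \<Delta>)))"
    using F by (subst nonneg_infsum_complete) (auto intro: SUP_upper)
  also have "\<dots> \<le> (SUP u\<in>{0..T}. \<Sum>\<^sub>\<infinity>k\<in>(UNIV :: int set). ennreal (f (u - of_int k * \<Delta>)))"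
    using u by (rule SUP_upper)
  also have "\<dots> = ennreal K" unfolding K_def using intensity by (simp add: less_top)
  finally show ?thesis .
qed

lemma prob_arr:
  "emeasure M {w \<in> space M. arr k w \<in> {s<..t}} =
    (\<integral>\<^sup>+u. ennreal (f (u - of_int k * \<Delta>)) * indicator {s<..t} u \<partial>lborel)"
proof -
  let ?c = "of_int k * \<Delta>"
  have "{w \<in> space M. arr k w \<in> {s<..t}} = \<tau> k -` {s - ?c<..t - ?c} \<inter> space M"
    by (auto simp: arr_def)
  hence "emeasure M {w \<in> space M. arr k w \<in> {s<..t}} =
      (\<integral>\<^sup>+x. ennreal (f x) * indicator {s - ?c<..t - ?c} x \<partial>lborel)"
    using distributed_emeasure[OF density, of "{s - ?c<..t - ?c}" k] by simp
  also have "\<dots> = (\<integral>\<^sup>+u. ennreal (f (- ?c + 1 * u)) * indicator {s - ?c<..t - ?c} (- ?c + 1 * u) \<partial>lborel)"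
    by (subst nn_integral_real_affine[where c = 1 and t = "- ?c"]) auto
  also have "\<dots> = (\<integral>\<^sup>+u. ennreal (f (u - ?c)) * indicator {s<..t} u \<partial>lborel)"
    by (intro nn_integral_cong) (auto simp: indicator_def)
  finally show ?thesis .
qed

text \<open>The densities are summed before integrating: over any finite set of indices they add up
  to at most K at each u in (s,t]. The bound is free of F and so survives the growth of the
  window.\<close>

lemma sum_prob_arr:
  assumes st: "0 \<le> s" "s \<le> t" "t \<le> T" and F: "finite F"
  shows "(\<Sum>k\<in>F. prob {w \<in> space M. arr k w \<in> {s<..t}}) \<le> K * (t - s)"
proof -
  have m [measurable]: "(\<lambda>u. ennreal (f (u - of_int k * \<Delta>))) \<in> borel_measurable borel" for k
    by (rule measurable_compose[OF _ f_meas]) measurable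
  have "ennreal (\<Sum>k\<in>F. prob {w \<in> space M. arr k w \<in> {s<..t}}) =
      (\<Sum>k\<in>F. emeasure M {w \<in> space M. arr k w \<in> {s<..t}})"
    by (simp add: emeasure_eq_measure sum_ennreal)
  also have "\<dots> = (\<integral>\<^sup>+u. (\<Sum>k\<in>F. ennreal (f (u - of_int k * \<Delta>)) * indicator {s<..t} u) \<partial>lborel)"
    unfolding prob_arr by (rule nn_integral_sum[symmetric]) measurable
  also have "\<dots> \<le> (\<integral>\<^sup>+u. ennreal K * indicator {s<..t} u \<partial>lborel)"
  proof (rule nn_integral_mono)
    fix u
    show "(\<Sum>k\<in>F. ennreal (f (u - of_int k * \<Delta>)) * indicator {s<..t} u) \<le> ennreal K * indicator {s<..t} u"
      unfolding sum_distrib_right[symmetric]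
      using intensity_bound[of u F] F st by (cases "u \<in> {s<..t}") auto
  qed
  also have "\<dots> = ennreal (K * (t - s))"
    using st by (simp add: nn_integral_cmult_indicator ennreal_mult' K_def)
  finally show ?thesis using st by (simp add: ennreal_le_iff K_def)
qed

text \<open>Each indicator contributes 1 + (exp \<alpha> - 1) p \<le> exp ((exp \<alpha> - 1) p),
  and these bounds multiply to a Poisson moment. As \<alpha> \<ge> 0, the sum of the p may be
  replaced by its upper bound.\<close>

lemma count_mgf:
  assumes st: "0 \<le> s" "s \<le> t" "t \<le> T" and \<alpha>: "0 \<le> \<alpha>"
  shows "(\<integral>\<^sup>+w. ennreal (exp (\<alpha> * count s t n w)) \<partial>M) \<le> ennreal (exp (K * (t - s) * (exp \<alpha> - 1)))"
proof -
  let ?F = "{- int n..int n}"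
  define p where "p k = prob {w \<in> space M. arr k w \<in> {s<..t}}" for k
  define g where "g k x = ennreal (exp (\<alpha> * indicator {s<..t} (of_int k * \<Delta> + x :: real)))" for k :: int and x
  have [measurable]: "g k \<in> borel_measurable borel" for k unfolding g_def[abs_def] by measurable
  have ind: "indep_vars (\<lambda>_. borel) (\<lambda>k w. g k (\<tau> k w)) ?F"
    by (rule indep_vars_compose2[where M' = "\<lambda>_. borel"])
      (auto intro: indep_vars_subset[OF indep])
  have one: "(\<integral>\<^sup>+w. g k (\<tau> k w) \<partial>M) \<le> ennreal (exp ((exp \<alpha> - 1) * p k))" for k
  proof -
    let ?E = "{w \<in> space M. arr k w \<in> {s<..t}}"
    have "(\<integral>\<^sup>+w. g k (\<tau> k w) \<partial>M) = (\<integral>\<^sup>+w. 1 + ennreal (exp \<alpha> - 1) * indicator ?E w \<partial>M)"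
    proof (rule nn_integral_cong)
      fix w assume w: "w \<in> space M"
      have "ennreal (exp \<alpha>) = 1 + ennreal (exp \<alpha> - 1)"
        using \<alpha> ennreal_plus[of 1 "exp \<alpha> - 1"] by simp
      thus "g k (\<tau> k w) = 1 + ennreal (exp \<alpha> - 1) * indicator ?E w"
        using w by (auto simp: g_def arr_def indicator_def)
    qed
    also have "\<dots> = 1 + ennreal (exp \<alpha> - 1) * emeasure M ?E"
      by (subst nn_integral_add) (auto simp: nn_integral_cmult_indicator emeasure_space_1)
    also have "\<dots> = ennreal (1 + (exp \<alpha> - 1) * p k)"
      using \<alpha> by (simp add: p_def emeasure_eq_measure ennreal_mult')
    also have "\<dots> \<le> ennreal (exp ((exp \<alpha> - 1) * p k))"
      by (intro ennreal_leI exp_ge_add_one_self)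
    finally show ?thesis .
  qed
  have "(\<integral>\<^sup>+w. ennreal (exp (\<alpha> * count s t n w)) \<partial>M) = (\<integral>\<^sup>+w. (\<Prod>k\<in>?F. g k (\<tau> k w)) \<partial>M)"
  proof (rule nn_integral_cong)
    fix w
    have "exp (\<alpha> * count s t n w) = (\<Prod>k\<in>?F. exp (\<alpha> * indicator {s<..t} (arr k w)))"
      unfolding count_def sum_distrib_left by (rule exp_sum) simp
    also have "ennreal \<dots> = (\<Prod>k\<in>?F. g k (\<tau> k w))"
      unfolding g_def arr_def by (rule prod_ennreal[symmetric]) simp
    finally show "ennreal (exp (\<alpha> * count s t n w)) = (\<Prod>k\<in>?F. g k (\<tau> k w))" .
  qed
  also have "\<dots> = (\<Prod>k\<in>?F. \<integral>\<^sup>+w. g k (\<tau> k w) \<partial>M)"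
    by (rule indep_vars_nn_integral[OF _ ind]) auto
  also have "\<dots> \<le> (\<Prod>k\<in>?F. ennreal (exp ((exp \<alpha> - 1) * p k)))"
    by (intro prod_mono_ennreal one)
  also have "\<dots> = ennreal (exp ((exp \<alpha> - 1) * (\<Sum>k\<in>?F. p k)))"
    by (simp add: prod_ennreal exp_sum[symmetric] sum_distrib_left)
  also have "\<dots> \<le> ennreal (exp (K * (t - s) * (exp \<alpha> - 1)))"
  proof -
    have "(exp \<alpha> - 1) * (\<Sum>k\<in>?F. p k) \<le> (exp \<alpha> - 1) * (K * (t - s))"
      unfolding p_def using \<alpha> by (intro mult_left_mono sum_prob_arr st) auto
    thus ?thesis by (intro ennreal_leI) (simp add: mult.commute)
  qed
  finally show ?thesis .
qed

text \<open>Fatou's lemma along growing windows: on a path with finitely many hits the windowed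
  count eventually equals the increment.\<close>

lemma A_increment_mgf:
  assumes st: "0 \<le> s" "s \<le> t" "t \<le> T" and \<alpha>: "0 \<le> \<alpha>"
  shows "(\<integral>\<^sup>+w. ennreal (exp (\<alpha> * (A w t - A w s))) \<partial>M) \<le> ennreal (exp (K * (t - s) * (exp \<alpha> - 1)))"
proof -
  \<comment> \<open>If \<open>hits w\<close> is infinite the path is zero and so is its increment;
    the matching default is exp 0 = 1.\<close>
  define u where "u n w = ennreal (if finite (hits w) then exp (\<alpha> * count s t n w) else 1)" for n w
  have [measurable]: "u n \<in> borel_measurable M" for n unfolding u_def[abs_def] by measurable
  have "ennreal (exp (\<alpha> * (A w t - A w s))) = liminf (\<lambda>n. u n w)" for w
  proof (cases "finite (hits w)")
    case True
    from hits_subset_window[OF this]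
    have "\<forall>\<^sub>F n in sequentially. u n w = ennreal (exp (\<alpha> * (A w t - A w s)))"
      by eventually_elim (simp add: u_def True A_eq_count[OF True st])
    hence "(\<lambda>n. u n w) \<longlonglongrightarrow> ennreal (exp (\<alpha> * (A w t - A w s)))" by (rule tendsto_eventually)
    thus ?thesis by (intro lim_imp_Liminf[symmetric]) auto
  next
    case False
    thus ?thesis using st A_at[of t w] A_at[of s w] by (simp add: u_def Liminf_const)
  qed
  hence "(\<integral>\<^sup>+w. ennreal (exp (\<alpha> * (A w t - A w s))) \<partial>M) = (\<integral>\<^sup>+w. liminf (\<lambda>n. u n w) \<partial>M)" by simp
  also have "\<dots> \<le> liminf (\<lambda>n. \<integral>\<^sup>+w. u n w \<partial>M)" by (rule nn_integral_liminf) measurable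
  also have "\<dots> \<le> limsup (\<lambda>n. \<integral>\<^sup>+w. u n w \<partial>M)" by (rule Liminf_le_Limsup) simp
  also have "\<dots> \<le> ennreal (exp (K * (t - s) * (exp \<alpha> - 1)))"
  proof (rule Limsup_bounded, rule always_eventually, rule allI)
    fix n
    have "(\<integral>\<^sup>+w. u n w \<partial>M) \<le> (\<integral>\<^sup>+w. ennreal (exp (\<alpha> * count s t n w)) \<partial>M)"
    proof (intro nn_integral_mono)
      fix w
      have "0 \<le> \<alpha> * count s t n w" unfolding count_def using \<alpha> by (intro mult_nonneg_nonneg sum_nonneg) auto
      thus "u n w \<le> ennreal (exp (\<alpha> * count s t n w))" by (auto simp: u_def intro!: ennreal_leI)
    qed
    also have "\<dots> \<le> ennreal (exp (K * (t - s) * (exp \<alpha> - 1)))" by (rule count_mgf[OF st \<alpha>])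
    finally show "(\<integral>\<^sup>+w. u n w \<partial>M) \<le> ennreal (exp (K * (t - s) * (exp \<alpha> - 1)))" .
  qed
  finally show ?thesis .
qed

lemma increasing_process_A: "increasing_process M A T K"
  by unfold_locales
    (auto simp: K_def T_pos A_measurable A_counting_like A_right_continuous A_increment_mgf[unfolded K_def])

lemma A_extensional: "A w \<in> extensional {0..T}"
  by (simp add: arrival_process_def)

end

theorem theorem5p1:
  fixes \<Delta> T :: real
    and M :: "'a measure" and \<tau> :: "int \<Rightarrow> 'a \<Rightarrow> real" and f :: "real \<Rightarrow> real"
    and A :: "'a \<Rightarrow> real \<Rightarrow> real"
    and N :: "'b measure" and X :: "nat \<Rightarrow> 'b \<Rightarrow> real \<Rightarrow> real"
  assumes "\<Delta> > 0" and "T > 0"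
    and "prob_space M"
    and "prob_space.indep_vars M (\<lambda>_. borel) \<tau> UNIV"
    and "\<And>x. 0 \<le> f x"
    and "\<And>k. distributed M lborel (\<tau> k) (\<lambda>x. ennreal (f x))"
    and "A = arrival_process T \<Delta> \<tau>"
    and "prob_space N"
    and "iid_copies T N X M A"
    and "(SUP u\<in>{0..T}. \<Sum>\<^sub>\<infinity>k\<in>(UNIV :: int set). ennreal (f (u - of_int k * \<Delta>))) < \<infinity>"
  shows "satisfies_LDP N (J1_topology T) (sample_mean T X) (rate T M A) \<and>
         good_rate_function (J1_topology T) (rate T M A) \<and>
         (\<forall>\<phi>\<in>cadlag T. rate T M A \<phi> =
           (SUP (\<theta>, \<gamma>) \<in> {\<theta>. continuous_on {0..T} \<theta>} \<times> UNIV.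
              ereal ((LBINT t:{0..T}. \<theta> t * \<phi> t) + \<gamma> * \<phi> T) - Lambda_path T M A \<theta> \<gamma>))"
proof -
  interpret ar: arrivals M \<Delta> T \<tau> f
    using assms by (intro arrivals.intro arrivals_axioms.intro) auto
  have "increasing_process M A T ar.K"
    unfolding \<open>A = arrival_process T \<Delta> \<tau>\<close> by (rule ar.increasing_process_A)
  moreover have "iid_increasing_axioms M A T N X"
    using assms ar.A_extensional by (intro iid_increasing_axioms.intro) auto
  ultimately interpret iid_increasing M A T ar.K N X
    using \<open>prob_space N\<close> by (intro iid_increasing.intro)
  show ?thesis using LDP good_rate rate_variational by blast
qed

end
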